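(* Let $\mathsf{T}$ be a compactly generated triangulated category with a single compact generator $G$ such that $\operatorname{Hom}_{\mathsf{T}}(\Sigma^{i}G,G)=0$ for all $i\gg 0$. If $\langle \mathsf{A},\mathsf{B}\rangle$ is a semiorthogonal decomposition of the category of compact objects $\mathsf{T}^c$, then $\langle \operatorname{Coprod}(\mathsf{A})\cap\mathsf{T}^+_c,\ \operatorname{Coprod}(\mathsf{B})\cap\mathsf{T}^+_c\rangle$ is a semiorthogonal decomposition of $\mathsf{T}^+_c$. If $\mathsf{B}$ is further assumed to be admissible in $\mathsf{T}^c$, then $\langle \operatorname{Coprod}(\mathsf{A})\cap{}^{\mathrm{II}}\mathsf{T}^b_c,\ \operatorname{Coprod}(\mathsf{B})\cap{}^{\mathrm{II}}\mathsf{T}^b_c\rangle$ is a semiorthogonal decomposition of ${}^{\mathrm{II}}\mathsf{T}^b_c$.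
   Context: $\Sigma$ is the shift functor. A semiorthogonal decomposition $\langle \mathsf{A},\mathsf{B}\rangle$ of a triangulated category $\mathsf{S}$ is a pair of strictly full triangulated subcategories with $\operatorname{Hom}(\mathsf{B},\mathsf{A})=0$ such that the smallest triangulated subcategory containing $\mathsf{A}\cup\mathsf{B}$ is $\mathsf{S}$. A strictly full triangulated subcategory is admissible if its inclusion has both adjoints. $\operatorname{Coprod}(\mathsf{C})$ is the closure of $\mathsf{C}$ under coproducts and extensions in $\mathsf{T}$; for $\mathsf{C}=\Sigma\mathsf{C}$ it is the localising subcategory generated by $\mathsf{C}$. For a class $\mathsf{C}$ of objects, $\mathsf{C}^{\perp}$ (resp. ${}^{\perp}\mathsf{C}$) is the full subcategory of $B$ with $\operatorname{Hom}(C,B)=0$ (resp. $\operatorname{Hom}(B,C)=0$) for all $C\in\mathsf{C}$. The co-t-structure on $\mathsf{T}$ generated by $G$ is $({}^{\mathrm{II}}\mathsf{T}_G^{\ge 0},{}^{\mathrm{II}}\mathsf{T}_G^{\le 0})$ with ${}^{\mathrm{II}}\mathsf{T}_G^{\le 0}=(\{\Sigma^iG:i\le 0\})^{\perp}$ and ${}^{\mathrm{II}}\mathsf{T}_G^{\ge 0}={}^{\perp}(\Sigma\,{}^{\mathrm{II}}\mathsf{T}_G^{\le 0})$; put ${}^{\mathrm{II}}\mathsf{T}_G^{\ge n}=\Sigma^{-n}\,{}^{\mathrm{II}}\mathsf{T}_G^{\ge 0}$. Then $\mathsf{T}^+_c$ is the full subcategory of $\mathsf{T}$ of objects $F$ such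 that for every $n\in\mathbb{Z}$ there is a triangle $E_n\to F\to D_n\to\Sigma E_n$ with $E_n\in\mathsf{T}^c$ and $D_n\in{}^{\mathrm{II}}\mathsf{T}_G^{\ge n}$. Moreover ${}^{\mathrm{II}}\mathsf{T}^b_c=\{F\in\mathsf{T}^+_c:\operatorname{Hom}_{\mathsf{T}}(\Sigma^iG,F)=0\text{ for } i\ll 0\}$. *)

theory Defs
  imports "HOL-Algebra.FiniteProduct"
begin

section \<open>Categories, functors and adjunctions\<close>

record ('o, 'm) category =
  Ob :: "'o set"
  Arr :: "'m set"
  Dom :: "'m \<Rightarrow> 'o"
  Cod :: "'m \<Rightarrow> 'o"
  Ident :: "'o \<Rightarrow> 'm"
  Comp :: "'m \<Rightarrow> 'm \<Rightarrow> 'm" (infixl "\<cdot>\<index>" 70)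

definition Hom :: "('o, 'm, 'x) category_scheme \<Rightarrow> 'o \<Rightarrow> 'o \<Rightarrow> 'm set" where
  "Hom T X Y = {f \<in> Arr T. Dom T f = X \<and> Cod T f = Y}"

locale category =
  fixes T :: "('o, 'm, 'x) category_scheme" (structure)
  assumes arr_ends: "f \<in> Arr T \<Longrightarrow> Dom T f \<in> Ob T \<and> Cod T f \<in> Ob T"
    and ident_hom: "X \<in> Ob T \<Longrightarrow> Ident T X \<in> Hom T X X"
    and comp_hom: "\<lbrakk>f \<in> Hom T X Y; g \<in> Hom T Y Z\<rbrakk> \<Longrightarrow> g \<cdot> f \<in> Hom T X Z"
    and comp_ident: "f \<in> Hom T X Y \<Longrightarrow> f \<cdot> Ident T X = f"
    and ident_comp: "f \<in> Hom T X Y \<Longrightarrow> Ident T Y \<cdot> f = f"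
    and comp_assoc: "\<lbrakk>f \<in> Hom T W X; g \<in> Hom T X Y; h \<in> Hom T Y Z\<rbrakk>
      \<Longrightarrow> (h \<cdot> g) \<cdot> f = h \<cdot> (g \<cdot> f)"

definition is_iso :: "('o, 'm, 'x) category_scheme \<Rightarrow> 'm \<Rightarrow> bool" where
  "is_iso T f \<longleftrightarrow> f \<in> Arr T \<and>
     (\<exists>g \<in> Hom T (Cod T f) (Dom T f).
        g \<cdot>\<^bsub>T\<^esub> f = Ident T (Dom T f) \<and> f \<cdot>\<^bsub>T\<^esub> g = Ident T (Cod T f))"

definition isomorphic :: "('o, 'm, 'x) category_scheme \<Rightarrow> 'o \<Rightarrow> 'o \<Rightarrow> bool" where
  "isomorphic T X Y \<longleftrightarrow> (\<exists>f \<in> Hom T X Y. is_iso T f)"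

definition zero_object :: "('o, 'm, 'x) category_scheme \<Rightarrow> 'o \<Rightarrow> bool" where
  "zero_object T Z \<longleftrightarrow> Z \<in> Ob T \<and>
     (\<forall>X \<in> Ob T. (\<exists>!f. f \<in> Hom T Z X) \<and> (\<exists>!f. f \<in> Hom T X Z))"

definition is_coproduct ::
  "('o, 'm, 'x) category_scheme \<Rightarrow> 'i set \<Rightarrow> ('i \<Rightarrow> 'o) \<Rightarrow> 'o \<Rightarrow> ('i \<Rightarrow> 'm) \<Rightarrow> bool" where
  "is_coproduct T I X C \<iota> \<longleftrightarrow> C \<in> Ob T \<and> (\<forall>i\<in>I. X i \<in> Ob T \<and> \<iota> i \<in> Hom T (X i) C) \<and>
     (\<forall>Y \<in> Ob T. \<forall>f. (\<forall>i\<in>I. f i \<in> Hom T (X i) Y) \<longrightarrow>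
        (\<exists>!g. g \<in> Hom T C Y \<and> (\<forall>i\<in>I. g \<cdot>\<^bsub>T\<^esub> \<iota> i = f i)))"

definition full_subcat :: "('o, 'm, 'x) category_scheme \<Rightarrow> 'o set \<Rightarrow> ('o, 'm) category" where
  "full_subcat T S =
     \<lparr>Ob = S, Arr = {f \<in> Arr T. Dom T f \<in> S \<and> Cod T f \<in> S},
      Dom = Dom T, Cod = Cod T, Ident = Ident T, Comp = Comp T\<rparr>"

definition is_functor ::
  "('o, 'm, 'x) category_scheme \<Rightarrow> ('p, 'n, 'y) category_scheme \<Rightarrow> ('o \<Rightarrow> 'p) \<Rightarrow> ('m \<Rightarrow> 'n) \<Rightarrow> bool"
where
  "is_functor C D Fo Fa \<longleftrightarrow>
     Fo ` Ob C \<subseteq> Ob D \<and>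
     (\<forall>X\<in>Ob C. \<forall>Y\<in>Ob C. Fa ` Hom C X Y \<subseteq> Hom D (Fo X) (Fo Y)) \<and>
     (\<forall>X\<in>Ob C. Fa (Ident C X) = Ident D (Fo X)) \<and>
     (\<forall>X\<in>Ob C. \<forall>Y\<in>Ob C. \<forall>Z\<in>Ob C. \<forall>f\<in>Hom C X Y. \<forall>g\<in>Hom C Y Z.
        Fa (g \<cdot>\<^bsub>C\<^esub> f) = Fa g \<cdot>\<^bsub>D\<^esub> Fa f)"

text \<open>The functor \<open>(Fo, Fa)\<close> from \<open>C\<close> to \<open>D\<close> is left adjoint to \<open>(Ho, Ha)\<close> from \<open>D\<close> to \<open>C\<close>.\<close>

definition adjoint_functors ::
  "('o, 'm, 'x) category_scheme \<Rightarrow> ('p, 'n, 'y) category_scheme \<Rightarrow>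
   ('o \<Rightarrow> 'p) \<Rightarrow> ('m \<Rightarrow> 'n) \<Rightarrow> ('p \<Rightarrow> 'o) \<Rightarrow> ('n \<Rightarrow> 'm) \<Rightarrow> bool"
where
  "adjoint_functors C D Fo Fa Ho Ha \<longleftrightarrow>
     is_functor C D Fo Fa \<and> is_functor D C Ho Ha \<and>
     (\<exists>\<phi>. (\<forall>c\<in>Ob C. \<forall>d\<in>Ob D. bij_betw (\<phi> c d) (Hom D (Fo c) d) (Hom C c (Ho d))) \<and>
          (\<forall>c\<in>Ob C. \<forall>c'\<in>Ob C. \<forall>d\<in>Ob D. \<forall>d'\<in>Ob D.
             \<forall>u\<in>Hom C c' c. \<forall>v\<in>Hom D d d'. \<forall>f\<in>Hom D (Fo c) d.
               \<phi> c' d' ((v \<cdot>\<^bsub>D\<^esub> f) \<cdot>\<^bsub>D\<^esub> Fa u) = (Ha v \<cdot>\<^bsub>C\<^esub> \<phi> c d f) \<cdot>\<^bsub>C\<^esub> u))"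

definition has_right_adjoint ::
  "('o, 'm, 'x) category_scheme \<Rightarrow> ('p, 'n, 'y) category_scheme \<Rightarrow> ('o \<Rightarrow> 'p) \<Rightarrow> ('m \<Rightarrow> 'n) \<Rightarrow> bool"
where
  "has_right_adjoint C D Fo Fa \<longleftrightarrow> (\<exists>Ho Ha. adjoint_functors C D Fo Fa Ho Ha)"

definition has_left_adjoint ::
  "('o, 'm, 'x) category_scheme \<Rightarrow> ('p, 'n, 'y) category_scheme \<Rightarrow> ('o \<Rightarrow> 'p) \<Rightarrow> ('m \<Rightarrow> 'n) \<Rightarrow> bool"
where
  "has_left_adjoint C D Fo Fa \<longleftrightarrow> (\<exists>Ho Ha. adjoint_functors D C Ho Ha Fo Fa)"


section \<open>Additive and triangulated categories\<close>

record ('o, 'm) tricat = "('o, 'm) category" +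
  Add :: "'m \<Rightarrow> 'm \<Rightarrow> 'm"
  Zero :: "'o \<Rightarrow> 'o \<Rightarrow> 'm"
  ShO :: "'o \<Rightarrow> 'o"
  ShA :: "'m \<Rightarrow> 'm"
  Tri :: "('m \<times> 'm \<times> 'm) set"

text \<open>The additive group of morphisms, written multiplicatively as a \<open>comm_group\<close>.\<close>

definition hom_group :: "('o, 'm, 'x) tricat_scheme \<Rightarrow> 'o \<Rightarrow> 'o \<Rightarrow> 'm monoid" where
  "hom_group T X Y = \<lparr>carrier = Hom T X Y, mult = Add T, one = Zero T X Y\<rparr>"

locale additive_category = category T
  for T :: "('o, 'm, 'x) tricat_scheme" (structure) +
  assumes hom_comm_group: "\<lbrakk>X \<in> Ob T; Y \<in> Ob T\<rbrakk> \<Longrightarrow> comm_group (hom_group T X Y)"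
    and comp_add: "\<lbrakk>f \<in> Hom T X Y; f' \<in> Hom T X Y; g \<in> Hom T Y Z\<rbrakk>
      \<Longrightarrow> g \<cdot> Add T f f' = Add T (g \<cdot> f) (g \<cdot> f')"
    and add_comp: "\<lbrakk>f \<in> Hom T X Y; g \<in> Hom T Y Z; g' \<in> Hom T Y Z\<rbrakk>
      \<Longrightarrow> Add T g g' \<cdot> f = Add T (g \<cdot> f) (g' \<cdot> f)"
    and ex_zero_object: "\<exists>Z. zero_object T Z"
    and ex_binary_coproduct: "\<lbrakk>X \<in> Ob T; Y \<in> Ob T\<rbrakk>
      \<Longrightarrow> \<exists>C \<iota>. is_coproduct T (UNIV :: bool set) (\<lambda>b. if b then X else Y) C \<iota>"

definition triangle ::
  "('o, 'm, 'x) tricat_scheme \<Rightarrow> 'o \<Rightarrow> 'o \<Rightarrow> 'o \<Rightarrow> 'm \<Rightarrow> 'm \<Rightarrow> 'm \<Rightarrow> bool" where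
  "triangle T X Y Z f g h \<longleftrightarrow>
     f \<in> Hom T X Y \<and> g \<in> Hom T Y Z \<and> h \<in> Hom T Z (ShO T X) \<and> (f, g, h) \<in> Tri T"

text \<open>The shift is an additive automorphism, as in Verdier and Neeman, not merely an
  auto-equivalence, so its integer powers are defined on the nose.\<close>

locale triangulated_category = additive_category T
  for T :: "('o, 'm, 'x) tricat_scheme" (structure) +
  assumes shift_functor: "is_functor T T (ShO T) (ShA T)"
    and shift_bij_ob: "bij_betw (ShO T) (Ob T) (Ob T)"
    and shift_bij_hom: "\<lbrakk>X \<in> Ob T; Y \<in> Ob T\<rbrakk>
      \<Longrightarrow> bij_betw (ShA T) (Hom T X Y) (Hom T (ShO T X) (ShO T Y))"
    and shift_add: "\<lbrakk>f \<in> Hom T X Y; g \<in> Hom T X Y\<rbrakk>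
      \<Longrightarrow> ShA T (Add T f g) = Add T (ShA T f) (ShA T g)"
    and TR1_iso: "\<lbrakk>triangle T X Y Z f g h;
        f' \<in> Hom T X' Y'; g' \<in> Hom T Y' Z'; h' \<in> Hom T Z' (ShO T X');
        a \<in> Hom T X X'; b \<in> Hom T Y Y'; c \<in> Hom T Z Z'; is_iso T a; is_iso T b; is_iso T c;
        b \<cdot> f = f' \<cdot> a; c \<cdot> g = g' \<cdot> b; ShA T a \<cdot> h = h' \<cdot> c\<rbrakk>
      \<Longrightarrow> triangle T X' Y' Z' f' g' h'"
    and TR1_ident: "\<lbrakk>X \<in> Ob T; zero_object T Z\<rbrakk>
      \<Longrightarrow> triangle T X X Z (Ident T X) (Zero T X Z) (Zero T Z (ShO T X))"
    and TR1_cone: "f \<in> Hom T X Y \<Longrightarrow> \<exists>Z g h. triangle T X Y Z f g h"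
    and TR2: "\<lbrakk>f \<in> Hom T X Y; g \<in> Hom T Y Z; h \<in> Hom T Z (ShO T X)\<rbrakk>
      \<Longrightarrow> triangle T X Y Z f g h \<longleftrightarrow>
          triangle T Y Z (ShO T X) g h (inv\<^bsub>hom_group T (ShO T X) (ShO T Y)\<^esub> (ShA T f))"
    and TR3: "\<lbrakk>triangle T X Y Z f g h; triangle T X' Y' Z' f' g' h';
        a \<in> Hom T X X'; b \<in> Hom T Y Y'; b \<cdot> f = f' \<cdot> a\<rbrakk>
      \<Longrightarrow> \<exists>c \<in> Hom T Z Z'. c \<cdot> g = g' \<cdot> b \<and> ShA T a \<cdot> h = h' \<cdot> c"
    and TR4: "\<lbrakk>triangle T X Y Z' f f' f''; triangle T Y Z X' g g' g'';
        triangle T X Z Y' (g \<cdot> f) h' h''\<rbrakk>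
      \<Longrightarrow> \<exists>u v. triangle T Z' Y' X' u v (ShA T f' \<cdot> g'') \<and>
            u \<cdot> f' = h' \<cdot> g \<and> h'' \<cdot> u = f'' \<and> v \<cdot> h' = g' \<and> g'' \<cdot> v = ShA T f \<cdot> h''"

definition shift :: "('o, 'm, 'x) tricat_scheme \<Rightarrow> int \<Rightarrow> 'o \<Rightarrow> 'o" where
  "shift T i X = (if 0 \<le> i then (ShO T ^^ nat i) X
                  else (inv_into (Ob T) (ShO T) ^^ nat (- i)) X)"

definition hom_zero :: "('o, 'm, 'x) tricat_scheme \<Rightarrow> 'o \<Rightarrow> 'o \<Rightarrow> bool" where
  "hom_zero T X Y \<longleftrightarrow> Hom T X Y = {Zero T X Y}"

definition right_perp :: "('o, 'm, 'x) tricat_scheme \<Rightarrow> 'o set \<Rightarrow> 'o set" where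
  "right_perp T C = {B \<in> Ob T. \<forall>X\<in>C. hom_zero T X B}"

definition left_perp :: "('o, 'm, 'x) tricat_scheme \<Rightarrow> 'o set \<Rightarrow> 'o set" where
  "left_perp T C = {B \<in> Ob T. \<forall>X\<in>C. hom_zero T B X}"

text \<open>Full subcategories are represented by their sets of objects.\<close>

definition triangulated_subcat :: "('o, 'm, 'x) tricat_scheme \<Rightarrow> 'o set \<Rightarrow> bool" where
  "triangulated_subcat T S \<longleftrightarrow> S \<subseteq> Ob T \<and>
     (\<forall>Z. zero_object T Z \<longrightarrow> Z \<in> S) \<and>
     (\<forall>X\<in>S. \<forall>Y. isomorphic T X Y \<longrightarrow> Y \<in> S) \<and>
     (\<forall>X\<in>S. shift T 1 X \<in> S \<and> shift T (- 1) X \<in> S) \<and>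
     (\<forall>X Y Z f g h. triangle T X Y Z f g h \<and> X \<in> S \<and> Y \<in> S \<longrightarrow> Z \<in> S)"

definition triangulated_hull :: "('o, 'm, 'x) tricat_scheme \<Rightarrow> 'o set \<Rightarrow> 'o set" where
  "triangulated_hull T C = \<Inter> {S. triangulated_subcat T S \<and> C \<subseteq> S}"

definition semiorthogonal_decomposition ::
  "('o, 'm, 'x) tricat_scheme \<Rightarrow> 'o set \<Rightarrow> 'o set \<Rightarrow> 'o set \<Rightarrow> bool" where
  "semiorthogonal_decomposition T S A B \<longleftrightarrow>
     triangulated_subcat T S \<and>
     triangulated_subcat T A \<and> A \<subseteq> S \<and>
     triangulated_subcat T B \<and> B \<subseteq> S \<and>
     (\<forall>b\<in>B. \<forall>a\<in>A. hom_zero T b a) \<and>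
     triangulated_hull T (A \<union> B) = S"

definition admissible :: "('o, 'm, 'x) tricat_scheme \<Rightarrow> 'o set \<Rightarrow> 'o set \<Rightarrow> bool" where
  "admissible T S B \<longleftrightarrow> triangulated_subcat T B \<and> B \<subseteq> S \<and>
     has_left_adjoint (full_subcat T B) (full_subcat T S) (\<lambda>X. X) (\<lambda>f. f) \<and>
     has_right_adjoint (full_subcat T B) (full_subcat T S) (\<lambda>X. X) (\<lambda>f. f)"


section \<open>Small coproducts and compact generation\<close>

text \<open>\<open>U\<close> is the collection of small index sets. Up to bijection, the sets in a Grothendieck
  universe are an instance; closure under power sets is not required.\<close>

locale smallness =
  fixes U :: "'i set set"
  assumes small_infinite: "\<exists>A \<in> U. infinite A"
    and small_image: "\<lbrakk>A \<in> U; B \<subseteq> f ` A\<rbrakk> \<Longrightarrow> B \<in> U"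
    and small_Union: "\<lbrakk>A \<in> U; \<And>a. a \<in> A \<Longrightarrow> F a \<in> U\<rbrakk> \<Longrightarrow> (\<Union>a\<in>A. F a) \<in> U"

text \<open>The second condition says that the canonical homomorphism from the direct sum of the groups
  \<open>Hom(X, Y i)\<close> to \<open>Hom(X, C)\<close> is bijective, for every coproduct \<open>C\<close> of the \<open>Y i\<close>; elements of
  the direct sum are the finitely supported families, and \<open>finprod\<close> is a finite sum
  in \<open>hom_group\<close>.\<close>

definition compact_object ::
  "('o, 'm, 'x) tricat_scheme \<Rightarrow> 'i set set \<Rightarrow> 'o \<Rightarrow> bool" where
  "compact_object T U X \<longleftrightarrow> X \<in> Ob T \<and>
     (\<forall>I\<in>U. \<forall>Y C \<iota>. is_coproduct T I Y C \<iota> \<longrightarrow>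
        bij_betw
          (\<lambda>f. finprod (hom_group T X C) (\<lambda>i. \<iota> i \<cdot>\<^bsub>T\<^esub> f i) {i \<in> I. f i \<noteq> Zero T X (Y i)})
          {f \<in> (\<Pi>\<^sub>E i\<in>I. Hom T X (Y i)). finite {i \<in> I. f i \<noteq> Zero T X (Y i)}}
          (Hom T X C))"

definition compact_objects :: "('o, 'm, 'x) tricat_scheme \<Rightarrow> 'i set set \<Rightarrow> 'o set" where
  "compact_objects T U = {X. compact_object T U X}"

text \<open>Local smallness is only imposed on morphisms out of compact objects. If all hom-sets were
  required to be small, then for nonzero \<open>X\<close> the hom-set from an \<open>I\<close>-fold coproduct of
  \<open>X\<close> to \<open>X\<close>, which has at least as many elements as \<open>Pow I\<close>, would force smallness to
  be closed under power sets. With countable coproducts this excludes every nonzero category that can be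
  built in HOL without a universe axiom. Categories with all hom-sets small are a special case.\<close>

locale compactly_generated = triangulated_category T + smallness U
  for T :: "('o, 'm, 'x) tricat_scheme" (structure) and U :: "'i set set" +
  fixes G :: 'o
  assumes ex_coproduct: "\<lbrakk>I \<in> U; \<And>i. i \<in> I \<Longrightarrow> Z i \<in> Ob T\<rbrakk> \<Longrightarrow> \<exists>C \<iota>. is_coproduct T I Z C \<iota>"
    and small_hom: "\<lbrakk>X \<in> compact_objects T U; Y \<in> Ob T\<rbrakk>
      \<Longrightarrow> \<exists>A\<in>U. \<exists>e. bij_betw e A (Hom T X Y)"
    and generator_compact: "G \<in> compact_objects T U"
    and generator: "\<lbrakk>X \<in> Ob T; \<And>i. hom_zero T (shift T i G) X\<rbrakk> \<Longrightarrow> zero_object T X"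

text \<open>Coproducts of one-element families make this closure strict.\<close>

inductive_set Coprod :: "('o, 'm, 'x) tricat_scheme \<Rightarrow> 'i set set \<Rightarrow> 'o set \<Rightarrow> 'o set"
  for T :: "('o, 'm, 'x) tricat_scheme" and U :: "'i set set" and C :: "'o set"
where
  base: "X \<in> C \<Longrightarrow> X \<in> Coprod T U C"
| coproduct: "\<lbrakk>I \<in> U; \<And>i. i \<in> I \<Longrightarrow> X i \<in> Coprod T U C; is_coproduct T I X Y \<iota>\<rbrakk>
    \<Longrightarrow> Y \<in> Coprod T U C"
| extension: "\<lbrakk>X \<in> Coprod T U C; Z \<in> Coprod T U C; triangle T X Y Z f g h\<rbrakk>
    \<Longrightarrow> Y \<in> Coprod T U C"


section \<open>The co-t-structure generated by an object\<close>

definition co_t_le0 :: "('o, 'm, 'x) tricat_scheme \<Rightarrow> 'o \<Rightarrow> 'o set" where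
  "co_t_le0 T G = right_perp T {shift T i G | i. i \<le> 0}"

definition co_t_ge0 :: "('o, 'm, 'x) tricat_scheme \<Rightarrow> 'o \<Rightarrow> 'o set" where
  "co_t_ge0 T G = left_perp T (shift T 1 ` co_t_le0 T G)"

definition co_t_ge :: "('o, 'm, 'x) tricat_scheme \<Rightarrow> 'o \<Rightarrow> int \<Rightarrow> 'o set" where
  "co_t_ge T G n = shift T (- n) ` co_t_ge0 T G"

definition T_plus_c :: "('o, 'm, 'x) tricat_scheme \<Rightarrow> 'i set set \<Rightarrow> 'o \<Rightarrow> 'o set" where
  "T_plus_c T U G = {F \<in> Ob T. \<forall>n. \<exists>E \<in> compact_objects T U. \<exists>D \<in> co_t_ge T G n.
     \<exists>f g h. triangle T E F D f g h}"

definition T_b_c :: "('o, 'm, 'x) tricat_scheme \<Rightarrow> 'i set set \<Rightarrow> 'o \<Rightarrow> 'o set" where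
  "T_b_c T U G = {F \<in> T_plus_c T U G. \<exists>N. \<forall>i\<le>N. hom_zero T (shift T i G) F}"

end

theory Submission
  imports Defs
begin

text \<open>
  Since compact objects are invisible to coproducts, \<open>\<langle>A, B\<rangle>\<close> extends to a decomposition
  \<open>\<langle>Coprod A, Coprod B\<rangle>\<close> of \<open>T\<close>: every \<open>F\<close> lies in a triangle \<open>b \<rightarrow> F \<rightarrow> a\<close>, and the point is that
  \<open>a\<close> inherits the finiteness of \<open>F\<close>. A triangle \<open>E \<rightarrow> F \<rightarrow> D\<close> with \<open>E\<close> compact and \<open>D\<close> in
  \<open>T\<^sup>\<ge>\<^sup>m\<close> induces \<open>a\<^sub>E \<rightarrow> a \<rightarrow> a\<^sub>D\<close>, where \<open>a\<^sub>E\<close> is compact. As \<open>T\<^sup>\<ge>\<^sup>m\<close> is a left orthogonal and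
  \<open>D \<mapsto> a\<^sub>D\<close> is a left adjoint, \<open>a\<^sub>D\<close> lies in \<open>T\<^sup>\<ge>\<^sup>m\<^sup>-\<^sup>c\<close>, where \<open>c\<close> depends only on the compact object
  \<open>a\<^sub>G\<close>. For the bounded version, the left adjoint of the inclusion of \<open>B\<close> supplies a compact \<open>L\<close> with
  \<open>Hom(\<Sigma>\<^sup>i G, b) = Hom(\<Sigma>\<^sup>i L, b) = Hom(\<Sigma>\<^sup>i L, F)\<close>, which vanishes for \<open>i \<ll> 0\<close>.
\<close>

section \<open>Additive categories\<close>

text \<open>Three points are left out of the overview. Nothing makes \<open>A\<close> or
  \<open>B\<close> small, and only hom-sets out of compact objects are known to be small, so the
  triangles b -> F -> a are built by attaching cells along the shifts of a single compact object;
  decomposing \<open>G\<close> itself into \<open>G_B\<close> and \<open>G_A\<close> supplies the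
  objects along which to localize. The constant c expresses boundedness of compact objects: a
  compact K has no morphism to Y as soon as all sufficiently low shifts of \<open>G\<close> have
  none, with a bound independent of Y. Uniformity is proved by contradiction: a sequence of
  counterexamples is collected in one coproduct that turns out to be a product as well. Finally,
  closure of \<open>T_plus_c\<close> under extensions is not formal: approximations of the two outer
  terms combine only if the compact part of one has no morphism to the shifted tail of the other.
  The vanishing of Hom(\<Sigma>^i G, G) for large i ensures this, because it makes deep tails
  invisible to any given compact object.\<close>

context category
begin

lemma Hom_ObD: "f \<in> Hom T X Y \<Longrightarrow> X \<in> Ob T \<and> Y \<in> Ob T"
  using arr_ends by (auto simp: Hom_def)

lemma is_isoI:
  assumes "f \<in> Hom T X Y" "g \<in> Hom T Y X" "g \<cdot> f = Ident T X" "f \<cdot> g = Ident T Y"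
  shows "is_iso T f"
  using assms by (auto simp: is_iso_def Hom_def)

lemma is_isoE:
  assumes "is_iso T f" "f \<in> Hom T X Y"
  obtains g where "g \<in> Hom T Y X" "g \<cdot> f = Ident T X" "f \<cdot> g = Ident T Y"
  using assms by (auto simp: is_iso_def Hom_def)

lemma is_iso_ident: "X \<in> Ob T \<Longrightarrow> is_iso T (Ident T X)"
  by (meson comp_ident ident_hom is_isoI)

lemma coproduct_map:
  assumes "is_coproduct T I X C \<iota>" "\<And>i. i \<in> I \<Longrightarrow> f i \<in> Hom T (X i) Y" "Y \<in> Ob T"
  obtains g where "g \<in> Hom T C Y" "\<And>i. i \<in> I \<Longrightarrow> g \<cdot> \<iota> i = f i"
  using assms unfolding is_coproduct_def by metis

lemma coproduct_eqI:
  assumes C: "is_coproduct T I X C \<iota>" and f: "f \<in> Hom T C Y" and g: "g \<in> Hom T C Y"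
    and eq: "\<And>i. i \<in> I \<Longrightarrow> f \<cdot> \<iota> i = g \<cdot> \<iota> i"
  shows "f = g"
proof -
  have Y: "Y \<in> Ob T" using f Hom_ObD by blast
  have "\<forall>i\<in>I. g \<cdot> \<iota> i \<in> Hom T (X i) Y"
    using C g comp_hom unfolding is_coproduct_def by blast
  then have "\<exists>!h. h \<in> Hom T C Y \<and> (\<forall>i\<in>I. h \<cdot> \<iota> i = g \<cdot> \<iota> i)"
    using C Y unfolding is_coproduct_def by simp
  then show ?thesis using f g eq by blast
qed

lemma is_coproductD:
  assumes "is_coproduct T I X C \<iota>"
  shows "C \<in> Ob T" "i \<in> I \<Longrightarrow> X i \<in> Ob T" "i \<in> I \<Longrightarrow> \<iota> i \<in> Hom T (X i) C"
  using assms unfolding is_coproduct_def by auto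

lemma is_coproductI:
  assumes "C \<in> Ob T" "\<And>i. i \<in> I \<Longrightarrow> X i \<in> Ob T" "\<And>i. i \<in> I \<Longrightarrow> \<iota> i \<in> Hom T (X i) C"
    and "\<And>Y f. \<lbrakk>Y \<in> Ob T; \<And>i. i \<in> I \<Longrightarrow> f i \<in> Hom T (X i) Y\<rbrakk>
      \<Longrightarrow> \<exists>g \<in> Hom T C Y. \<forall>i\<in>I. g \<cdot> \<iota> i = f i"
    and "\<And>Y g h. \<lbrakk>Y \<in> Ob T; g \<in> Hom T C Y; h \<in> Hom T C Y; \<And>i. i \<in> I \<Longrightarrow> g \<cdot> \<iota> i = h \<cdot> \<iota> i\<rbrakk> \<Longrightarrow> g = h"
  shows "is_coproduct T I X C \<iota>"
  unfolding is_coproduct_def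
proof (intro conjI ballI allI impI)
  fix Y f assume Y: "Y \<in> Ob T" and f: "\<forall>i\<in>I. f i \<in> Hom T (X i) Y"
  obtain g where g: "g \<in> Hom T C Y" "\<forall>i\<in>I. g \<cdot> \<iota> i = f i" using assms(4)[of Y f] Y f by blast
  show "\<exists>!g. g \<in> Hom T C Y \<and> (\<forall>i\<in>I. g \<cdot> \<iota> i = f i)"
  proof (rule ex1I[of _ g])
    fix h assume "h \<in> Hom T C Y \<and> (\<forall>i\<in>I. h \<cdot> \<iota> i = f i)"
    then show "h = g" using assms(5)[of Y h g] Y g by simp
  qed (use g in auto)
qed (use assms in auto)

text \<open>Index sets in \<open>U\<close> have one fixed type, whereas the families used below are
  indexed by naturals, compact objects or morphisms; injections pass between the two.\<close>

lemma coproduct_reindex: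
  assumes C: "is_coproduct T (e ` A) X C \<iota>" and e: "inj_on e A"
  shows "is_coproduct T A (X \<circ> e) C (\<iota> \<circ> e)"
proof (rule is_coproductI)
  fix Y f assume Y: "Y \<in> Ob T" and f: "\<And>i. i \<in> A \<Longrightarrow> f i \<in> Hom T ((X \<circ> e) i) Y"
  have "\<And>i. i \<in> e ` A \<Longrightarrow> f (inv_into A e i) \<in> Hom T (X i) Y"
    using f e by (auto simp: inv_into_f_f)
  from coproduct_map[OF C this Y] obtain g where
    g: "g \<in> Hom T C Y" "\<And>i. i \<in> e ` A \<Longrightarrow> g \<cdot> \<iota> i = f (inv_into A e i)"
    by blast
  show "\<exists>g \<in> Hom T C Y. \<forall>i\<in>A. g \<cdot> (\<iota> \<circ> e) i = f i"
    using g e by (intro bexI[of _ g]) (auto simp: inv_into_f_f)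
next
  fix Y g h assume "Y \<in> Ob T" "g \<in> Hom T C Y" "h \<in> Hom T C Y" "\<And>i. i \<in> A \<Longrightarrow> g \<cdot> (\<iota> \<circ> e) i = h \<cdot> (\<iota> \<circ> e) i"
  then show "g = h" using coproduct_eqI[OF C, of g Y h] by auto
qed (use is_coproductD[OF C] in auto)

lemma coproduct_reindex':
  assumes C: "is_coproduct T A X C \<iota>" and e: "inj_on e A"
  shows "is_coproduct T (e ` A) (X \<circ> inv_into A e) C (\<iota> \<circ> inv_into A e)"
proof -
  have A: "A = inv_into A e ` e ` A" using e by simp
  show ?thesis
    by (rule coproduct_reindex) (use C A e inj_on_inv_into[of "e ` A" e A] in auto)
qed

end

context additive_category
begin

text \<open>The ends of \<open>g\<close> select the hom group in which the inverse is taken, so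
  differences can be written without naming objects.\<close>

definition sub :: "'m \<Rightarrow> 'm \<Rightarrow> 'm" where
  "sub f g = Add T f (inv\<^bsub>hom_group T (Dom T g) (Cod T g)\<^esub> g)"

lemma zero_hom: "\<lbrakk>X \<in> Ob T; Y \<in> Ob T\<rbrakk> \<Longrightarrow> Zero T X Y \<in> Hom T X Y"
  using comm_group.axioms(2)[OF hom_comm_group] group.is_monoid monoid.one_closed
  by (force simp: hom_group_def)

context
  fixes X Y
  assumes XY: "X \<in> Ob T" "Y \<in> Ob T"
begin

interpretation H: comm_group "hom_group T X Y" using hom_comm_group XY .

lemma add_hom_aux: "\<lbrakk>f \<in> Hom T X Y; g \<in> Hom T X Y\<rbrakk> \<Longrightarrow> Add T f g \<in> Hom T X Y"
  using H.m_closed by (simp add: hom_group_def)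

lemma sub_hom_aux: "\<lbrakk>f \<in> Hom T X Y; g \<in> Hom T X Y\<rbrakk> \<Longrightarrow> sub f g \<in> Hom T X Y"
  using H.m_closed[of f "inv\<^bsub>hom_group T X Y\<^esub> g"] H.inv_closed[of g]
  by (simp add: hom_group_def sub_def Hom_def)

lemma add_zero_aux: "f \<in> Hom T X Y \<Longrightarrow> Add T f (Zero T X Y) = f"
  using H.r_one by (simp add: hom_group_def)

lemma add_zero_left_aux: "f \<in> Hom T X Y \<Longrightarrow> Add T (Zero T X Y) f = f"
  using H.l_one by (simp add: hom_group_def)

lemma sub_add_aux: assumes "f \<in> Hom T X Y" "g \<in> Hom T X Y" shows "Add T (sub f g) g = f"
proof -
  have "(f \<otimes>\<^bsub>hom_group T X Y\<^esub> inv\<^bsub>hom_group T X Y\<^esub> g) \<otimes>\<^bsub>hom_group T X Y\<^esub> g = f"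
    using assms H.inv_solve_right by (metis H.inv_closed H.m_closed hom_group_def partial_object.select_convs(1))
  then show ?thesis using assms by (simp add: hom_group_def sub_def Hom_def)
qed

lemma add_cancel_aux: "\<lbrakk>f \<in> Hom T X Y; g \<in> Hom T X Y; h \<in> Hom T X Y; Add T f h = Add T g h\<rbrakk> \<Longrightarrow> f = g"
  using H.right_cancel[of h f g] by (simp add: hom_group_def)

lemma inv_hom_aux: "f \<in> Hom T X Y \<Longrightarrow> inv\<^bsub>hom_group T X Y\<^esub> f \<in> Hom T X Y"
  using H.inv_closed[of f] by (simp add: hom_group_def)

lemma add_inv_aux: "f \<in> Hom T X Y \<Longrightarrow> Add T f (inv\<^bsub>hom_group T X Y\<^esub> f) = Zero T X Y"
  using H.r_inv[of f] by (simp add: hom_group_def)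

lemma inv_zero_aux: "inv\<^bsub>hom_group T X Y\<^esub> (Zero T X Y) = Zero T X Y"
  using H.inv_one by (simp add: hom_group_def)

end

lemma
  assumes "f \<in> Hom T X Y"
  shows add_hom: "g \<in> Hom T X Y \<Longrightarrow> Add T f g \<in> Hom T X Y"
    and sub_hom: "g \<in> Hom T X Y \<Longrightarrow> sub f g \<in> Hom T X Y"
    and add_zero: "Add T f (Zero T X Y) = f"
    and add_zero_left: "Add T (Zero T X Y) f = f"
    and sub_add: "g \<in> Hom T X Y \<Longrightarrow> Add T (sub f g) g = f"
    and add_cancel: "\<lbrakk>g \<in> Hom T X Y; h \<in> Hom T X Y; Add T f h = Add T g h\<rbrakk> \<Longrightarrow> f = g"
    and inv_hom: "inv\<^bsub>hom_group T X Y\<^esub> f \<in> Hom T X Y"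
    and add_inv: "Add T f (inv\<^bsub>hom_group T X Y\<^esub> f) = Zero T X Y"
  using Hom_ObD[OF assms] assms add_hom_aux sub_hom_aux add_zero_aux add_zero_left_aux sub_add_aux
    add_cancel_aux[of X Y f g h] inv_hom_aux add_inv_aux by auto

lemmas inv_zero = inv_zero_aux

lemma sub_eq_zero_iff:
  assumes "f \<in> Hom T X Y" "g \<in> Hom T X Y"
  shows "sub f g = Zero T X Y \<longleftrightarrow> f = g"
proof
  assume "sub f g = Zero T X Y"
  then show "f = g" using sub_add[OF assms] add_zero_left assms by simp
next
  assume "f = g"
  then have "Add T (sub f g) g = Add T (Zero T X Y) g"
    using sub_add assms add_zero_left by simp
  then show "sub f g = Zero T X Y"
    using add_cancel assms sub_hom zero_hom Hom_ObD by meson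
qed

lemma comp_zero: assumes "g \<in> Hom T Y Z" "X \<in> Ob T" shows "g \<cdot> Zero T X Y = Zero T X Z"
proof -
  have Y: "Y \<in> Ob T" and Z: "Z \<in> Ob T" using assms Hom_ObD by blast+
  let ?z = "Zero T X Y"
  have z: "?z \<in> Hom T X Y" using zero_hom assms Y by blast
  have gz: "g \<cdot> ?z \<in> Hom T X Z" using comp_hom z assms by blast
  have "Add T (g \<cdot> ?z) (g \<cdot> ?z) = Add T (Zero T X Z) (g \<cdot> ?z)"
    using comp_add[OF z z assms(1)] add_zero[OF z] add_zero_left[OF gz] by simp
  then show ?thesis using add_cancel[OF gz _ gz] zero_hom assms(2) Z by blast
qed

lemma zero_comp: assumes "f \<in> Hom T X Y" "Z \<in> Ob T" shows "Zero T Y Z \<cdot> f = Zero T X Z"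
proof -
  have Y: "Y \<in> Ob T" and X: "X \<in> Ob T" using assms Hom_ObD by blast+
  let ?z = "Zero T Y Z"
  have z: "?z \<in> Hom T Y Z" using zero_hom assms Y by blast
  have gz: "?z \<cdot> f \<in> Hom T X Z" using comp_hom z assms by blast
  have "Add T (?z \<cdot> f) (?z \<cdot> f) = Add T (Zero T X Z) (?z \<cdot> f)"
    using add_comp[OF assms(1) z z] add_zero[OF z] add_zero_left[OF gz] by simp
  then show ?thesis using add_cancel[OF gz _ gz] zero_hom assms(2) X by blast
qed

lemma comp_sub:
  assumes f: "f \<in> Hom T X Y" and f': "f' \<in> Hom T X Y" and g: "g \<in> Hom T Y Z"
  shows "g \<cdot> sub f f' = sub (g \<cdot> f) (g \<cdot> f')"
proof -
  note s = sub_hom[OF f f']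
  have "Add T (g \<cdot> sub f f') (g \<cdot> f') = g \<cdot> f"
    using comp_add[OF s f' g] sub_add[OF f f'] by simp
  also have "\<dots> = Add T (sub (g \<cdot> f) (g \<cdot> f')) (g \<cdot> f')"
    using sub_add[OF comp_hom[OF f g] comp_hom[OF f' g]] by simp
  finally show ?thesis
    by (meson add_cancel comp_hom f f' g s sub_hom)
qed

lemma sub_comp:
  assumes f: "f \<in> Hom T X Y" and g: "g \<in> Hom T Y Z" and g': "g' \<in> Hom T Y Z"
  shows "sub g g' \<cdot> f = sub (g \<cdot> f) (g' \<cdot> f)"
proof -
  note s = sub_hom[OF g g']
  have "Add T (sub g g' \<cdot> f) (g' \<cdot> f) = g \<cdot> f"
    using add_comp[OF f s g'] sub_add[OF g g'] by simp
  also have "\<dots> = Add T (sub (g \<cdot> f) (g' \<cdot> f)) (g' \<cdot> f)"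
    using sub_add[OF comp_hom[OF f g] comp_hom[OF f g']] by simp
  finally show ?thesis
    by (meson add_cancel comp_hom f g g' s sub_hom)
qed

lemma comp_inv:
  assumes f: "f \<in> Hom T X Y" and g: "g \<in> Hom T Y Z"
  shows "g \<cdot> inv\<^bsub>hom_group T X Y\<^esub> f = inv\<^bsub>hom_group T X Z\<^esub> (g \<cdot> f)"
proof -
  have gf: "g \<cdot> f \<in> Hom T X Z" using f g comp_hom by blast
  have X: "X \<in> Ob T" and Z: "Z \<in> Ob T" using Hom_ObD f g by blast+
  interpret H: comm_group "hom_group T X Z" using hom_comm_group X Z .
  have "Add T (g \<cdot> f) (g \<cdot> inv\<^bsub>hom_group T X Y\<^esub> f) = Zero T X Z"
    using comp_add[OF f inv_hom[OF f] g] add_inv[OF f] comp_zero[OF g X] by simp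
  moreover have "g \<cdot> inv\<^bsub>hom_group T X Y\<^esub> f \<in> Hom T X Z" using inv_hom[OF f] g comp_hom by blast
  ultimately show ?thesis using H.inv_equality[of "g \<cdot> inv\<^bsub>hom_group T X Y\<^esub> f" "g \<cdot> f"] gf
    H.m_comm by (metis hom_group_def monoid.select_convs(1,2) partial_object.select_convs(1))
qed

lemma inv_comp:
  assumes f: "f \<in> Hom T X Y" and g: "g \<in> Hom T Y Z"
  shows "inv\<^bsub>hom_group T Y Z\<^esub> g \<cdot> f = inv\<^bsub>hom_group T X Z\<^esub> (g \<cdot> f)"
proof -
  have gf: "g \<cdot> f \<in> Hom T X Z" using f g comp_hom by blast
  have X: "X \<in> Ob T" and Z: "Z \<in> Ob T" using Hom_ObD f g by blast+
  interpret H: comm_group "hom_group T X Z" using hom_comm_group X Z .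
  have "Add T (g \<cdot> f) (inv\<^bsub>hom_group T Y Z\<^esub> g \<cdot> f) = Zero T X Z"
    using add_comp[OF f g inv_hom[OF g]] add_inv[OF g] zero_comp[OF f Z] by simp
  moreover have "inv\<^bsub>hom_group T Y Z\<^esub> g \<cdot> f \<in> Hom T X Z" using inv_hom[OF g] f comp_hom by blast
  ultimately show ?thesis using H.inv_equality[of "inv\<^bsub>hom_group T Y Z\<^esub> g \<cdot> f" "g \<cdot> f"] gf
    H.m_comm by (metis hom_group_def monoid.select_convs(1,2) partial_object.select_convs(1))
qed

lemma inv_inject:
  assumes f: "f \<in> Hom T X Y" and g: "g \<in> Hom T X Y"
    and eq: "inv\<^bsub>hom_group T X Y\<^esub> f = inv\<^bsub>hom_group T X Y\<^esub> g"
  shows "f = g"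
proof -
  have X: "X \<in> Ob T" and Y: "Y \<in> Ob T" using Hom_ObD f by blast+
  interpret H: comm_group "hom_group T X Y" using hom_comm_group X Y .
  show ?thesis using H.inv_inj f g eq by (auto simp: inj_on_def hom_group_def)
qed

lemma hom_zeroD: "\<lbrakk>hom_zero T X Y; f \<in> Hom T X Y\<rbrakk> \<Longrightarrow> f = Zero T X Y"
  by (auto simp: hom_zero_def)

lemma hom_zeroI: "\<lbrakk>X \<in> Ob T; Y \<in> Ob T; \<And>f. f \<in> Hom T X Y \<Longrightarrow> f = Zero T X Y\<rbrakk> \<Longrightarrow> hom_zero T X Y"
  using zero_hom by (auto simp: hom_zero_def)

lemma hom_zero_Ob: "hom_zero T X Y \<Longrightarrow> X \<in> Ob T \<and> Y \<in> Ob T"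
  using Hom_ObD by (auto simp: hom_zero_def)

lemma zero_objectD:
  assumes "zero_object T Z"
  shows "Z \<in> Ob T" and "X \<in> Ob T \<Longrightarrow> hom_zero T Z X" and "X \<in> Ob T \<Longrightarrow> hom_zero T X Z"
  using assms zero_hom by (auto intro!: hom_zeroI simp: zero_object_def)

lemma zero_objectI:
  assumes "hom_zero T Z Z"
  shows "zero_object T Z"
proof -
  have Z: "Z \<in> Ob T" using assms hom_zero_Ob by blast
  have i: "Ident T Z = Zero T Z Z" using assms ident_hom[OF Z] hom_zeroD by blast
  show ?thesis unfolding zero_object_def
  proof (intro conjI ballI)
    fix X assume X: "X \<in> Ob T"
    have "f = Zero T Z X" if "f \<in> Hom T Z X" for f
      using comp_ident[OF that] comp_zero[OF that Z] i by simp
    then show "\<exists>!f. f \<in> Hom T Z X" using zero_hom[OF Z X] by blast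
    have "f = Zero T X Z" if "f \<in> Hom T X Z" for f
      using ident_comp[OF that] zero_comp[OF that Z] i by simp
    then show "\<exists>!f. f \<in> Hom T X Z" using zero_hom[OF X Z] by blast
  qed (fact Z)
qed

text \<open>The universal property applied to Kronecker families gives coordinates on a coproduct.
  Later they separate morphisms out of compact objects.\<close>

lemma coproduct_proj:
  assumes C: "is_coproduct T I X C \<iota>"
  obtains p where "\<And>i. i \<in> I \<Longrightarrow> p i \<in> Hom T C (X i)"
    and "\<And>i j. \<lbrakk>i \<in> I; j \<in> I\<rbrakk> \<Longrightarrow> p i \<cdot> \<iota> j = (if i = j then Ident T (X i) else Zero T (X j) (X i))"
proof -
  note D = is_coproductD[OF C]
  have "\<exists>q. q \<in> Hom T C (X i) \<and> (\<forall>j\<in>I. q \<cdot> \<iota> j = (if i = j then Ident T (X i) else Zero T (X j) (X i)))"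
    if i: "i \<in> I" for i
    by (rule coproduct_map[OF C, of "\<lambda>j. if i = j then Ident T (X i) else Zero T (X j) (X i)" "X i"])
      (use i D ident_hom zero_hom in auto)
  then obtain p where "\<forall>i\<in>I. p i \<in> Hom T C (X i) \<and> (\<forall>j\<in>I. p i \<cdot> \<iota> j = (if i = j then Ident T (X i) else Zero T (X j) (X i)))"
    by metis
  then show thesis using that[of p] by simp
qed

end

section \<open>Triangulated categories\<close>

text \<open>Forgetting the maps leaves the statement that \<open>Y\<close> is an extension of
  \<open>Z\<close> by \<open>X\<close>, which is the form in which closure arguments are carried
  out.\<close>

definition tri :: "('o, 'm, 'x) tricat_scheme \<Rightarrow> 'o \<Rightarrow> 'o \<Rightarrow> 'o \<Rightarrow> bool" where
  "tri T X Y Z \<longleftrightarrow> (\<exists>f g h. triangle T X Y Z f g h)"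

definition coprod ::
  "('o, 'm, 'x) category_scheme \<Rightarrow> 'i set \<Rightarrow> ('i \<Rightarrow> 'o) \<Rightarrow> 'o \<Rightarrow> bool" where
  "coprod T I X C \<longleftrightarrow> (\<exists>\<iota>. is_coproduct T I X C \<iota>)"

lemma shift_0 [simp]: "shift T 0 X = X"
  and shift_1: "shift T 1 X = ShO T X"
  by (simp_all add: shift_def)

context category
begin

lemma isomorphicI:
  assumes "f \<in> Hom T X Y" "g \<in> Hom T Y X" "g \<cdot> f = Ident T X" "f \<cdot> g = Ident T Y"
  shows "isomorphic T X Y"
  unfolding isomorphic_def using is_isoI[OF assms] assms(1) by blast

lemma isomorphicE:
  assumes "isomorphic T X Y"
  obtains f g where "f \<in> Hom T X Y" "g \<in> Hom T Y X" "g \<cdot> f = Ident T X" "f \<cdot> g = Ident T Y"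
proof -
  obtain f where f: "f \<in> Hom T X Y" "is_iso T f" using assms unfolding isomorphic_def by blast
  show thesis using is_isoE[OF f(2,1)] that f(1) by blast
qed

lemma isomorphic_refl: "X \<in> Ob T \<Longrightarrow> isomorphic T X X"
  using is_iso_ident ident_hom by (auto simp: isomorphic_def)

lemma isomorphic_sym: "isomorphic T X Y \<Longrightarrow> isomorphic T Y X"
  by (meson isomorphicE isomorphicI)

end

context triangulated_category
begin

section \<open>Integer powers of the shift\<close>

lemma ShO_Ob: "X \<in> Ob T \<Longrightarrow> ShO T X \<in> Ob T"
  using shift_bij_ob bij_betwE by blast

lemma shift_m1_Ob: "X \<in> Ob T \<Longrightarrow> shift T (- 1) X \<in> Ob T"
  and ShO_shift_m1: "X \<in> Ob T \<Longrightarrow> ShO T (shift T (- 1) X) = X"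
  and shift_m1_ShO: "X \<in> Ob T \<Longrightarrow> shift T (- 1) (ShO T X) = X"
  using shift_bij_ob by (auto simp: shift_def bij_betw_def inv_into_into f_inv_into_f inv_into_f_f)

lemma shift_Ob: assumes "X \<in> Ob T" shows "shift T i X \<in> Ob T"
proof -
  have a: "(ShO T ^^ n) X \<in> Ob T" for n
    by (induction n) (use assms ShO_Ob in auto)
  have "(inv_into (Ob T) (ShO T) ^^ n) X \<in> Ob T" for n
    by (induction n) (use assms shift_m1_Ob in \<open>auto simp: shift_def\<close>)
  with a show ?thesis by (simp add: shift_def)
qed

lemma shift_Suc: assumes "X \<in> Ob T" shows "shift T (i + 1) X = ShO T (shift T i X)"
proof (cases "0 \<le> i")
  case True
  then have "nat (i + 1) = Suc (nat i)" by simp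
  then show ?thesis using True by (simp add: shift_def)
next
  case False
  then have n: "nat (- i) = Suc (nat (- (i + 1)))" by simp
  have k: "(inv_into (Ob T) (ShO T) ^^ n) X \<in> Ob T" for n
    by (induction n) (use assms shift_m1_Ob in \<open>auto simp: shift_def\<close>)
  have "ShO T (shift T i X) = (inv_into (Ob T) (ShO T) ^^ nat (- (i + 1))) X"
    using False n ShO_shift_m1[OF k] by (simp add: shift_def)
  also have "\<dots> = shift T (i + 1) X"
    using False by (cases "i = - 1") (auto simp: shift_def)
  finally show ?thesis by simp
qed

lemma shift_pred: assumes "X \<in> Ob T" shows "shift T (i - 1) X = shift T (- 1) (shift T i X)"
  using shift_Suc[OF assms, of "i - 1"] shift_m1_ShO[OF shift_Ob[OF assms]] by simp

lemma shift_shift: assumes X: "X \<in> Ob T" shows "shift T i (shift T j X) = shift T (i + j) X"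
proof (induction i rule: int_induct[where k = 0])
  case base show ?case by simp
next
  case (step1 i)
  then show ?case using shift_Suc[OF X, of "i + j"] shift_Suc[OF shift_Ob[OF X], of i]
    by (simp add: algebra_simps)
next
  case (step2 i)
  then show ?case using shift_pred[OF X, of "i + j"] shift_pred[OF shift_Ob[OF X], of i]
    by (simp add: algebra_simps)
qed

lemma ShA_hom: "f \<in> Hom T X Y \<Longrightarrow> ShA T f \<in> Hom T (ShO T X) (ShO T Y)"
  using shift_bij_hom[of X Y] Hom_ObD[of f X Y] bij_betwE by blast

lemma ShA_inj: "\<lbrakk>f \<in> Hom T X Y; g \<in> Hom T X Y; ShA T f = ShA T g\<rbrakk> \<Longrightarrow> f = g"
  using shift_bij_hom[of X Y] Hom_ObD[of f X Y] by (auto simp: bij_betw_def inj_on_def)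

lemma ShA_surj:
  assumes "X \<in> Ob T" "Y \<in> Ob T" "k \<in> Hom T (ShO T X) (ShO T Y)"
  obtains f where "f \<in> Hom T X Y" "k = ShA T f"
  using shift_bij_hom[OF assms(1,2)] assms(3) by (auto simp: bij_betw_def)

lemma ShA_ident: "X \<in> Ob T \<Longrightarrow> ShA T (Ident T X) = Ident T (ShO T X)"
  using shift_functor by (simp add: is_functor_def)

lemma ShA_comp: assumes "f \<in> Hom T X Y" "g \<in> Hom T Y Z" shows "ShA T (g \<cdot> f) = ShA T g \<cdot> ShA T f"
  using shift_functor assms Hom_ObD unfolding is_functor_def by blast

lemma ShA_zero: assumes X: "X \<in> Ob T" and Y: "Y \<in> Ob T" shows "ShA T (Zero T X Y) = Zero T (ShO T X) (ShO T Y)"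
proof -
  let ?z = "Zero T X Y"
  have z: "?z \<in> Hom T X Y" using zero_hom X Y .
  note sz = ShA_hom[OF z]
  have "Add T (ShA T ?z) (ShA T ?z) = Add T (Zero T (ShO T X) (ShO T Y)) (ShA T ?z)"
    using shift_add[OF z z] add_zero[OF z] add_zero_left[OF sz] by simp
  then show ?thesis using add_cancel[OF sz _ sz] zero_hom ShO_Ob X Y by blast
qed

lemma hom_zero_ShO: assumes X: "X \<in> Ob T" and Y: "Y \<in> Ob T"
  shows "hom_zero T (ShO T X) (ShO T Y) \<longleftrightarrow> hom_zero T X Y"
proof
  assume h: "hom_zero T (ShO T X) (ShO T Y)"
  show "hom_zero T X Y"
  proof (rule hom_zeroI[OF X Y])
    fix f assume "f \<in> Hom T X Y"
    then show "f = Zero T X Y"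
      using hom_zeroD[OF h ShA_hom] ShA_zero[OF X Y] ShA_inj zero_hom[OF X Y] by metis
  qed
next
  assume h: "hom_zero T X Y"
  show "hom_zero T (ShO T X) (ShO T Y)"
  proof (rule hom_zeroI)
    fix f assume "f \<in> Hom T (ShO T X) (ShO T Y)"
    then show "f = Zero T (ShO T X) (ShO T Y)"
      using ShA_surj[OF X Y] hom_zeroD[OF h] ShA_zero[OF X Y] by metis
  qed (use X Y ShO_Ob in auto)
qed

lemma hom_zero_shift: assumes X: "X \<in> Ob T" and Y: "Y \<in> Ob T"
  shows "hom_zero T (shift T i X) (shift T i Y) \<longleftrightarrow> hom_zero T X Y"
proof (induction i rule: int_induct[where k = 0])
  case base show ?case by simp
next
  case (step1 i)
  then show ?case using shift_Suc X Y hom_zero_ShO shift_Ob by simp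
next
  case (step2 i)
  then show ?case using shift_Suc[OF X, of "i - 1"] shift_Suc[OF Y, of "i - 1"] X Y
      hom_zero_ShO[of "shift T (i - 1) X" "shift T (i - 1) Y"] shift_Ob by simp
qed

lemma hom_zero_shift_left: assumes X: "X \<in> Ob T" and Y: "Y \<in> Ob T"
  shows "hom_zero T (shift T i X) Y \<longleftrightarrow> hom_zero T X (shift T (- i) Y)"
  using hom_zero_shift[OF X shift_Ob[OF Y], of i "- i"] shift_shift[OF Y] by simp

lemma zero_object_shift: "zero_object T Z \<Longrightarrow> zero_object T (shift T i Z)"
  by (intro zero_objectI) (simp add: hom_zero_shift zero_objectD)

section \<open>Rotation and exactness of Hom along triangles\<close>

lemma triangle_Ob:
  assumes "triangle T X Y Z f g h"
  shows "X \<in> Ob T" "Y \<in> Ob T" "Z \<in> Ob T" "f \<in> Hom T X Y" "g \<in> Hom T Y Z" "h \<in> Hom T Z (ShO T X)"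
  using assms Hom_ObD unfolding triangle_def by blast+

lemma tri_Ob: "tri T X Y Z \<Longrightarrow> X \<in> Ob T \<and> Y \<in> Ob T \<and> Z \<in> Ob T"
  unfolding tri_def using triangle_Ob by blast

lemma triangle_rotate:
  assumes "triangle T X Y Z f g h"
  shows "triangle T Y Z (ShO T X) g h (inv\<^bsub>hom_group T (ShO T X) (ShO T Y)\<^esub> (ShA T f))"
  using assms TR2 unfolding triangle_def by blast

text \<open>Once the maps are forgotten, the sign of a rotation is invisible. Rotating backwards,
  the negative of the third map desuspends to the missing first map.\<close>

lemma tri_rotate: assumes X: "X \<in> Ob T" shows "tri T Y Z (ShO T X) \<longleftrightarrow> tri T X Y Z"
proof
  assume "tri T Y Z (ShO T X)"
  then obtain g h k where t: "triangle T Y Z (ShO T X) g h k" unfolding tri_def by blast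
  note O = triangle_Ob[OF t]
  let ?G = "hom_group T (ShO T X) (ShO T Y)"
  interpret H: comm_group ?G using hom_comm_group ShO_Ob X O by blast
  have "inv\<^bsub>?G\<^esub> k \<in> Hom T (ShO T X) (ShO T Y)" using O inv_hom by blast
  then obtain f where f: "f \<in> Hom T X Y" "inv\<^bsub>?G\<^esub> k = ShA T f" using ShA_surj X O by metis
  have "inv\<^bsub>?G\<^esub> (ShA T f) = k" using f(2) H.inv_inv[of k] O by (simp add: hom_group_def)
  then have "triangle T X Y Z f g h" using TR2[OF f(1) O(4,5)] t by simp
  then show "tri T X Y Z" unfolding tri_def by blast
next
  assume "tri T X Y Z"
  then show "tri T Y Z (ShO T X)" unfolding tri_def using triangle_rotate by blast
qed

text \<open>Three rotations.\<close>

lemma tri_ShO: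
  assumes "X \<in> Ob T" "Y \<in> Ob T" "Z \<in> Ob T"
  shows "tri T (ShO T X) (ShO T Y) (ShO T Z) \<longleftrightarrow> tri T X Y Z"
  using assms tri_rotate ShO_Ob by simp

lemma tri_shift:
  assumes X: "X \<in> Ob T" and Y: "Y \<in> Ob T" and Z: "Z \<in> Ob T"
  shows "tri T (shift T i X) (shift T i Y) (shift T i Z) \<longleftrightarrow> tri T X Y Z"
proof (induction i rule: int_induct[where k = 0])
  case base show ?case by simp
next
  case (step1 i)
  then show ?case using shift_Suc X Y Z tri_ShO shift_Ob by simp
next
  case (step2 i)
  then show ?case using shift_Suc[OF X, of "i - 1"] shift_Suc[OF Y, of "i - 1"] shift_Suc[OF Z, of "i - 1"]
      X Y Z tri_ShO[of "shift T (i - 1) X" "shift T (i - 1) Y" "shift T (i - 1) Z"] shift_Ob by simp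
qed

lemma triangle_ident:
  assumes "X \<in> Ob T" "zero_object T Z"
  shows "triangle T X X Z (Ident T X) (Zero T X Z) (Zero T Z (ShO T X))"
  using TR1_ident assms .

text \<open>TR3 compares the triangle of the identity of \<open>X\<close> with the given one; the
  composite then factors through a zero object.\<close>

lemma triangle_comp_zero:
  assumes t: "triangle T X Y Z f g h"
  shows "g \<cdot> f = Zero T X Z"
proof -
  note O = triangle_Ob[OF t]
  obtain N where N: "zero_object T N" using ex_zero_object by blast
  have "f \<cdot> Ident T X = f \<cdot> Ident T X" ..
  from TR3[OF triangle_ident[OF O(1) N] t ident_hom[OF O(1)] O(4) this]
  obtain c where c: "c \<in> Hom T N Z" "c \<cdot> Zero T X N = g \<cdot> f" by blast
  then show ?thesis using comp_zero[OF c(1) O(1)] by simp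
qed

text \<open>Exactness of Hom(K, -) at the middle term: TR3 is applied to the rotated triangles
  starting with K -> 0 and with \<open>g\<close>, and the third map it provides is
  desuspended.\<close>

lemma triangle_lift:
  assumes t: "triangle T X Y Z f g h" and u: "u \<in> Hom T K Y" and gu: "g \<cdot> u = Zero T K Z"
  obtains v where "v \<in> Hom T K X" "f \<cdot> v = u"
proof -
  note O = triangle_Ob[OF t]
  have K: "K \<in> Ob T" using u Hom_ObD by blast
  obtain N where N: "zero_object T N" using ex_zero_object by blast
  note NO = zero_objectD(1)[OF N]
  let ?i = "inv\<^bsub>hom_group T (ShO T K) (ShO T K)\<^esub> (ShA T (Ident T K))"
  let ?j = "inv\<^bsub>hom_group T (ShO T X) (ShO T Y)\<^esub> (ShA T f)"
  note tK = triangle_rotate[OF triangle_ident[OF K N]]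
  have zNZ: "Zero T N Z \<in> Hom T N Z" using zero_hom NO O by blast
  have "Zero T N Z \<cdot> Zero T K N = g \<cdot> u" using comp_zero[OF zNZ K] gu by simp
  from TR3[OF tK triangle_rotate[OF t] u zNZ this]
  obtain c where c: "c \<in> Hom T (ShO T K) (ShO T X)" "ShA T u \<cdot> ?i = ?j \<cdot> c" by blast
  obtain v where v: "v \<in> Hom T K X" "c = ShA T v" using ShA_surj[OF K O(1) c(1)] by blast
  have I: "ShA T (Ident T K) \<in> Hom T (ShO T K) (ShO T K)" using ShA_hom ident_hom K by blast
  \<comment> \<open>Both rotated triangles carry a minus sign on a suspended map; it cancels by
    injectivity of inversion.\<close>
  have "ShA T u \<cdot> ShA T (Ident T K) = ShA T f \<cdot> c"
  proof (rule inv_inject)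
    show "inv\<^bsub>hom_group T (ShO T K) (ShO T Y)\<^esub> (ShA T u \<cdot> ShA T (Ident T K))
      = inv\<^bsub>hom_group T (ShO T K) (ShO T Y)\<^esub> (ShA T f \<cdot> c)"
      using c(2) comp_inv[OF I ShA_hom[OF u]] inv_comp[OF c(1) ShA_hom[OF O(4)]] by simp
  qed (use I u ShA_hom comp_hom c O in blast)+
  then have "ShA T (f \<cdot> v) = ShA T u"
    using ShA_comp[OF v(1) O(4)] v(2) comp_ident[OF ShA_hom[OF u]] ShA_ident[OF K] by simp
  then have "f \<cdot> v = u" using ShA_inj comp_hom v(1) O(4) u by blast
  then show thesis using that v(1) by blast
qed

lemma triangle_ident_right:
  assumes K: "K \<in> Ob T" and N: "zero_object T N"
  shows "triangle T N K K (Zero T N K) (Ident T K) (Zero T K (ShO T N))"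
proof -
  note NO = zero_objectD(1)[OF N]
  have SN: "zero_object T (ShO T N)" using zero_object_shift[OF N, of 1] by (simp add: shift_1)
  have "inv\<^bsub>hom_group T (ShO T N) (ShO T K)\<^esub> (ShA T (Zero T N K)) = Zero T (ShO T N) (ShO T K)"
    using ShA_zero[OF NO K] inv_zero ShO_Ob K NO by simp
  then show ?thesis using TR2[of "Zero T N K" N K "Ident T K" K "Zero T K (ShO T N)"]
    triangle_ident[OF K SN] zero_hom ident_hom ShO_Ob NO K by simp
qed

text \<open>Exactness of Hom(-, K), by TR3 against the triangle 0 -> K -> K.\<close>

lemma triangle_extend:
  assumes t: "triangle T X Y Z f g h" and u: "u \<in> Hom T Y K" and uf: "u \<cdot> f = Zero T X K"
  obtains v where "v \<in> Hom T Z K" "v \<cdot> g = u"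
proof -
  note O = triangle_Ob[OF t]
  have K: "K \<in> Ob T" using u Hom_ObD by blast
  obtain N where N: "zero_object T N" using ex_zero_object by blast
  note NO = zero_objectD(1)[OF N]
  have z: "Zero T X N \<in> Hom T X N" using zero_hom NO O by blast
  have "u \<cdot> f = Zero T N K \<cdot> Zero T X N" using zero_comp[OF z K] uf by simp
  from TR3[OF t triangle_ident_right[OF K N] z u this]
  obtain c where c: "c \<in> Hom T Z K" "c \<cdot> g = Ident T K \<cdot> u" by blast
  then show thesis using that ident_comp[OF u] by simp
qed

lemma triangle_lift2:
  assumes t: "triangle T X Y Z f g h" and u: "u \<in> Hom T K Z" and "h \<cdot> u = Zero T K (ShO T X)"
  obtains v where "v \<in> Hom T K Y" "g \<cdot> v = u"
  using triangle_lift[OF triangle_rotate[OF t] u] assms(3) by blast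

lemma triangle_extend2:
  assumes t: "triangle T X Y Z f g h" and u: "u \<in> Hom T Z K" and "u \<cdot> g = Zero T Y K"
  obtains v where "v \<in> Hom T (ShO T X) K" "v \<cdot> h = u"
  using triangle_extend[OF triangle_rotate[OF t] u] assms(3) by blast

lemma triangle_comp_zero2: "triangle T X Y Z f g h \<Longrightarrow> h \<cdot> g = Zero T Y (ShO T X)"
  using triangle_comp_zero[OF triangle_rotate] .

lemma triangle_comp_zero3:
  assumes t: "triangle T X Y Z f g h"
  shows "ShA T f \<cdot> h = Zero T Z (ShO T Y)"
proof -
  note O = triangle_Ob[OF t]
  have "inv\<^bsub>hom_group T Z (ShO T Y)\<^esub> (ShA T f \<cdot> h) = Zero T Z (ShO T Y)"
    using triangle_comp_zero[OF triangle_rotate[OF triangle_rotate[OF t]]]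
      inv_comp[OF O(6) ShA_hom[OF O(4)]] by simp
  then have "inv\<^bsub>hom_group T Z (ShO T Y)\<^esub> (ShA T f \<cdot> h) = inv\<^bsub>hom_group T Z (ShO T Y)\<^esub> (Zero T Z (ShO T Y))"
    using inv_zero O ShO_Ob by simp
  then show ?thesis using inv_inject comp_hom[OF O(6) ShA_hom[OF O(4)]] zero_hom O ShO_Ob by meson
qed

lemma tri_hom_zero_right:
  assumes "tri T X Y Z" "hom_zero T K X" "hom_zero T K Z"
  shows "hom_zero T K Y"
proof -
  obtain f g h where t: "triangle T X Y Z f g h" using assms unfolding tri_def by blast
  note O = triangle_Ob[OF t]
  have K: "K \<in> Ob T" using assms hom_zero_Ob by blast
  show ?thesis
  proof (rule hom_zeroI[OF K O(2)])
    fix u assume u: "u \<in> Hom T K Y"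
    have "g \<cdot> u = Zero T K Z" using hom_zeroD[OF assms(3)] comp_hom u O by blast
    then obtain v where v: "v \<in> Hom T K X" "f \<cdot> v = u" using triangle_lift[OF t u] by blast
    then show "u = Zero T K Y" using hom_zeroD[OF assms(2)] comp_zero[OF O(4) K] by blast
  qed
qed

lemma tri_hom_zero_left:
  assumes "tri T X Y Z" "hom_zero T X K" "hom_zero T Z K"
  shows "hom_zero T Y K"
proof -
  obtain f g h where t: "triangle T X Y Z f g h" using assms unfolding tri_def by blast
  note O = triangle_Ob[OF t]
  have K: "K \<in> Ob T" using assms hom_zero_Ob by blast
  show ?thesis
  proof (rule hom_zeroI[OF O(2) K])
    fix u assume u: "u \<in> Hom T Y K"
    have "u \<cdot> f = Zero T X K" using hom_zeroD[OF assms(2)] comp_hom u O by blast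
    then obtain v where v: "v \<in> Hom T Z K" "v \<cdot> g = u" using triangle_extend[OF t u] by blast
    then show "u = Zero T Y K" using hom_zeroD[OF assms(3)] zero_comp[OF O(5) K] by blast
  qed
qed

lemma tri_ident_left: "\<lbrakk>X \<in> Ob T; zero_object T Z\<rbrakk> \<Longrightarrow> tri T X X Z"
  using triangle_ident unfolding tri_def by blast

lemma tri_ident_right: "\<lbrakk>X \<in> Ob T; zero_object T Z\<rbrakk> \<Longrightarrow> tri T Z X X"
  using triangle_ident_right unfolding tri_def by blast

lemma tri_iso:
  assumes t: "tri T X Y Z" and X: "isomorphic T X X'" and Y: "isomorphic T Y Y'" and Z: "isomorphic T Z Z'"
  shows "tri T X' Y' Z'"
proof -
  obtain f g h where t: "triangle T X Y Z f g h" using t unfolding tri_def by blast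
  note O = triangle_Ob[OF t]
  obtain a a' where a: "a \<in> Hom T X X'" "a' \<in> Hom T X' X" "a' \<cdot> a = Ident T X" "a \<cdot> a' = Ident T X'"
    using isomorphicE[OF X] .
  obtain b b' where b: "b \<in> Hom T Y Y'" "b' \<in> Hom T Y' Y" "b' \<cdot> b = Ident T Y" "b \<cdot> b' = Ident T Y'"
    using isomorphicE[OF Y] .
  obtain c c' where c: "c \<in> Hom T Z Z'" "c' \<in> Hom T Z' Z" "c' \<cdot> c = Ident T Z" "c \<cdot> c' = Ident T Z'"
    using isomorphicE[OF Z] .
  have bf: "b \<cdot> f \<in> Hom T X Y'" and cg: "c \<cdot> g \<in> Hom T Y Z'" and ah: "ShA T a \<cdot> h \<in> Hom T Z (ShO T X')"
    using comp_hom O a b c ShA_hom by blast+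
  have 1: "b \<cdot> f = ((b \<cdot> f) \<cdot> a') \<cdot> a"
    using comp_assoc[OF a(1) a(2) bf] a(3) comp_ident[OF bf] by simp
  have 2: "c \<cdot> g = ((c \<cdot> g) \<cdot> b') \<cdot> b"
    using comp_assoc[OF b(1) b(2) cg] b(3) comp_ident[OF cg] by simp
  have 3: "ShA T a \<cdot> h = ((ShA T a \<cdot> h) \<cdot> c') \<cdot> c"
    using comp_assoc[OF c(1) c(2) ah] c(3) comp_ident[OF ah] by simp
  have "triangle T X' Y' Z' ((b \<cdot> f) \<cdot> a') ((c \<cdot> g) \<cdot> b') ((ShA T a \<cdot> h) \<cdot> c')"
    by (rule TR1_iso[OF t _ _ _ a(1) b(1) c(1) is_isoI[OF a] is_isoI[OF b] is_isoI[OF c] 1 2 3])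
      (use comp_hom bf cg ah a b c in blast)+
  then show ?thesis unfolding tri_def by blast
qed

lemma isomorphic_ShO:
  assumes "isomorphic T (ShO T X) (ShO T Y)" and X: "X \<in> Ob T" and Y: "Y \<in> Ob T"
  shows "isomorphic T X Y"
proof -
  obtain f g where f: "f \<in> Hom T (ShO T X) (ShO T Y)" "g \<in> Hom T (ShO T Y) (ShO T X)"
    "g \<cdot> f = Ident T (ShO T X)" "f \<cdot> g = Ident T (ShO T Y)" using isomorphicE[OF assms(1)] .
  obtain f' where f': "f' \<in> Hom T X Y" "f = ShA T f'" using ShA_surj[OF X Y f(1)] .
  obtain g' where g': "g' \<in> Hom T Y X" "g = ShA T g'" using ShA_surj[OF Y X f(2)] .
  show ?thesis
  proof (rule isomorphicI[OF f'(1) g'(1)])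
    show "g' \<cdot> f' = Ident T X"
      by (rule ShA_inj[OF comp_hom[OF f'(1) g'(1)] ident_hom[OF X]])
        (use ShA_comp[OF f'(1) g'(1)] f' g' f ShA_ident X in simp)
    show "f' \<cdot> g' = Ident T Y"
      by (rule ShA_inj[OF comp_hom[OF g'(1) f'(1)] ident_hom[OF Y]])
        (use ShA_comp[OF g'(1) f'(1)] f' g' f ShA_ident Y in simp)
  qed
qed

text \<open>Since \<open>X\<close> and its shift are zero, the identity of \<open>Y\<close> extends
  along \<open>g\<close> and the identity of \<open>Z\<close> lifts along \<open>g\<close>; these
  one-sided inverses of \<open>g\<close> coincide.\<close>

lemma tri_zero_iso:
  assumes "tri T X Y Z" and X: "zero_object T X"
  shows "isomorphic T Y Z"
proof -
  obtain f g h where t: "triangle T X Y Z f g h" using assms unfolding tri_def by blast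
  note O = triangle_Ob[OF t]
  have SX: "zero_object T (ShO T X)" using zero_object_shift[OF X, of 1] by (simp add: shift_1)
  have "Ident T Y \<cdot> f = Zero T X Y"
    using hom_zeroD[OF zero_objectD(2)[OF X O(2)]] comp_hom[OF O(4) ident_hom[OF O(2)]] by blast
  then obtain r where r: "r \<in> Hom T Z Y" "r \<cdot> g = Ident T Y"
    using triangle_extend[OF t ident_hom[OF O(2)]] by blast
  have "h \<cdot> Ident T Z = Zero T Z (ShO T X)"
    using hom_zeroD[OF zero_objectD(3)[OF SX O(3)]] comp_hom[OF ident_hom[OF O(3)] O(6)] by blast
  then obtain s where s: "s \<in> Hom T Z Y" "g \<cdot> s = Ident T Z"
    using triangle_lift2[OF t ident_hom[OF O(3)]] by blast
  have "r = s"
    using comp_assoc[OF s(1) O(5) r(1)] r s comp_ident[OF r(1)] ident_comp[OF s(1)] by simp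
  then show ?thesis using isomorphicI[OF O(5) r(1) r(2)] s by simp
qed

text \<open>One half of the associativity of extensions: from Z in (X * Z') * X' to Z in X * (Z' *
  X').\<close>

lemma octahedron:
  assumes "tri T X Y Z'" "tri T Y Z X'"
  obtains W where "tri T X Z W" "tri T Z' W X'"
proof -
  obtain f f' f'' g g' g'' where t: "triangle T X Y Z' f f' f''" "triangle T Y Z X' g g' g''"
    using assms unfolding tri_def by blast
  have "g \<cdot> f \<in> Hom T X Z" using triangle_Ob(4) t comp_hom by blast
  then obtain W k l where "triangle T X Z W (g \<cdot> f) k l" using TR1_cone by blast
  with t TR4 show thesis using that unfolding tri_def by blast
qed

text \<open>The other half of associativity, obtained by rotating both triangles, applying the first
  half to Z -> W -> X' and desuspending the cone.\<close>

lemma octahedron':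
  assumes "tri T X Z W" "tri T Z' W X'"
  obtains Y where "tri T X Y Z'" "tri T Y Z X'"
proof -
  note O = tri_Ob[OF assms(1)] tri_Ob[OF assms(2)]
  have "tri T Z W (ShO T X)" "tri T W X' (ShO T Z')" using assms tri_rotate O by blast+
  then obtain V where V: "tri T Z X' V" "tri T (ShO T X) V (ShO T Z')" using octahedron by blast
  have VO: "V \<in> Ob T" using V tri_Ob by blast
  let ?Y = "shift T (- 1) V"
  have Y: "?Y \<in> Ob T" "ShO T ?Y = V" using VO shift_m1_Ob ShO_shift_m1 by auto
  show thesis
    using that[of ?Y] V Y O tri_rotate[of ?Y Z X'] tri_ShO[of X ?Y Z'] by simp
qed

text \<open>The connecting map vanishes, so \<open>g\<close> has a section s. The octahedron on the
  composite of s and \<open>g\<close>, an identity with zero cone, identifies the cone of s with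
  \<open>A\<close>.\<close>

lemma tri_swap:
  assumes "tri T A X B" and z: "hom_zero T B (ShO T A)"
  shows "tri T B X A"
proof -
  obtain f g h where t: "triangle T A X B f g h" using assms unfolding tri_def by blast
  note O = triangle_Ob[OF t]
  have "h \<cdot> Ident T B = Zero T B (ShO T A)" using hom_zeroD[OF z] comp_hom ident_hom O by blast
  then obtain s where s: "s \<in> Hom T B X" "g \<cdot> s = Ident T B"
    using triangle_lift2[OF t ident_hom[OF O(3)]] by blast
  obtain C s' s'' where S: "triangle T B X C s s' s''" using TR1_cone[OF s(1)] by blast
  obtain N where N: "zero_object T N" using ex_zero_object by blast
  have "\<exists>u v w. triangle T C N (ShO T A) u v w"
    using TR4[OF S triangle_rotate[OF t], of N "Zero T B N" "Zero T N (ShO T B)"]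
      triangle_ident[OF O(3) N] s(2) by auto
  then have "tri T C N (ShO T A)" unfolding tri_def .
  moreover have CO: "C \<in> Ob T" using triangle_Ob S by blast
  ultimately have "isomorphic T (ShO T A) (ShO T C)"
    using tri_zero_iso[OF _ N] tri_rotate by blast
  then have "isomorphic T C A" using isomorphic_sym isomorphic_ShO O CO by blast
  then show ?thesis using tri_iso[OF _ isomorphic_refl isomorphic_refl] O S unfolding tri_def by blast
qed

section \<open>Coproducts under the shift\<close>

lemma is_coproduct_ShO:
  assumes C: "C \<in> Ob T" and i: "\<And>i. i \<in> I \<Longrightarrow> X i \<in> Ob T \<and> \<iota> i \<in> Hom T (X i) C"
  shows "is_coproduct T I (\<lambda>i. ShO T (X i)) (ShO T C) (\<lambda>i. ShA T (\<iota> i)) \<longleftrightarrow> is_coproduct T I X C \<iota>"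
proof
  assume A: "is_coproduct T I X C \<iota>"
  show "is_coproduct T I (\<lambda>i. ShO T (X i)) (ShO T C) (\<lambda>i. ShA T (\<iota> i))"
  proof (rule is_coproductI)
    fix Y f assume Y: "Y \<in> Ob T" and f: "\<And>i. i \<in> I \<Longrightarrow> f i \<in> Hom T (ShO T (X i)) Y"
    let ?Y = "shift T (- 1) Y"
    have Y': "?Y \<in> Ob T" "ShO T ?Y = Y" using Y shift_m1_Ob ShO_shift_m1 by auto
    have "\<forall>i\<in>I. \<exists>f'. f' \<in> Hom T (X i) ?Y \<and> f i = ShA T f'"
      using ShA_surj[OF _ Y'(1)] f i Y'(2) by metis
    then obtain f' where f': "\<And>i. i \<in> I \<Longrightarrow> f' i \<in> Hom T (X i) ?Y \<and> f i = ShA T (f' i)" by metis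
    obtain g where g: "g \<in> Hom T C ?Y" "\<And>i. i \<in> I \<Longrightarrow> g \<cdot> \<iota> i = f' i"
      by (rule coproduct_map[OF A, of f' ?Y]) (use f' Y' in auto)
    show "\<exists>g\<in>Hom T (ShO T C) Y. \<forall>i\<in>I. g \<cdot> ShA T (\<iota> i) = f i"
      using ShA_hom[OF g(1)] Y'(2) g(2) f' ShA_comp[OF _ g(1)] i by (intro bexI[of _ "ShA T g"]) metis+
  next
    fix Y g h assume Y: "Y \<in> Ob T" and g: "g \<in> Hom T (ShO T C) Y" and h: "h \<in> Hom T (ShO T C) Y"
      and eq: "\<And>i. i \<in> I \<Longrightarrow> g \<cdot> ShA T (\<iota> i) = h \<cdot> ShA T (\<iota> i)"
    let ?Y = "shift T (- 1) Y"
    have Y': "?Y \<in> Ob T" "ShO T ?Y = Y" using Y shift_m1_Ob ShO_shift_m1 by auto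
    obtain g' where g': "g' \<in> Hom T C ?Y" "g = ShA T g'" using ShA_surj[OF C Y'(1)] g Y'(2) by metis
    obtain h' where h': "h' \<in> Hom T C ?Y" "h = ShA T h'" using ShA_surj[OF C Y'(1)] h Y'(2) by metis
    have "g' = h'"
    proof (rule coproduct_eqI[OF A g'(1) h'(1)])
      fix j assume j: "j \<in> I"
      have "ShA T (g' \<cdot> \<iota> j) = ShA T (h' \<cdot> \<iota> j)"
        using ShA_comp[of "\<iota> j"] i[OF j] g' h' eq[OF j] by metis
      then show "g' \<cdot> \<iota> j = h' \<cdot> \<iota> j"
        using ShA_inj[OF comp_hom[OF _ g'(1)] comp_hom[OF _ h'(1)]] i[OF j] by blast
    qed
    then show "g = h" using g' h' by simp
  qed (use ShO_Ob ShA_hom C i in auto)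
next
  assume A: "is_coproduct T I (\<lambda>i. ShO T (X i)) (ShO T C) (\<lambda>i. ShA T (\<iota> i))"
  show "is_coproduct T I X C \<iota>"
  proof (rule is_coproductI)
    fix Y f assume Y: "Y \<in> Ob T" and f: "\<And>i. i \<in> I \<Longrightarrow> f i \<in> Hom T (X i) Y"
    obtain g where g: "g \<in> Hom T (ShO T C) (ShO T Y)" "\<And>i. i \<in> I \<Longrightarrow> g \<cdot> ShA T (\<iota> i) = ShA T (f i)"
      by (rule coproduct_map[OF A, of "\<lambda>i. ShA T (f i)" "ShO T Y"]) (use f Y ShA_hom ShO_Ob in auto)
    obtain g' where g': "g' \<in> Hom T C Y" "g = ShA T g'" using ShA_surj[OF C Y g(1)] .
    have "g' \<cdot> \<iota> j = f j" if j: "j \<in> I" for j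
      by (rule ShA_inj[OF comp_hom[OF conjunct2[OF i[OF j]] g'(1)] f[OF j]])
       (use g(2)[OF j] g' ShA_comp[OF conjunct2[OF i[OF j]] g'(1)] in simp)
    then show "\<exists>g\<in>Hom T C Y. \<forall>i\<in>I. g \<cdot> \<iota> i = f i" using g' by blast
  next
    fix Y g h assume Y: "Y \<in> Ob T" and g: "g \<in> Hom T C Y" and h: "h \<in> Hom T C Y"
      and eq: "\<And>i. i \<in> I \<Longrightarrow> g \<cdot> \<iota> i = h \<cdot> \<iota> i"
    have "ShA T g = ShA T h"
      by (rule coproduct_eqI[OF A ShA_hom[OF g] ShA_hom[OF h]])
        (use eq i ShA_comp[OF _ g] ShA_comp[OF _ h] in metis)
    then show "g = h" using ShA_inj g h by blast
  qed (use C i in auto)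
qed

lemma coprod_Ob: "coprod T I X C \<Longrightarrow> C \<in> Ob T"
  "\<lbrakk>coprod T I X C; i \<in> I\<rbrakk> \<Longrightarrow> X i \<in> Ob T"
  unfolding coprod_def is_coproduct_def by auto

lemma coprod_cong: "\<lbrakk>coprod T I X C; \<And>i. i \<in> I \<Longrightarrow> X i = Y i\<rbrakk> \<Longrightarrow> coprod T I Y C"
  unfolding coprod_def is_coproduct_def by auto

lemma coprod_ShO: "coprod T I X C \<Longrightarrow> coprod T I (\<lambda>i. ShO T (X i)) (ShO T C)"
proof -
  assume "coprod T I X C"
  then obtain \<iota> where A: "is_coproduct T I X C \<iota>" unfolding coprod_def by blast
  note D = is_coproductD[OF A]
  show ?thesis using is_coproduct_ShO[of C I X \<iota>] A D unfolding coprod_def by blast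
qed

lemma coprod_shift_m1:
  assumes "coprod T I X C" shows "coprod T I (\<lambda>i. shift T (- 1) (X i)) (shift T (- 1) C)"
proof -
  obtain \<iota> where A: "is_coproduct T I X C \<iota>" using assms unfolding coprod_def by blast
  note D = is_coproductD[OF A]
  let ?C = "shift T (- 1) C" and ?X = "\<lambda>i. shift T (- 1) (X i)"
  have C: "?C \<in> Ob T" "ShO T ?C = C" using D(1) shift_m1_Ob ShO_shift_m1 by auto
  have X: "?X i \<in> Ob T" "ShO T (?X i) = X i" if "i \<in> I" for i
    using D(2)[OF that] shift_m1_Ob ShO_shift_m1 by auto
  have "\<forall>i\<in>I. \<exists>f'. f' \<in> Hom T (?X i) ?C \<and> \<iota> i = ShA T f'"
    using ShA_surj[OF X(1) C(1)] D(3) X(2) C(2) by metis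
  then obtain j where j: "\<And>i. i \<in> I \<Longrightarrow> j i \<in> Hom T (?X i) ?C \<and> \<iota> i = ShA T (j i)" by metis
  have "is_coproduct T I (\<lambda>i. ShO T (?X i)) (ShO T ?C) (\<lambda>i. ShA T (j i))"
    using A j X(2) C(2) unfolding is_coproduct_def by simp
  then show ?thesis using is_coproduct_ShO[OF C(1), of I ?X j] X j unfolding coprod_def by blast
qed

lemma coprod_shift:
  assumes c: "coprod T I X C" shows "coprod T I (\<lambda>i. shift T k (X i)) (shift T k C)"
proof (induction k rule: int_induct[where k = 0])
  case base show ?case using c by simp
next
  case (step1 k)
  show ?case unfolding shift_Suc[OF coprod_Ob(1)[OF c]]
    by (rule coprod_cong[OF coprod_ShO[OF step1(2)]]) (simp add: shift_Suc coprod_Ob(2)[OF c])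
next
  case (step2 k)
  show ?case unfolding shift_pred[OF coprod_Ob(1)[OF c]]
    by (rule coprod_cong[OF coprod_shift_m1[OF step2(2)]]) (simp add: shift_pred coprod_Ob(2)[OF c])
qed

text \<open>Extensions and shifts already give the rest: an object isomorphic to \<open>X\<close> is
  an extension of zero by \<open>X\<close>, and the cone of X -> Y is an extension of the shift of
  \<open>X\<close> by \<open>Y\<close>.\<close>

lemma triangulated_subcatI:
  assumes S: "S \<subseteq> Ob T" and z: "\<And>Z. zero_object T Z \<Longrightarrow> Z \<in> S"
    and e: "\<And>X Y Z. \<lbrakk>tri T X Y Z; X \<in> S; Z \<in> S\<rbrakk> \<Longrightarrow> Y \<in> S"
    and s: "\<And>X. X \<in> S \<Longrightarrow> shift T 1 X \<in> S" "\<And>X. X \<in> S \<Longrightarrow> shift T (- 1) X \<in> S"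
  shows "triangulated_subcat T S"
  unfolding triangulated_subcat_def
proof (intro conjI ballI allI impI)
  fix X Y assume X: "X \<in> S" and XY: "isomorphic T X Y"
  obtain N where N: "zero_object T N" using ex_zero_object by blast
  have XO: "X \<in> Ob T" using X S by blast
  have "tri T X Y N"
    using tri_iso[OF tri_ident_left[OF XO N] isomorphic_refl XY isomorphic_refl] XO zero_objectD N by blast
  then show "Y \<in> S" using e z N X by blast
next
  fix X Y Z f g h assume "triangle T X Y Z f g h \<and> X \<in> S \<and> Y \<in> S"
  then have "tri T X Y Z" "X \<in> S" "Y \<in> S" unfolding tri_def by blast+
  then show "Z \<in> S" using e[of Y Z "ShO T X"] s(1)[of X] tri_rotate S shift_1[of T] by auto
qed (use S z s in auto)

lemma triangulated_subcatD:
  assumes S: "triangulated_subcat T S"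
  shows "S \<subseteq> Ob T" "\<And>Z. zero_object T Z \<Longrightarrow> Z \<in> S"
    "\<And>X Y Z. \<lbrakk>tri T X Y Z; X \<in> S; Y \<in> S\<rbrakk> \<Longrightarrow> Z \<in> S"
    "\<And>X. X \<in> S \<Longrightarrow> shift T 1 X \<in> S" "\<And>X. X \<in> S \<Longrightarrow> shift T (- 1) X \<in> S"
    "\<And>X Y. \<lbrakk>X \<in> S; isomorphic T X Y\<rbrakk> \<Longrightarrow> Y \<in> S"
  using S unfolding triangulated_subcat_def tri_def by blast+

lemma triangulated_subcat_ext:
  assumes S: "triangulated_subcat T S" and t: "tri T X Y Z" and "X \<in> S" "Z \<in> S"
  shows "Y \<in> S"
proof -
  note D = triangulated_subcatD[OF S]
  have O: "X \<in> Ob T" "Y \<in> Ob T" "Z \<in> Ob T" using t tri_Ob by auto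
  have "tri T Z (ShO T X) (ShO T Y)" using t tri_rotate O by blast
  then have "ShO T Y \<in> S" using D(3,4) assms(3,4) by (metis shift_1)
  then show ?thesis using D(5) shift_m1_ShO O by metis
qed

lemma triangulated_subcat_fibre:
  assumes S: "triangulated_subcat T S" and t: "tri T X Y Z" and "Y \<in> S" "Z \<in> S"
  shows "X \<in> S"
  using triangulated_subcatD[OF S] assms(3,4) t tri_rotate shift_m1_ShO tri_Ob by metis

lemma triangulated_subcat_shift:
  assumes S: "triangulated_subcat T S" and X: "X \<in> S"
  shows "shift T i X \<in> S"
proof -
  note D = triangulated_subcatD[OF S]
  have XO: "X \<in> Ob T" using D(1) X by blast
  show ?thesis
  proof (induction i rule: int_induct[where k = 0])
    case base show ?case using X by simp
  next
    case (step1 i)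
    then show ?case using D(4)[OF step1(2)] shift_Suc[OF XO] by (simp add: shift_1)
  next
    case (step2 i)
    then show ?case using D(5)[OF step2(2)] shift_pred[OF XO] by simp
  qed
qed

lemma triangulated_subcat_Int:
  assumes "triangulated_subcat T S" "triangulated_subcat T S'"
  shows "triangulated_subcat T (S \<inter> S')"
proof -
  note D = triangulated_subcatD(1,2,4,5)[OF assms(1)] triangulated_subcatD(1,2,4,5)[OF assms(2)]
  show ?thesis
  proof (rule triangulated_subcatI)
    fix X Y Z assume t: "tri T X Y Z" "X \<in> S \<inter> S'" "Z \<in> S \<inter> S'"
    then show "Y \<in> S \<inter> S'"
      using triangulated_subcat_ext[OF assms(1) t(1)] triangulated_subcat_ext[OF assms(2) t(1)] by simp
  qed (use D in auto)
qed

lemma triangulated_subcat_hull: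
  assumes "triangulated_subcat T S" "C \<subseteq> S" shows "triangulated_hull T C \<subseteq> S"
  using assms unfolding triangulated_hull_def by blast

text \<open>In the language of classes of objects, \<open>\<A> * \<B> \<subseteq> \<B> * \<A>\<close> because the connecting morphisms
  vanish, so \<open>(\<B> * \<A>) * (\<B> * \<A>) \<subseteq> \<B> * \<B> * \<A> * \<A>\<close>.\<close>

lemma tri_merge:
  assumes Y: "tri T Y1 Y Y2" and 1: "tri T B1 Y1 A1" and 2: "tri T B2 Y2 A2"
    and z: "hom_zero T B2 (ShO T A1)"
  obtains B A where "tri T B Y A" "tri T B1 B B2" "tri T A1 A A2"
proof -
  obtain W where W: "tri T B1 Y W" "tri T A1 W Y2" using octahedron[OF 1 Y] .
  \<comment> \<open>W lies in A1 * (B2 * A2). Reassociating exposes A1 * B2, the only place where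
    the order has to be exchanged.\<close>
  obtain V where V: "tri T A1 V B2" "tri T V W A2" using octahedron'[OF W(2) 2] .
  have V': "tri T B2 V A1" using tri_swap[OF V(1) z] .
  obtain A where A: "tri T B2 W A" "tri T A1 A A2" using octahedron[OF V' V(2)] .
  obtain B where B: "tri T B1 B B2" "tri T B Y A" using octahedron'[OF W(1) A(1)] .
  show thesis using that[OF B(2) B(1) A(2)] .
qed

text \<open>A semiorthogonal decomposition is defined by generation; this is what turns generation
  into an actual triangle for every object, because the triangulated hull is contained in this
  class.\<close>

lemma decomposable_subcat:
  assumes A: "triangulated_subcat T A" and B: "triangulated_subcat T B"
    and z: "\<And>a b. \<lbrakk>a \<in> A; b \<in> B\<rbrakk> \<Longrightarrow> hom_zero T b a"
  shows "triangulated_subcat T {Y. \<exists>b\<in>B. \<exists>a\<in>A. tri T b Y a}" (is "triangulated_subcat T ?S")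
proof (rule triangulated_subcatI)
  show "?S \<subseteq> Ob T" using tri_Ob by blast
  show "Z \<in> ?S" if "zero_object T Z" for Z
    using that triangulated_subcatD(2)[OF A] triangulated_subcatD(2)[OF B] tri_ident_left
      zero_objectD(1) by blast
  fix X Y Z assume t: "tri T X Y Z" "X \<in> ?S" "Z \<in> ?S"
  then obtain b1 a1 b2 a2 where 1: "tri T b1 X a1" "b1 \<in> B" "a1 \<in> A" and 2: "tri T b2 Z a2" "b2 \<in> B" "a2 \<in> A"
    by blast
  have "hom_zero T b2 (ShO T a1)" using z triangulated_subcatD(4)[OF A 1(3)] 2 by (simp add: shift_1)
  from tri_merge[OF t(1) 1(1) 2(1) this]
  obtain b a where "tri T b Y a" "tri T b1 b b2" "tri T a1 a a2" .
  then show "Y \<in> ?S" using triangulated_subcat_ext A B 1 2 by blast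
next
  have "shift T i X \<in> ?S" if "X \<in> ?S" for X i
    using that triangulated_subcat_shift A B tri_shift tri_Ob by blast
  then show "X \<in> ?S \<Longrightarrow> shift T 1 X \<in> ?S" "X \<in> ?S \<Longrightarrow> shift T (- 1) X \<in> ?S" for X
    by blast+
qed

text \<open>Orthogonality of \<open>B\<close> and \<open>B'\<close> to the opposite right-hand terms
  gives comparison maps in both directions; orthogonality of their shifts makes the maps mutually
  inverse.\<close>

lemma decomposition_unique:
  assumes 1: "tri T B Y A" and 2: "tri T B' Y A'"
    and z: "hom_zero T B A'" "hom_zero T B' A" "hom_zero T (ShO T B) A" "hom_zero T (ShO T B') A'"
  shows "isomorphic T A A'"
proof -
  obtain f g h where t: "triangle T B Y A f g h" using 1 unfolding tri_def by blast
  obtain f' g' h' where t': "triangle T B' Y A' f' g' h'" using 2 unfolding tri_def by blast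
  note O = triangle_Ob[OF t] note O' = triangle_Ob[OF t']
  have "g' \<cdot> f = Zero T B A'" using hom_zeroD[OF z(1)] comp_hom O O' by blast
  then obtain v where v: "v \<in> Hom T A A'" "v \<cdot> g = g'" using triangle_extend[OF t O'(5)] by blast
  have "g \<cdot> f' = Zero T B' A" using hom_zeroD[OF z(2)] comp_hom O O' by blast
  then obtain w where w: "w \<in> Hom T A' A" "w \<cdot> g' = g" using triangle_extend[OF t' O(5)] by blast
  \<comment> \<open>The difference of \<open>k\<close> and the identity vanishes on
    \<open>Y\<close>, hence factors through \<open>ShO T B\<close>, which has no nonzero map to
    \<open>A\<close>.\<close>
  have *: "k = Ident T A" if tt: "triangle T B Y A f g h" and zz: "hom_zero T (ShO T B) A"
    and k: "k \<in> Hom T A A" "k \<cdot> g = g" for B A f g h k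
  proof -
    note O = triangle_Ob[OF tt]
    note i = ident_hom[OF O(3)]
    have "sub k (Ident T A) \<cdot> g = sub (k \<cdot> g) (Ident T A \<cdot> g)"
      using sub_comp[OF O(5) k(1) i] .
    also have "\<dots> = Zero T Y A"
      using k(2) ident_comp[OF O(5)] sub_eq_zero_iff[OF O(5) O(5)] by simp
    finally obtain l where l: "l \<in> Hom T (ShO T B) A" "l \<cdot> h = sub k (Ident T A)"
      using triangle_extend2[OF tt sub_hom[OF k(1) i]] by blast
    then have "sub k (Ident T A) = Zero T A A"
      using hom_zeroD[OF zz l(1)] zero_comp[OF O(6) O(3)] by simp
    then show ?thesis using sub_eq_zero_iff[OF k(1) i] by simp
  qed
  show ?thesis
  proof (rule isomorphicI[OF v(1) w(1)])
    show "w \<cdot> v = Ident T A"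
      by (rule *[OF t z(3) comp_hom[OF v(1) w(1)]]) (use comp_assoc[OF O(5) v(1) w(1)] v w in simp)
    show "v \<cdot> w = Ident T A'"
      by (rule *[OF t' z(4) comp_hom[OF w(1) v(1)]]) (use comp_assoc[OF O'(5) w(1) v(1)] v w in simp)
  qed
qed

end

section \<open>Compact objects and localization\<close>

text \<open>\<open>U\<close> consists of sets of one type. This transfers smallness to sets of
  morphisms, objects or integers through an injective encoding.\<close>

definition is_small :: "'i set set \<Rightarrow> 'a set \<Rightarrow> bool" where
  "is_small U A \<longleftrightarrow> (\<exists>e. inj_on e A \<and> e ` A \<in> U)"

context smallness
begin

lemma is_small_subset: assumes "is_small U A" "B \<subseteq> A" shows "is_small U B"
proof -
  obtain e where e: "inj_on e A" "e ` A \<in> U" using assms unfolding is_small_def by blast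
  have "e ` B \<in> U" using small_image[OF e(2), of "e ` B" id] assms(2) by auto
  then show ?thesis using e(1) assms(2) inj_on_subset unfolding is_small_def by blast
qed

lemma is_small_image: assumes "is_small U A" shows "is_small U (g ` A)"
proof -
  have "is_small U (inv_into A g ` g ` A)"
    by (rule is_small_subset[OF assms]) (auto intro: inv_into_into)
  then obtain e where e: "inj_on e (inv_into A g ` g ` A)" "e ` inv_into A g ` g ` A \<in> U"
    unfolding is_small_def by blast
  then have "inj_on (e \<circ> inv_into A g) (g ` A)"
    by (simp add: comp_inj_on inj_on_inv_into)
  then show ?thesis using e(2) unfolding is_small_def by (metis image_comp)
qed

lemma is_small_nat: "is_small U (UNIV :: nat set)"
proof -
  obtain A where A: "A \<in> U" "infinite A" using small_infinite by blast
  obtain f :: "nat \<Rightarrow> _" where f: "inj f" "range f \<subseteq> A" using infinite_countable_subset[OF A(2)] by blast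
  have "range f \<in> U" using small_image[OF A(1), of "range f" id] f by auto
  then show ?thesis using f unfolding is_small_def by blast
qed

lemma is_small_int: "is_small U (UNIV :: int set)"
proof -
  let ?f = "\<lambda>n. if even n then int (n div 2) else - int ((n + 1) div 2)"
  have "z \<in> range ?f" for z :: int
  proof (cases "0 \<le> z")
    case True
    then show ?thesis by (intro image_eqI[of _ _ "2 * nat z"]) auto
  next
    case False
    then show ?thesis by (intro image_eqI[of _ _ "2 * nat (- z) - 1"]) (auto simp: algebra_simps)
  qed
  then have "range ?f = UNIV" by blast
  then show ?thesis using is_small_image[OF is_small_nat, of ?f] by simp
qed

end

text \<open>The extra assumption is part of what it means for the compact objects to have a
  semiorthogonal decomposition, so the theorem can discharge it from its hypothesis.\<close>

locale compactly_generated_category = compactly_generated T U G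
  for T :: "('o, 'm, 'x) tricat_scheme" (structure) and U :: "'i set set" and G :: 'o +
  assumes compact_subcat: "triangulated_subcat T (compact_objects T U)"

context compactly_generated
begin

section \<open>Morphisms from compact objects into coproducts\<close>

lemma compact_Ob: "K \<in> compact_objects T U \<Longrightarrow> K \<in> Ob T"
  by (simp add: compact_objects_def compact_object_def)

lemma small_coproduct:
  assumes A: "is_small U A" and X: "\<And>a. a \<in> A \<Longrightarrow> X a \<in> Ob T"
  obtains C \<iota> where "is_coproduct T A X C \<iota>"
proof -
  obtain e where e: "inj_on e A" "e ` A \<in> U" using A unfolding is_small_def by blast
  have "\<And>i. i \<in> e ` A \<Longrightarrow> (X \<circ> inv_into A e) i \<in> Ob T" using X inv_into_into by (simp add: inv_into_into)
  then obtain C \<iota> where "is_coproduct T (e ` A) (X \<circ> inv_into A e) C \<iota>" using ex_coproduct[OF e(2)] by blast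
  then have "is_coproduct T A ((X \<circ> inv_into A e) \<circ> e) C (\<iota> \<circ> e)" using coproduct_reindex e(1) by blast
  then have "is_coproduct T A X C (\<iota> \<circ> e)" unfolding is_coproduct_def using e(1) by simp
  then show thesis using that by blast
qed

lemma is_small_Hom: "\<lbrakk>K \<in> compact_objects T U; Y \<in> Ob T\<rbrakk> \<Longrightarrow> is_small U (Hom T K Y)"
  using small_hom unfolding is_small_def bij_betw_def
  by (metis bij_betw_def bij_betw_inv_into)

lemma compact_expansion_aux:
  assumes K: "K \<in> compact_objects T U" and I: "I \<in> U" and C: "is_coproduct T I Y C \<iota>"
    and v: "v \<in> Hom T K C"
  obtains J f where "finite J" "J \<subseteq> I" "\<And>i. i \<in> I \<Longrightarrow> f i \<in> Hom T K (Y i)"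
    "v = finprod (hom_group T K C) (\<lambda>i. \<iota> i \<cdot> f i) J"
proof -
  have "bij_betw
          (\<lambda>f. finprod (hom_group T K C) (\<lambda>i. \<iota> i \<cdot> f i) {i \<in> I. f i \<noteq> Zero T K (Y i)})
          {f \<in> (\<Pi>\<^sub>E i\<in>I. Hom T K (Y i)). finite {i \<in> I. f i \<noteq> Zero T K (Y i)}}
          (Hom T K C)"
    using K I C unfolding compact_objects_def compact_object_def by blast
  then obtain f where f: "f \<in> (\<Pi>\<^sub>E i\<in>I. Hom T K (Y i))" "finite {i \<in> I. f i \<noteq> Zero T K (Y i)}"
     "v = finprod (hom_group T K C) (\<lambda>i. \<iota> i \<cdot> f i) {i \<in> I. f i \<noteq> Zero T K (Y i)}"
    using v unfolding bij_betw_def by force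
  show thesis by (rule that[OF f(2) _ _ f(3)]) (use f(1) in auto)
qed

text \<open>The predicate also sees the index set, because the coordinates of a partial sum depend
  on which summands have been added.\<close>

lemma finprod_induct:
  assumes K: "K \<in> Ob T" and C: "is_coproduct T I Y C \<iota>"
    and J: "finite J" "J \<subseteq> I" and f: "\<And>i. i \<in> I \<Longrightarrow> f i \<in> Hom T K (Y i)"
    and 0: "P {} (Zero T K C)"
    and step: "\<And>j J v. \<lbrakk>finite J; J \<subseteq> I; j \<in> I; j \<notin> J; v \<in> Hom T K C; P J v\<rbrakk> \<Longrightarrow> P (insert j J) (Add T (\<iota> j \<cdot> f j) v)"
  shows "P J (finprod (hom_group T K C) (\<lambda>i. \<iota> i \<cdot> f i) J)"
proof -
  note D = is_coproductD[OF C]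
  interpret H: comm_group "hom_group T K C" using hom_comm_group K D by blast
  have c: "\<iota> i \<cdot> f i \<in> carrier (hom_group T K C)" if "i \<in> I" for i
    using comp_hom[OF f[OF that] D(3)[OF that]] by (simp add: hom_group_def)
  show ?thesis using J
  proof (induction J rule: finite_induct)
    case empty
    have "\<one>\<^bsub>hom_group T K C\<^esub> = Zero T K C" by (simp add: hom_group_def)
    then show ?case using 0 by (simp only: H.finprod_empty)
  next
    case (insert j J)
    have "finprod (hom_group T K C) (\<lambda>i. \<iota> i \<cdot> f i) (insert j J) =
      Add T (\<iota> j \<cdot> f j) (finprod (hom_group T K C) (\<lambda>i. \<iota> i \<cdot> f i) J)"
      using H.finprod_insert[OF insert(1,2)] c insert(4) by (simp add: hom_group_def Pi_def subset_iff)
    moreover have "finprod (hom_group T K C) (\<lambda>i. \<iota> i \<cdot> f i) J \<in> Hom T K C"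
      using H.finprod_closed[of "\<lambda>i. \<iota> i \<cdot> f i" J] c insert(4) by (simp add: hom_group_def Pi_def subset_iff)
    ultimately show ?case using step[OF insert(1) _ _ insert(2)] insert by simp
  qed
qed

text \<open>By compactness, every morphism into the coproduct is a finite sum of morphisms through
  single summands.\<close>

lemma compact_induct_aux:
  assumes K: "K \<in> compact_objects T U" and I: "I \<in> U" and C: "is_coproduct T I Y C \<iota>"
    and v: "v \<in> Hom T K C"
    and P: "P (Zero T K C)" "\<And>i f. \<lbrakk>i \<in> I; f \<in> Hom T K (Y i)\<rbrakk> \<Longrightarrow> P (\<iota> i \<cdot> f)"
      "\<And>v w. \<lbrakk>v \<in> Hom T K C; w \<in> Hom T K C; P v; P w\<rbrakk> \<Longrightarrow> P (Add T v w)"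
  shows "P v"
proof -
  obtain J f where J: "finite J" "J \<subseteq> I" "\<And>i. i \<in> I \<Longrightarrow> f i \<in> Hom T K (Y i)"
    "v = finprod (hom_group T K C) (\<lambda>i. \<iota> i \<cdot> f i) J"
    using compact_expansion_aux[OF K I C v] by blast
  note D = is_coproductD[OF C]
  show ?thesis unfolding J(4)
  proof (rule finprod_induct[OF compact_Ob[OF K] C J(1,2), where P = "\<lambda>_. P"])
    fix j J v assume "j \<in> I" "v \<in> Hom T K C" "P v"
    then show "P (Add T (\<iota> j \<cdot> f j) v)"
      using P(3)[OF comp_hom[OF J(3) D(3)]] P(2)[OF _ J(3)] by simp
  qed (use J(3) P(1) in auto)
qed

text \<open>If \<open>v\<close> is the finite sum of the \<open>\<iota> i \<cdot> f i\<close> over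
  \<open>J\<close>, its coordinates are the \<open>f i\<close> on \<open>J\<close> and zero
  elsewhere; both claims follow from this expansion.\<close>

lemma compact_proj_aux:
  assumes K: "K \<in> compact_objects T U" and I: "I \<in> U" and C: "is_coproduct T I Y C \<iota>"
    and v: "v \<in> Hom T K C"
    and p: "\<And>i. i \<in> I \<Longrightarrow> p i \<in> Hom T C (Y i)"
      "\<And>i j. \<lbrakk>i \<in> I; j \<in> I\<rbrakk> \<Longrightarrow> p i \<cdot> \<iota> j = (if i = j then Ident T (Y i) else Zero T (Y j) (Y i))"
  shows "finite {i \<in> I. p i \<cdot> v \<noteq> Zero T K (Y i)}"
    and "(\<And>i. i \<in> I \<Longrightarrow> p i \<cdot> v = Zero T K (Y i)) \<Longrightarrow> v = Zero T K C"
proof -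
  obtain J f where J: "finite J" "J \<subseteq> I" and f: "\<And>i. i \<in> I \<Longrightarrow> f i \<in> Hom T K (Y i)"
    and vJ: "v = finprod (hom_group T K C) (\<lambda>i. \<iota> i \<cdot> f i) J"
    using compact_expansion_aux[OF K I C v] by blast
  note D = is_coproductD[OF C] and KO = compact_Ob[OF K]
  have pv: "p i \<cdot> v = (if i \<in> J then f i else Zero T K (Y i))" if i: "i \<in> I" for i
    unfolding vJ
  proof (rule finprod_induct[OF KO C J f, where P = "\<lambda>J v. p i \<cdot> v = (if i \<in> J then f i else Zero T K (Y i))"])
    show "p i \<cdot> Zero T K C = (if i \<in> {} then f i else Zero T K (Y i))"
      using comp_zero[OF p(1)[OF i] KO] by simp
    fix j J v assume A: "finite J" "J \<subseteq> I" "j \<in> I" "j \<notin> J" "v \<in> Hom T K C"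
      "p i \<cdot> v = (if i \<in> J then f i else Zero T K (Y i))"
    have "p i \<cdot> Add T (\<iota> j \<cdot> f j) v = Add T (p i \<cdot> (\<iota> j \<cdot> f j)) (p i \<cdot> v)"
      using comp_add[OF comp_hom[OF f[OF A(3)] D(3)[OF A(3)]] A(5) p(1)[OF i]] .
    also have "p i \<cdot> (\<iota> j \<cdot> f j) = (if i = j then f i else Zero T K (Y i))"
      using comp_assoc[OF f[OF A(3)] D(3)[OF A(3)] p(1)[OF i]] p(2)[OF i A(3)]
        ident_comp[OF f[OF A(3)]] zero_comp[OF f[OF A(3)] D(2)[OF i]] by auto
    finally show "p i \<cdot> Add T (\<iota> j \<cdot> f j) v = (if i \<in> insert j J then f i else Zero T K (Y i))"
      using A(4,6) add_zero[OF f[OF i]] add_zero_left[OF f[OF i]] add_zero[OF zero_hom[OF KO D(2)[OF i]]] by auto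
  qed auto
  show "finite {i \<in> I. p i \<cdot> v \<noteq> Zero T K (Y i)}"
    by (rule finite_subset[OF _ J(1)]) (auto simp: pv split: if_splits)
  assume z: "\<And>i. i \<in> I \<Longrightarrow> p i \<cdot> v = Zero T K (Y i)"
  have fz: "f i = Zero T K (Y i)" if "i \<in> J" for i
    using z[of i] pv[of i] that J(2) by auto
  have "J \<subseteq> J \<longrightarrow> v = Zero T K C"
    unfolding vJ
  proof (rule finprod_induct[OF KO C J f, where P = "\<lambda>J' v. J' \<subseteq> J \<longrightarrow> v = Zero T K C"])
    fix j J' v assume A: "J' \<subseteq> I" "j \<in> I" "v \<in> Hom T K C" "J' \<subseteq> J \<longrightarrow> v = Zero T K C"
    show "insert j J' \<subseteq> J \<longrightarrow> Add T (\<iota> j \<cdot> f j) v = Zero T K C"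
      using A fz[of j] comp_zero[OF D(3)[OF A(2)] KO] add_zero[OF zero_hom[OF KO D(1)]] by auto
  qed auto
  then show "v = Zero T K C" by simp
qed

context
  fixes A :: "'a set" and Y :: "'a \<Rightarrow> 'o" and C \<iota> K v
  assumes K: "K \<in> compact_objects T U" and A: "is_small U A" and C: "is_coproduct T A Y C \<iota>"
    and v: "v \<in> Hom T K C"
begin

text \<open>The encoding of the small set \<open>A\<close> in \<open>U\<close> transports the
  induction from indices of the fixed type.\<close>

lemma compact_induct:
  assumes P: "P (Zero T K C)" "\<And>i f. \<lbrakk>i \<in> A; f \<in> Hom T K (Y i)\<rbrakk> \<Longrightarrow> P (\<iota> i \<cdot> f)"
      "\<And>v w. \<lbrakk>v \<in> Hom T K C; w \<in> Hom T K C; P v; P w\<rbrakk> \<Longrightarrow> P (Add T v w)"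
  shows "P v"
proof -
  obtain e where e: "inj_on e A" "e ` A \<in> U" using A unfolding is_small_def by blast
  show ?thesis
    by (rule compact_induct_aux[OF K e(2) coproduct_reindex'[OF C e(1)] v])
      (use P inv_into_into in \<open>auto simp: e(1)\<close>)
qed

lemma
  assumes p: "\<And>i. i \<in> A \<Longrightarrow> p i \<in> Hom T C (Y i)"
      "\<And>i j. \<lbrakk>i \<in> A; j \<in> A\<rbrakk> \<Longrightarrow> p i \<cdot> \<iota> j = (if i = j then Ident T (Y i) else Zero T (Y j) (Y i))"
  shows compact_proj_finite: "finite {i \<in> A. p i \<cdot> v \<noteq> Zero T K (Y i)}"
    and compact_proj_zero: "(\<And>i. i \<in> A \<Longrightarrow> p i \<cdot> v = Zero T K (Y i)) \<Longrightarrow> v = Zero T K C"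
proof -
  obtain e where e: "inj_on e A" "e ` A \<in> U" using A unfolding is_small_def by blast
  let ?r = "inv_into A e"
  have p1: "(p \<circ> ?r) i \<in> Hom T C ((Y \<circ> ?r) i)" if "i \<in> e ` A" for i
    using that p(1) inv_into_into[OF that] by simp
  have p2: "(p \<circ> ?r) i \<cdot> (\<iota> \<circ> ?r) j = (if i = j then Ident T ((Y \<circ> ?r) i) else Zero T ((Y \<circ> ?r) j) ((Y \<circ> ?r) i))"
    if "i \<in> e ` A" "j \<in> e ` A" for i j
    using p(2)[OF inv_into_into[OF that(1)] inv_into_into[OF that(2)]] that e(1) by (auto simp: inv_into_f_f)
  note * = compact_proj_aux[OF K e(2) coproduct_reindex'[OF C e(1)] v, of "p \<circ> ?r", OF p1 p2]
  have "{i \<in> A. p i \<cdot> v \<noteq> Zero T K (Y i)} \<subseteq>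
    ?r ` {i \<in> e ` A. (p \<circ> ?r) i \<cdot> v \<noteq> Zero T K ((Y \<circ> ?r) i)}"
  proof
    fix i assume i: "i \<in> {i \<in> A. p i \<cdot> v \<noteq> Zero T K (Y i)}"
    show "i \<in> ?r ` {i \<in> e ` A. (p \<circ> ?r) i \<cdot> v \<noteq> Zero T K ((Y \<circ> ?r) i)}"
      by (rule image_eqI[of _ _ "e i"]) (use i e(1) in auto)
  qed
  then show "finite {i \<in> A. p i \<cdot> v \<noteq> Zero T K (Y i)}"
    using *(1) finite_surj by blast
  assume "\<And>i. i \<in> A \<Longrightarrow> p i \<cdot> v = Zero T K (Y i)"
  then show "v = Zero T K C" using *(2) inv_into_into[of _ e A] by simp
qed

end

section \<open>Closure properties of \<open>Coprod\<close> and orthogonality\<close>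

lemma Coprod_Ob: assumes "S \<subseteq> Ob T" shows "Coprod T U S \<subseteq> Ob T"
proof
  fix X assume "X \<in> Coprod T U S"
  then show "X \<in> Ob T"
    by (induction rule: Coprod.induct) (use assms in \<open>auto dest: is_coproductD(1) triangle_Ob(2)\<close>)
qed

lemma Coprod_mono: assumes "S \<subseteq> Coprod T U S'" shows "Coprod T U S \<subseteq> Coprod T U S'"
proof
  fix X assume "X \<in> Coprod T U S"
  then show "X \<in> Coprod T U S'"
    by (induction rule: Coprod.induct) (use assms in \<open>auto intro: Coprod.intros\<close>)
qed

lemma Coprod_mono_set: "S \<subseteq> S' \<Longrightarrow> Coprod T U S \<subseteq> Coprod T U S'"
  by (rule Coprod_mono) (auto intro: Coprod.base)

text \<open>A zero object is a coproduct of the empty family.\<close>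

lemma Coprod_zero: assumes N: "zero_object T N" shows "N \<in> Coprod T U S"
proof -
  have "{} \<in> U" using small_infinite small_image[of _ "{}" id] by auto
  moreover have "is_coproduct T {} (\<lambda>_. N) N (\<lambda>_. Ident T N)"
    using N unfolding is_coproduct_def zero_object_def by auto
  ultimately show ?thesis using Coprod.coproduct[of "{}" U "\<lambda>_. N" T S N] by blast
qed

lemma Coprod_ext: "\<lbrakk>tri T X Y Z; X \<in> Coprod T U S; Z \<in> Coprod T U S\<rbrakk> \<Longrightarrow> Y \<in> Coprod T U S"
  unfolding tri_def by (auto intro: Coprod.extension)

lemma Coprod_coproduct:
  assumes A: "is_small U A" and X: "\<And>a. a \<in> A \<Longrightarrow> X a \<in> Coprod T U S" and C: "coprod T A X C"
  shows "C \<in> Coprod T U S"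
proof -
  obtain e where e: "inj_on e A" "e ` A \<in> U" using A unfolding is_small_def by blast
  obtain \<iota> where \<iota>: "is_coproduct T A X C \<iota>" using C unfolding coprod_def by blast
  show ?thesis
    by (rule Coprod.coproduct[OF e(2) _ coproduct_reindex'[OF \<iota> e(1)]]) (use X e(1) in auto)
qed

lemma Coprod_shift: assumes S: "S \<subseteq> Ob T" and X: "X \<in> Coprod T U S" shows "shift T k X \<in> Coprod T U (shift T k ` S)"
  using X
proof (induction rule: Coprod.induct)
  case (base X)
  then show ?case by (auto intro: Coprod.base)
next
  case (coproduct I X Y \<iota>)
  have "coprod T I (\<lambda>i. shift T k (X i)) (shift T k Y)"
    by (rule coprod_shift) (use coproduct in \<open>auto simp: coprod_def\<close>)
  moreover have "is_small U I" using coproduct(1) unfolding is_small_def by (metis image_ident inj_on_id2)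
  ultimately show ?case
    using Coprod_coproduct[of I "\<lambda>i. shift T k (X i)" "shift T k ` S"] coproduct.IH by simp
next
  case (extension X Z Y f g h)
  then have t: "tri T X Y Z" unfolding tri_def by blast
  then have "tri T (shift T k X) (shift T k Y) (shift T k Z)" using tri_shift tri_Ob by blast
  then show ?case using Coprod_ext extension by blast
qed

lemma Coprod_hom_zero_left:
  assumes S: "\<And>s. s \<in> S \<Longrightarrow> hom_zero T s Y" and Y: "Y \<in> Ob T" and X: "X \<in> Coprod T U S"
  shows "hom_zero T X Y"
  using X
proof (induction rule: Coprod.induct)
  case (base X)
  then show ?case by (rule S)
next
  case (coproduct I X C \<iota>)
  note D = is_coproductD[OF coproduct.hyps(3)]
  show ?case
  proof (rule hom_zeroI[OF D(1) Y])
    fix f assume f: "f \<in> Hom T C Y"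
    show "f = Zero T C Y"
    proof (rule coproduct_eqI[OF coproduct.hyps(3) f zero_hom[OF D(1) Y]])
      fix i assume i: "i \<in> I"
      show "f \<cdot> \<iota> i = Zero T C Y \<cdot> \<iota> i"
        using hom_zeroD[OF coproduct.IH[OF i] comp_hom[OF D(3)[OF i] f]] zero_comp[OF D(3)[OF i] Y] by simp
    qed
  qed
next
  case (extension X Z Y f g h)
  then show ?case using tri_hom_zero_left unfolding tri_def by blast
qed

lemma coproduct_hom_zero:
  assumes K: "K \<in> compact_objects T U" and A: "is_small U A" and C: "coprod T A X C"
    and z: "\<And>a. a \<in> A \<Longrightarrow> hom_zero T K (X a)"
  shows "hom_zero T K C"
proof -
  obtain \<iota> where \<iota>: "is_coproduct T A X C \<iota>" using C unfolding coprod_def by blast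
  note D = is_coproductD[OF \<iota>] and KO = compact_Ob[OF K]
  show ?thesis
  proof (rule hom_zeroI[OF KO D(1)])
    fix v assume v: "v \<in> Hom T K C"
    show "v = Zero T K C"
    proof (rule compact_induct[OF K A \<iota> v])
      fix i f assume "i \<in> A" "f \<in> Hom T K (X i)"
      then show "\<iota> i \<cdot> f = Zero T K C" using hom_zeroD[OF z] comp_zero[OF D(3) KO] by metis
    qed (use add_zero zero_hom KO D in auto)
  qed
qed

text \<open>In contrast to \<open>Coprod_hom_zero_left\<close>, where the universal property handles
  coproducts, vanishing passes to a coproduct in the target because \<open>K\<close> is
  compact.\<close>

lemma Coprod_hom_zero_right:
  assumes K: "K \<in> compact_objects T U" and S: "\<And>s. s \<in> S \<Longrightarrow> hom_zero T K s" and X: "X \<in> Coprod T U S"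
  shows "hom_zero T K X"
  using X
proof (induction rule: Coprod.induct)
  case (base X)
  then show ?case by (rule S)
next
  case (coproduct I X C \<iota>)
  have "is_small U I" using coproduct(1) unfolding is_small_def by (metis image_ident inj_on_id2)
  then show ?case by (rule coproduct_hom_zero[OF K]) (use coproduct in \<open>auto simp: coprod_def\<close>)
next
  case (extension X Z Y f g h)
  then show ?case using tri_hom_zero_right unfolding tri_def by blast
qed

end

section \<open>Homotopy colimits and localization\<close>

context compactly_generated_category
begin

lemma compact_shift: "K \<in> compact_objects T U \<Longrightarrow> shift T i K \<in> compact_objects T U"
  using triangulated_subcat_shift compact_subcat by blast

text \<open>The cone of identity minus shift on the coproduct of the \<open>X n\<close>. It is only
  a weak colimit: \<open>k\<close> is not claimed to be unique. For compact sources, each morphism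
  to \<open>H\<close> is represented at a finite stage.\<close>

lemma hocolim:
  fixes X :: "nat \<Rightarrow> 'o"
  assumes x: "\<And>n. x n \<in> Hom T (X n) (X (Suc n))"
  obtains C H j where "coprod T UNIV X C" "tri T C C H"
    and "\<forall>n. j n \<in> Hom T (X n) H \<and> j (Suc n) \<cdot> x n = j n"
    and "\<forall>D g. (\<forall>n. g n \<in> Hom T (X n) D \<and> g (Suc n) \<cdot> x n = g n) \<longrightarrow> (\<exists>k \<in> Hom T H D. \<forall>n. k \<cdot> j n = g n)"
    and "\<forall>K \<in> compact_objects T U. \<forall>u \<in> Hom T K H. \<exists>n. \<exists>w \<in> Hom T K (X n). u = j n \<cdot> w"
proof -
  have X: "X n \<in> Ob T" for n using x Hom_ObD by blast
  obtain C \<iota> where C: "is_coproduct T UNIV X C \<iota>" using small_coproduct[OF is_small_nat, of X] X by blast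
  have D: "C \<in> Ob T" "\<And>n. \<iota> n \<in> Hom T (X n) C" using is_coproductD[OF C] by auto
  obtain p where p: "\<And>n. p n \<in> Hom T C (X n)"
    "\<And>n m. p n \<cdot> \<iota> m = (if n = m then Ident T (X n) else Zero T (X m) (X n))"
    using coproduct_proj[OF C] by (metis UNIV_I)
  have ix: "\<iota> (Suc n) \<cdot> x n \<in> Hom T (X n) C" for n using D x comp_hom by blast
  obtain \<phi> where \<phi>: "\<phi> \<in> Hom T C C" "\<And>n. \<phi> \<cdot> \<iota> n = sub (\<iota> n) (\<iota> (Suc n) \<cdot> x n)"
    by (rule coproduct_map[OF C, of "\<lambda>n. sub (\<iota> n) (\<iota> (Suc n) \<cdot> x n)" C])
      (use D ix sub_hom in auto)
  \<comment> \<open>In coordinates \<open>\<phi>\<close> is triangular: coordinate 0 is unchanged,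
    and from coordinate m + 1 the image of coordinate m is subtracted. Induction on the coordinates
    then shows that \<open>\<phi>\<close> is injective on morphisms out of compact objects.\<close>
  have p0: "p 0 \<cdot> \<phi> = p 0"
  proof (rule coproduct_eqI[OF C comp_hom[OF \<phi>(1) p(1)] p(1)])
    fix n
    have "(p 0 \<cdot> \<phi>) \<cdot> \<iota> n = sub (p 0 \<cdot> \<iota> n) (p 0 \<cdot> (\<iota> (Suc n) \<cdot> x n))"
      using comp_assoc[OF D(2) \<phi>(1) p(1)] \<phi>(2) comp_sub[OF D(2) ix p(1)] by simp
    also have "p 0 \<cdot> (\<iota> (Suc n) \<cdot> x n) = Zero T (X n) (X 0)"
      using comp_assoc[OF x[of n] D(2) p(1)[of 0]] p(2)[of 0 "Suc n"] zero_comp[OF x X] by simp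
    finally show "(p 0 \<cdot> \<phi>) \<cdot> \<iota> n = p 0 \<cdot> \<iota> n"
      using sub_add[OF comp_hom[OF D(2) p(1)] zero_hom[OF X X]]
        add_zero[OF sub_hom[OF comp_hom[OF D(2) p(1)] zero_hom[OF X X]]] by metis
  qed
  have pS: "p (Suc m) \<cdot> \<phi> = sub (p (Suc m)) (x m \<cdot> p m)" for m
  proof (rule coproduct_eqI[OF C comp_hom[OF \<phi>(1) p(1)] sub_hom[OF p(1) comp_hom[OF p(1) x]]])
    fix n
    have "(p (Suc m) \<cdot> \<phi>) \<cdot> \<iota> n = sub (p (Suc m) \<cdot> \<iota> n) (p (Suc m) \<cdot> (\<iota> (Suc n) \<cdot> x n))"
      using comp_assoc[OF D(2) \<phi>(1) p(1)] \<phi>(2) comp_sub[OF D(2) ix p(1)] by simp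
    also have "p (Suc m) \<cdot> (\<iota> (Suc n) \<cdot> x n) = (x m \<cdot> p m) \<cdot> \<iota> n"
      using comp_assoc[OF x[of n] D(2) p(1)[of "Suc m"]] comp_assoc[OF D(2)[of n] p(1) x[of m]] p(2)[of "Suc m" "Suc n"] p(2)[of m n]
         zero_comp[OF x X] comp_zero[OF x X] ident_comp[OF x] comp_ident[OF x] by auto
    also have "sub (p (Suc m) \<cdot> \<iota> n) ((x m \<cdot> p m) \<cdot> \<iota> n) = sub (p (Suc m)) (x m \<cdot> p m) \<cdot> \<iota> n"
      using sub_comp[OF D(2) p(1) comp_hom[OF p(1) x]] by simp
    finally show "(p (Suc m) \<cdot> \<phi>) \<cdot> \<iota> n = sub (p (Suc m)) (x m \<cdot> p m) \<cdot> \<iota> n" .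
  qed
  have mono: "v = Zero T K C" if K: "K \<in> compact_objects T U" and v: "v \<in> Hom T K C" "\<phi> \<cdot> v = Zero T K C" for K v
  proof -
    note KO = compact_Ob[OF K]
    have "p n \<cdot> v = Zero T K (X n)" for n
    proof (induction n)
      case 0
      show ?case using comp_assoc[OF v(1) \<phi>(1) p(1), of 0] p0 v(2) comp_zero[OF p(1) KO] by simp
    next
      case (Suc n)
      have "sub (p (Suc n) \<cdot> v) ((x n \<cdot> p n) \<cdot> v) = (p (Suc n) \<cdot> \<phi>) \<cdot> v"
        using sub_comp[OF v(1) p(1) comp_hom[OF p(1) x]] pS by simp
      also have "\<dots> = Zero T K (X (Suc n))"
        using comp_assoc[OF v(1) \<phi>(1) p(1)] v(2) comp_zero[OF p(1) KO] by simp
      finally have "p (Suc n) \<cdot> v = (x n \<cdot> p n) \<cdot> v"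
        using sub_eq_zero_iff comp_hom[OF v(1) p(1)] comp_hom[OF v(1) comp_hom[OF p(1) x]] by blast
      then show ?case using comp_assoc[OF v(1) p(1) x] Suc comp_zero[OF x KO] by simp
    qed
    then show ?thesis using compact_proj_zero[OF K is_small_nat C v(1), of p] p by blast
  qed
  obtain H q h where t: "triangle T C C H \<phi> q h" using TR1_cone[OF \<phi>(1)] by blast
  note O = triangle_Ob[OF t]
  let ?j = "\<lambda>n. q \<cdot> \<iota> n"
  have j: "?j n \<in> Hom T (X n) H" for n using comp_hom[OF D(2) O(5)] .
  have jx: "?j (Suc n) \<cdot> x n = ?j n" for n
  proof -
    have "sub (q \<cdot> \<iota> n) (q \<cdot> (\<iota> (Suc n) \<cdot> x n)) = q \<cdot> (\<phi> \<cdot> \<iota> n)"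
      using \<phi>(2) comp_sub[OF D(2) ix O(5)] by simp
    also have "\<dots> = Zero T (X n) H"
      using comp_assoc[OF D(2) \<phi>(1) O(5)] triangle_comp_zero[OF t] zero_comp[OF D(2) O(3)] by simp
    finally have "q \<cdot> \<iota> n = q \<cdot> (\<iota> (Suc n) \<cdot> x n)"
      using sub_eq_zero_iff[OF j comp_hom[OF ix O(5)]] by simp
    then show ?thesis using comp_assoc[OF x D(2) O(5)] by simp
  qed
  \<comment> \<open>This brings two representatives to a common stage, where they can be
    added.\<close>
  have jle: "\<exists>w' \<in> Hom T K (X m). ?j n \<cdot> w = ?j m \<cdot> w'" if "n \<le> m" "w \<in> Hom T K (X n)" for n m K w
    using that
  proof (induction m rule: dec_induct)
    case base then show ?case by blast
  next
    case (step m)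
    then obtain w' where w': "w' \<in> Hom T K (X m)" "?j n \<cdot> w = ?j m \<cdot> w'" by blast
    show ?case
      by (rule bexI[of _ "x m \<cdot> w'"]) (use w' comp_hom[OF w'(1) x] comp_assoc[OF w'(1) x j] jx in simp_all)
  qed
  show thesis
  proof (rule that[of C H ?j])
    show "coprod T UNIV X C" using C unfolding coprod_def by blast
    show "tri T C C H" using t unfolding tri_def by blast
    have "\<exists>k \<in> Hom T H E. \<forall>n. k \<cdot> (q \<cdot> \<iota> n) = g n"
      if g: "\<And>n. g n \<in> Hom T (X n) E" "\<And>n. g (Suc n) \<cdot> x n = g n" for E g
    proof -
      have E: "E \<in> Ob T" using g Hom_ObD by blast
      obtain k where k: "k \<in> Hom T C E" "\<And>n. k \<cdot> \<iota> n = g n" by (rule coproduct_map[OF C, of g E]) (use g(1) E in auto)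
      have "k \<cdot> \<phi> = Zero T C E"
      proof (rule coproduct_eqI[OF C comp_hom[OF \<phi>(1) k(1)] zero_hom[OF O(1) E]])
        fix n
        have "(k \<cdot> \<phi>) \<cdot> \<iota> n = sub (k \<cdot> \<iota> n) (k \<cdot> (\<iota> (Suc n) \<cdot> x n))"
          using comp_assoc[OF D(2) \<phi>(1) k(1)] \<phi>(2) comp_sub[OF D(2) ix k(1)] by simp
        also have "k \<cdot> (\<iota> (Suc n) \<cdot> x n) = k \<cdot> \<iota> n"
          using comp_assoc[OF x D(2) k(1)] k(2) g(2) by simp
        finally show "(k \<cdot> \<phi>) \<cdot> \<iota> n = Zero T C E \<cdot> \<iota> n"
          using sub_eq_zero_iff[OF comp_hom[OF D(2) k(1)] comp_hom[OF D(2) k(1)]] zero_comp[OF D(2) E] by simp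
      qed
      then obtain k' where k': "k' \<in> Hom T H E" "k' \<cdot> q = k" using triangle_extend[OF t k(1)] by blast
      then show ?thesis
        using comp_assoc[OF D(2) O(5) k'(1)] k(2) by (intro bexI[of _ k'] allI) simp_all
    qed
    then show "\<forall>D g. (\<forall>n. g n \<in> Hom T (X n) D \<and> g (Suc n) \<cdot> x n = g n) \<longrightarrow>
        (\<exists>k \<in> Hom T H D. \<forall>n. k \<cdot> (q \<cdot> \<iota> n) = g n)" by simp
  next
    have "\<exists>n. \<exists>w \<in> Hom T K (X n). u = ?j n \<cdot> w" if K: "K \<in> compact_objects T U" and u: "u \<in> Hom T K H" for K u
    proof -
      note KO = compact_Ob[OF K]
      let ?K = "shift T (- 1) K"
      have K': "?K \<in> Ob T" "ShO T ?K = K" using KO shift_m1_Ob ShO_shift_m1 by auto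
      have hu: "h \<cdot> u \<in> Hom T K (ShO T C)" using comp_hom u O by blast
      \<comment> \<open>The obstruction to lifting \<open>u\<close> through \<open>q\<close>
        desuspends to a morphism \<open>v\<close> killed by \<open>\<phi>\<close>; injectivity on
        the compact object \<open>?K\<close> makes it zero.\<close>
      obtain v where v: "v \<in> Hom T ?K C" "h \<cdot> u = ShA T v" using ShA_surj[OF K'(1) O(1)] hu K'(2) by metis
      have "ShA T (\<phi> \<cdot> v) = (ShA T \<phi> \<cdot> h) \<cdot> u"
        using ShA_comp[OF v(1) \<phi>(1)] v(2) comp_assoc[OF u O(6) ShA_hom[OF \<phi>(1)]] by simp
      also have "\<dots> = Zero T K (ShO T C)"
        using triangle_comp_zero3[OF t] zero_comp[OF u ShO_Ob[OF O(1)]] by simp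
      finally have "ShA T (\<phi> \<cdot> v) = ShA T (Zero T ?K C)" using ShA_zero[OF K'(1) O(1)] K'(2) by simp
      then have "\<phi> \<cdot> v = Zero T ?K C" using ShA_inj[OF comp_hom[OF v(1) \<phi>(1)] zero_hom[OF K'(1) O(1)]] by blast
      then have "v = Zero T ?K C" using mono[OF compact_shift[OF K] v(1)] by blast
      then have "h \<cdot> u = Zero T K (ShO T C)" using v(2) ShA_zero[OF K'(1) O(1)] K'(2) by simp
      then obtain u' where u': "u' \<in> Hom T K C" "q \<cdot> u' = u" using triangle_lift2[OF t u] by blast
      have "\<exists>n. \<exists>w \<in> Hom T K (X n). q \<cdot> u' = ?j n \<cdot> w"
      proof (rule compact_induct[OF K is_small_nat C u'(1)])
        show "\<exists>n. \<exists>w \<in> Hom T K (X n). q \<cdot> Zero T K C = ?j n \<cdot> w"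
          using comp_zero[OF O(5) KO] comp_zero[OF j KO] zero_hom[OF KO X] by metis
        fix n f assume f: "f \<in> Hom T K (X n)"
        then show "\<exists>m. \<exists>w \<in> Hom T K (X m). q \<cdot> (\<iota> n \<cdot> f) = ?j m \<cdot> w"
          using comp_assoc[OF f D(2) O(5)] by metis
      next
        fix v v' assume v: "v \<in> Hom T K C" "v' \<in> Hom T K C"
        assume "\<exists>n. \<exists>w \<in> Hom T K (X n). q \<cdot> v = ?j n \<cdot> w" "\<exists>n. \<exists>w \<in> Hom T K (X n). q \<cdot> v' = ?j n \<cdot> w"
        then obtain n w n' w' where w: "w \<in> Hom T K (X n)" "q \<cdot> v = ?j n \<cdot> w"
          and w': "w' \<in> Hom T K (X n')" "q \<cdot> v' = ?j n' \<cdot> w'" by blast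
        let ?m = "max n n'"
        obtain z where z: "z \<in> Hom T K (X ?m)" "?j n \<cdot> w = ?j ?m \<cdot> z" using jle[of n ?m, OF _ w(1)] by auto
        obtain z' where z': "z' \<in> Hom T K (X ?m)" "?j n' \<cdot> w' = ?j ?m \<cdot> z'" using jle[of n' ?m, OF _ w'(1)] by auto
        have "q \<cdot> Add T v v' = ?j ?m \<cdot> Add T z z'"
          using comp_add[OF v O(5)] comp_add[OF z(1) z'(1) j] z z' w w' by simp
        then show "\<exists>n. \<exists>w \<in> Hom T K (X n). q \<cdot> Add T v v' = ?j n \<cdot> w" using add_hom[OF z(1) z'(1)] by blast
      qed
      then show ?thesis using u'(2) by simp
    qed
    then show "\<forall>K \<in> compact_objects T U. \<forall>u \<in> Hom T K H. \<exists>n. \<exists>w \<in> Hom T K (X n). u = q \<cdot> \<iota> n \<cdot> w"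
      by blast
  qed (use j jx in auto)
qed

text \<open>\<open>Z\<close> contains one copy of s for each s in \<open>S\<close> and each morphism
  from s killed by \<open>g\<close>. With two nested coproducts, it is enough that \<open>S\<close>
  and each kernel are small.\<close>

lemma kernel_cover:
  assumes S: "is_small U S" "S \<subseteq> compact_objects T U" and g: "g \<in> Hom T X D"
  obtains Z p where "Z \<in> Coprod T U S" "p \<in> Hom T Z X" "g \<cdot> p = Zero T Z D"
    and "\<forall>s\<in>S. \<forall>f\<in>Hom T s X. g \<cdot> f = Zero T s D \<longrightarrow> (\<exists>f'\<in>Hom T s Z. f = p \<cdot> f')"
proof -
  have O: "X \<in> Ob T" "D \<in> Ob T" using g Hom_ObD by blast+
  define F where "F s = {f \<in> Hom T s X. g \<cdot> f = Zero T s D}" for s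
  have sO: "s \<in> Ob T" if "s \<in> S" for s using that S(2) compact_Ob by blast
  have F: "is_small U (F s)" if "s \<in> S" for s
    using is_small_subset[OF is_small_Hom[of s X], of "F s"] that S(2) O unfolding F_def by blast
  have "\<forall>s\<in>S. \<exists>C \<iota>. is_coproduct T (F s) (\<lambda>_. s) C \<iota>"
    using small_coproduct[OF F] sO by metis
  then obtain C \<iota> where C: "\<And>s. s \<in> S \<Longrightarrow> is_coproduct T (F s) (\<lambda>_. s) (C s) (\<iota> s)" by metis
  note D = is_coproductD[OF C]
  have "\<exists>q. q \<in> Hom T (C s) X \<and> (\<forall>f\<in>F s. q \<cdot> \<iota> s f = f)" if s: "s \<in> S" for s
    by (rule coproduct_map[OF C[OF s], of "\<lambda>f. f" X]) (use O in \<open>auto simp: F_def\<close>)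
  then obtain q where q: "\<And>s. s \<in> S \<Longrightarrow> q s \<in> Hom T (C s) X"
    "\<And>s f. \<lbrakk>s \<in> S; f \<in> F s\<rbrakk> \<Longrightarrow> q s \<cdot> \<iota> s f = f" by metis
  obtain Z \<kappa> where Z: "is_coproduct T S C Z \<kappa>"
    using small_coproduct[OF S(1), of C] D(1) by blast
  note E = is_coproductD[OF Z]
  obtain p where p: "p \<in> Hom T Z X" "\<And>s. s \<in> S \<Longrightarrow> p \<cdot> \<kappa> s = q s"
    by (rule coproduct_map[OF Z, of q X]) (use q(1) O in auto)
  show thesis
  proof (rule that[of Z p])
    have "C s \<in> Coprod T U S" if "s \<in> S" for s
      by (rule Coprod_coproduct[OF F[OF that], of "\<lambda>_. s"])
        (use C[OF that] that in \<open>auto simp: coprod_def intro: Coprod.base\<close>)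
    then show "Z \<in> Coprod T U S" using Coprod_coproduct[OF S(1)] Z unfolding coprod_def by blast
    show "p \<in> Hom T Z X" by (fact p)
    show "g \<cdot> p = Zero T Z D"
    proof (rule coproduct_eqI[OF Z comp_hom[OF p(1) g] zero_hom[OF E(1) O(2)]])
      fix s assume s: "s \<in> S"
      have "g \<cdot> q s = Zero T (C s) D"
      proof (rule coproduct_eqI[OF C[OF s] comp_hom[OF q(1)[OF s] g] zero_hom[OF D(1)[OF s] O(2)]])
        fix f assume f: "f \<in> F s"
        show "(g \<cdot> q s) \<cdot> \<iota> s f = Zero T (C s) D \<cdot> \<iota> s f"
          using comp_assoc[OF D(3)[OF s f] q(1)[OF s] g] q(2)[OF s f] f zero_comp[OF D(3)[OF s f] O(2)]
          by (simp add: F_def)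
      qed
      then show "(g \<cdot> p) \<cdot> \<kappa> s = Zero T Z D \<cdot> \<kappa> s"
        using comp_assoc[OF E(3)[OF s] p(1) g] p(2)[OF s] zero_comp[OF E(3)[OF s] O(2)] by simp
    qed
    have "\<exists>f' \<in> Hom T s Z. f = p \<cdot> f'" if s: "s \<in> S" and f: "f \<in> Hom T s X" "g \<cdot> f = Zero T s D" for s f
    proof -
      have fF: "f \<in> F s" using f by (simp add: F_def)
      show ?thesis
        by (rule bexI[of _ "\<kappa> s \<cdot> \<iota> s f"])
         (use comp_hom[OF D(3)[OF s fF] E(3)[OF s]] comp_assoc[OF D(3)[OF s fF] E(3)[OF s] p(1)] p(2)[OF s] q(2)[OF s fF] in simp_all)
    qed
    then show "\<forall>s\<in>S. \<forall>f\<in>Hom T s X. g \<cdot> f = Zero T s D \<longrightarrow> (\<exists>f'\<in>Hom T s Z. f = p \<cdot> f')" by blast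
  qed
qed

text \<open>\<open>X\<close> is the homotopy colimit of a sequence over \<open>D\<close>: the first term makes
  \<open>Hom(s, X) \<rightarrow> Hom(s, D)\<close> surjective, and each step kills the kernel of the previous one.
  Shifts up to 2 occur because the steps and the homotopy colimit are cones.\<close>

lemma localization:
  assumes S: "is_small U S" "S \<subseteq> compact_objects T U" and S': "\<And>s. s \<in> S \<Longrightarrow> shift T (- 1) s \<in> S"
    and D: "D \<in> Ob T"
  obtains X Y where "tri T X D Y" "X \<in> Coprod T U (S \<union> shift T 1 ` S \<union> shift T 2 ` S)" "Y \<in> right_perp T S"
proof -
  let ?S1 = "S \<union> shift T 1 ` S" and ?S2 = "S \<union> shift T 1 ` S \<union> shift T 2 ` S"
  have SO: "S \<subseteq> Ob T" using S(2) compact_Ob by blast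
  define P where "P = (\<lambda>(X, \<pi>). X \<in> Coprod T U ?S1 \<and> \<pi> \<in> Hom T X D \<and>
    (\<forall>s\<in>S. \<forall>f\<in>Hom T s D. \<exists>f'\<in>Hom T s X. f = \<pi> \<cdot> f'))"
  define R where "R = (\<lambda>(X, \<pi>) (X', \<pi>'). \<exists>x \<in> Hom T X X'. \<pi>' \<cdot> x = \<pi> \<and>
    (\<forall>s\<in>S. \<forall>f\<in>Hom T s X. \<pi> \<cdot> f = Zero T s D \<longrightarrow> x \<cdot> f = Zero T s X'))"
  have "\<exists>F. \<forall>n::nat. P (F n) \<and> R (F n) (F (Suc n))"
  proof (rule dependent_nat_choice[of "\<lambda>_. P" "\<lambda>_. R"])
    obtain N where N: "zero_object T N" using ex_zero_object by blast
    note NO = zero_objectD(1)[OF N]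
    \<comment> \<open>Every morphism to a zero object is zero, so this kernel cover hits all
      morphisms from \<open>S\<close> to \<open>D\<close>.\<close>
    obtain Z p where Z: "Z \<in> Coprod T U S" "p \<in> Hom T Z D" "Zero T D N \<cdot> p = Zero T Z N"
      "\<forall>s\<in>S. \<forall>f\<in>Hom T s D. Zero T D N \<cdot> f = Zero T s N \<longrightarrow> (\<exists>f'\<in>Hom T s Z. f = p \<cdot> f')"
      by (rule kernel_cover[OF S zero_hom[OF D NO]])
    have "Z \<in> Coprod T U ?S1" using Z(1) Coprod_mono_set[of S ?S1] by auto
    then have "P (Z, p)" using Z(2,4) zero_comp[OF _ NO] unfolding P_def by simp
    then show "\<exists>x. P x" by blast
  next
    fix Q and n :: nat assume "P Q"
    moreover obtain X \<pi> where Q: "Q = (X, \<pi>)" by (cases Q)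
    ultimately have X: "X \<in> Coprod T U ?S1" and \<pi>: "\<pi> \<in> Hom T X D"
      and sur: "\<And>s f. \<lbrakk>s \<in> S; f \<in> Hom T s D\<rbrakk> \<Longrightarrow> \<exists>f'\<in>Hom T s X. f = \<pi> \<cdot> f'"
      unfolding P_def by auto
    obtain Z p where Z: "Z \<in> Coprod T U S" "p \<in> Hom T Z X" "\<pi> \<cdot> p = Zero T Z D"
      "\<forall>s\<in>S. \<forall>f\<in>Hom T s X. \<pi> \<cdot> f = Zero T s D \<longrightarrow> (\<exists>f'\<in>Hom T s Z. f = p \<cdot> f')"
      by (rule kernel_cover[OF S \<pi>])
    obtain X' x h where t: "triangle T Z X X' p x h" using TR1_cone[OF Z(2)] by blast
    note O = triangle_Ob[OF t]
    obtain \<pi>' where \<pi>': "\<pi>' \<in> Hom T X' D" "\<pi>' \<cdot> x = \<pi>" using triangle_extend[OF t \<pi> Z(3)] by blast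
    have "ShO T Z \<in> Coprod T U ?S1"
      using Coprod_shift[OF SO Z(1), of 1] Coprod_mono_set[of "shift T 1 ` S" ?S1]
        shift_1[of T Z] by auto
    moreover have "tri T X X' (ShO T Z)" using t tri_rotate O unfolding tri_def by blast
    ultimately have X': "X' \<in> Coprod T U ?S1" using Coprod_ext[OF _ X] by simp
    have "P (X', \<pi>')"
      unfolding P_def
    proof (clarsimp, intro conjI ballI)
      fix s f assume "s \<in> S" "f \<in> Hom T s D"
      then obtain f' where f': "f' \<in> Hom T s X" "f = \<pi> \<cdot> f'" using sur by blast
      then show "\<exists>f'\<in>Hom T s X'. f = \<pi>' \<cdot> f'"
        using comp_assoc[OF f'(1) O(5) \<pi>'(1)] \<pi>'(2) comp_hom[OF f'(1) O(5)] by metis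
    qed (use X' \<pi>' in auto)
    moreover have "R (X, \<pi>) (X', \<pi>')"
      unfolding R_def
    proof (clarsimp, intro bexI[of _ x] conjI ballI impI)
      fix s f assume "s \<in> S" "f \<in> Hom T s X" "\<pi> \<cdot> f = Zero T s D"
      then obtain f' where f': "f' \<in> Hom T s Z" "f = p \<cdot> f'" using Z(4) by blast
      then show "x \<cdot> f = Zero T s X'"
        using comp_assoc[OF f'(1) O(4) O(5)] triangle_comp_zero[OF t] zero_comp[OF f'(1) O(3)] by simp
    qed (use \<pi>' O in auto)
    ultimately show "\<exists>y. P y \<and> R Q y" using Q by blast
  qed
  then obtain F where F: "\<And>n. P (F n)" "\<And>n. R (F n) (F (Suc n))" by blast
  define X \<pi> where "X n = fst (F n)" and "\<pi> n = snd (F n)" for n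
  have X: "X n \<in> Coprod T U ?S1" and \<pi>: "\<pi> n \<in> Hom T (X n) D"
    and sur: "\<And>s f. \<lbrakk>s \<in> S; f \<in> Hom T s D\<rbrakk> \<Longrightarrow> \<exists>f'\<in>Hom T s (X n). f = \<pi> n \<cdot> f'" for n
    using F(1)[of n] unfolding P_def X_def \<pi>_def by (auto split: prod.splits)
  have "\<exists>x. x \<in> Hom T (X n) (X (Suc n)) \<and> \<pi> (Suc n) \<cdot> x = \<pi> n \<and>
    (\<forall>s\<in>S. \<forall>f\<in>Hom T s (X n). \<pi> n \<cdot> f = Zero T s D \<longrightarrow> x \<cdot> f = Zero T s (X (Suc n)))" for n
    using F(2)[of n] unfolding R_def X_def \<pi>_def by (auto split: prod.splits)
  then obtain x where x: "\<And>n. x n \<in> Hom T (X n) (X (Suc n))" "\<And>n. \<pi> (Suc n) \<cdot> x n = \<pi> n"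
    and kill: "\<And>n s f. \<lbrakk>s \<in> S; f \<in> Hom T s (X n); \<pi> n \<cdot> f = Zero T s D\<rbrakk> \<Longrightarrow> x n \<cdot> f = Zero T s (X (Suc n))"
    by metis
  obtain C H j where C: "coprod T UNIV X C" and H: "tri T C C H"
    and j': "\<forall>n. j n \<in> Hom T (X n) H \<and> j (Suc n) \<cdot> x n = j n"
    and ext: "\<forall>D g. (\<forall>n. g n \<in> Hom T (X n) D \<and> g (Suc n) \<cdot> x n = g n) \<longrightarrow> (\<exists>k \<in> Hom T H D. \<forall>n. k \<cdot> j n = g n)"
    and fac: "\<forall>K \<in> compact_objects T U. \<forall>u \<in> Hom T K H. \<exists>n. \<exists>w \<in> Hom T K (X n). u = j n \<cdot> w"
    by (rule hocolim[of x X, OF x(1)])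
  have j: "j n \<in> Hom T (X n) H" "j (Suc n) \<cdot> x n = j n" for n using j' by auto
  obtain k where k: "k \<in> Hom T H D" "\<And>n. k \<cdot> j n = \<pi> n" using ext \<pi> x(2) by meson
  have HO: "H \<in> Ob T" "C \<in> Ob T" using H tri_Ob by auto
  have S1O: "?S1 \<subseteq> Ob T" using SO shift_Ob by blast
  have C1: "C \<in> Coprod T U ?S1" using Coprod_coproduct[OF is_small_nat X C] .
  have sS1: "shift T 1 ` ?S1 \<subseteq> Coprod T U ?S2"
  proof
    fix y assume "y \<in> shift T 1 ` ?S1"
    then obtain s where s: "s \<in> S" "y = shift T 1 s \<or> y = shift T 1 (shift T 1 s)" by blast
    moreover have "shift T 1 (shift T 1 s) = shift T 2 s" using shift_shift s SO by auto
    ultimately have "y \<in> ?S2" by auto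
    then show "y \<in> Coprod T U ?S2" by (rule Coprod.base)
  qed
  have "C \<in> Coprod T U ?S2" using C1 Coprod_mono_set[of ?S1 ?S2] by auto
  moreover have "ShO T C \<in> Coprod T U ?S2"
    using Coprod_shift[OF S1O C1, of 1] Coprod_mono[OF sS1] shift_1[of T] by auto
  moreover have "tri T C H (ShO T C)" using H tri_rotate HO by blast
  ultimately have H2: "H \<in> Coprod T U ?S2" using Coprod_ext by blast
  \<comment> \<open>A morphism from s to \<open>H\<close> comes from a finite stage; if its image in
    \<open>D\<close> vanishes, it dies one stage later.\<close>
  have inj: "u = Zero T s H" if s: "s \<in> S" and u: "u \<in> Hom T s H" "k \<cdot> u = Zero T s D" for s u
  proof -
    have sO: "s \<in> Ob T" using s SO by blast
    obtain n w where w: "w \<in> Hom T s (X n)" "u = j n \<cdot> w" using fac s S(2) u(1) by blast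
    have "\<pi> n \<cdot> w = Zero T s D" using u(2) w comp_assoc[OF w(1) j(1) k(1)] k(2) by simp
    then have "x n \<cdot> w = Zero T s (X (Suc n))" using kill[OF s w(1)] by blast
    then show ?thesis using w j(2) comp_assoc[OF w(1) x(1) j(1)] comp_zero[OF j(1) sO] by metis
  qed
  obtain Y g h where t: "triangle T H D Y k g h" using TR1_cone[OF k(1)] by blast
  note O = triangle_Ob[OF t]
  have "Y \<in> right_perp T S"
    unfolding right_perp_def
  proof (intro CollectI conjI ballI O(3))
    fix s assume s: "s \<in> S"
    have sO: "s \<in> Ob T" using s SO by blast
    \<comment> \<open>In the long exact sequence, Hom(s, Y) vanishes by surjectivity at s and
      injectivity at the desuspension of s. This is why \<open>S\<close> is assumed closed under
      desuspension.\<close>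
    let ?s = "shift T (- 1) s"
    have s': "?s \<in> S" "?s \<in> Ob T" "ShO T ?s = s" using S'[OF s] sO shift_m1_Ob ShO_shift_m1 by auto
    show "hom_zero T s Y"
    proof (rule hom_zeroI[OF sO O(3)])
      fix u assume u: "u \<in> Hom T s Y"
      have hu: "h \<cdot> u \<in> Hom T s (ShO T H)" using comp_hom u O by blast
      obtain v where v: "v \<in> Hom T ?s H" "h \<cdot> u = ShA T v" using ShA_surj[OF s'(2) O(1)] hu s'(3) by metis
      have "ShA T (k \<cdot> v) = (ShA T k \<cdot> h) \<cdot> u"
        using ShA_comp[OF v(1) k(1)] v(2) comp_assoc[OF u O(6) ShA_hom[OF k(1)]] by simp
      also have "\<dots> = Zero T s (ShO T D)"
        using triangle_comp_zero3[OF t] zero_comp[OF u ShO_Ob[OF O(2)]] by simp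
      finally have "ShA T (k \<cdot> v) = ShA T (Zero T ?s D)" using ShA_zero[OF s'(2) O(2)] s'(3) by simp
      then have "k \<cdot> v = Zero T ?s D" using ShA_inj[OF comp_hom[OF v(1) k(1)] zero_hom[OF s'(2) O(2)]] by blast
      then have "v = Zero T ?s H" using inj[OF s'(1) v(1)] by blast
      then have "h \<cdot> u = Zero T s (ShO T H)" using v(2) ShA_zero[OF s'(2) O(1)] s'(3) by simp
      then obtain u' where u': "u' \<in> Hom T s D" "g \<cdot> u' = u" using triangle_lift2[OF t u] by blast
      obtain w where w: "w \<in> Hom T s (X 0)" "u' = \<pi> 0 \<cdot> w" using sur[OF s u'(1)] by blast
      have jw: "j 0 \<cdot> w \<in> Hom T s H" using comp_hom[OF w(1) j(1)] .
      have "u' = k \<cdot> (j 0 \<cdot> w)" using w(2) k(2) comp_assoc[OF w(1) j(1) k(1)] by simp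
      then have "u = (g \<cdot> k) \<cdot> (j 0 \<cdot> w)" using u'(2) comp_assoc[OF jw k(1) O(5)] by simp
      then show "u = Zero T s Y" using triangle_comp_zero[OF t] zero_comp[OF jw O(3)] by simp
    qed
  qed
  moreover have "tri T H D Y" using t unfolding tri_def by blast
  ultimately show thesis using that H2 by blast
qed

end

section \<open>Boundedness of compact objects\<close>

abbreviation orbit :: "('o, 'm, 'x) tricat_scheme \<Rightarrow> 'o \<Rightarrow> 'o set" where
  "orbit T K \<equiv> range (\<lambda>i. shift T i K)"

text \<open>For m = 0 this is \<open>co_t_le0\<close>, and the other values of m give its shifts. A
  larger m is a stronger condition.\<close>

abbreviation perp_le :: "('o, 'm, 'x) tricat_scheme \<Rightarrow> 'o \<Rightarrow> int \<Rightarrow> 'o set" where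
  "perp_le T G m \<equiv> right_perp T {shift T i G | i. i \<le> m}"

context category
begin

lemma Hom_full_subcat: "\<lbrakk>X \<in> S; Y \<in> S\<rbrakk> \<Longrightarrow> Hom (full_subcat T S) X Y = Hom T X Y"
  by (auto simp: Hom_def full_subcat_def)

text \<open>The image of the identity under the adjunction bijection is the unit, and naturality
  shows that the whole bijection is composition with it.\<close>

lemma left_adjoint_unit:
  assumes adj: "has_left_adjoint (full_subcat T B) (full_subcat T S) (\<lambda>X. X) (\<lambda>f. f)"
    and B: "B \<subseteq> S" and S: "S \<subseteq> Ob T" and K: "K \<in> S"
  obtains L \<eta> where "L \<in> B" "\<eta> \<in> Hom T K L"
    "\<And>b. b \<in> B \<Longrightarrow> bij_betw (\<lambda>f. f \<cdot> \<eta>) (Hom T L b) (Hom T K b)"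
proof -
  let ?B = "full_subcat T B" and ?S = "full_subcat T S"
  have simps: "Ob ?B = B" "Ob ?S = S" "Ident ?B = Ident T" "Ident ?S = Ident T" "Comp ?B = Comp T" "Comp ?S = Comp T"
    by (simp_all add: full_subcat_def)
  obtain Ho Ha where ad: "adjoint_functors ?S ?B Ho Ha (\<lambda>X. X) (\<lambda>f. f)"
    using adj unfolding has_left_adjoint_def by blast
  then have fu: "is_functor ?S ?B Ho Ha" unfolding adjoint_functors_def by blast
  obtain \<phi> where bij: "\<forall>c\<in>Ob ?S. \<forall>d\<in>Ob ?B. bij_betw (\<phi> c d) (Hom ?B (Ho c) d) (Hom ?S c d)"
    and nat: "\<forall>c\<in>Ob ?S. \<forall>c'\<in>Ob ?S. \<forall>d\<in>Ob ?B. \<forall>d'\<in>Ob ?B.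
             \<forall>u\<in>Hom ?S c' c. \<forall>v\<in>Hom ?B d d'. \<forall>f\<in>Hom ?B (Ho c) d.
               \<phi> c' d' ((v \<cdot>\<^bsub>?B\<^esub> f) \<cdot>\<^bsub>?B\<^esub> Ha u) = (v \<cdot>\<^bsub>?S\<^esub> \<phi> c d f) \<cdot>\<^bsub>?S\<^esub> u"
    using ad unfolding adjoint_functors_def by blast
  let ?L = "Ho K"
  have L: "?L \<in> B" using fu K unfolding is_functor_def simps by blast
  have LO: "?L \<in> Ob T" and KO: "K \<in> Ob T" using L K B S by blast+
  have Hid: "Ha (Ident T K) = Ident T ?L" using fu K unfolding is_functor_def simps by blast
  let ?\<eta> = "\<phi> K ?L (Ident T ?L)"
  have \<phi>: "bij_betw (\<phi> K b) (Hom T ?L b) (Hom T K b)" if "b \<in> B" for b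
    using bij K that L B unfolding simps by (metis Hom_full_subcat subsetD)
  have \<eta>: "?\<eta> \<in> Hom T K ?L" using \<phi>[OF L] ident_hom[OF LO] bij_betwE by blast
  have "\<phi> K b v = v \<cdot> ?\<eta>" if b: "b \<in> B" and v: "v \<in> Hom T ?L b" for b v
  proof -
    \<comment> \<open>Naturality applied to the identity of \<open>?L\<close>, with \<open>v\<close>
      in the target variable and the identity of \<open>K\<close> in the source variable.\<close>
    have "\<phi> K b ((v \<cdot> Ident T ?L) \<cdot> Ha (Ident T K)) = (v \<cdot> ?\<eta>) \<cdot> Ident T K"
      using nat K L b v ident_hom KO LO Hom_full_subcat[of K S K] Hom_full_subcat[of ?L B b] Hom_full_subcat[of ?L B ?L]
      unfolding simps by auto
    then show ?thesis using Hid comp_ident[OF v] comp_ident[OF comp_hom[OF \<eta> v]] by simp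
  qed
  then have "bij_betw (\<lambda>f. f \<cdot> ?\<eta>) (Hom T ?L b) (Hom T K b)" if "b \<in> B" for b
    using \<phi>[OF that] that bij_betw_cong[of "Hom T ?L b" "\<phi> K b" "\<lambda>f. f \<cdot> ?\<eta>"] by blast
  then show thesis using that L \<eta> by blast
qed

end

context triangulated_category
begin

lemma right_perpD: "\<lbrakk>Y \<in> right_perp T S; s \<in> S\<rbrakk> \<Longrightarrow> hom_zero T s Y"
  by (auto simp: right_perp_def)

text \<open>Since D -> Y vanishes, every morphism into \<open>D\<close> lifts to \<open>X\<close>;
  in effect \<open>D\<close> is a retract of \<open>X\<close>.\<close>

lemma tri_hom_zero_retract:
  assumes "tri T X D Y" "hom_zero T D Y" "hom_zero T K X"
  shows "hom_zero T K D"
proof -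
  obtain f g h where t: "triangle T X D Y f g h" using assms unfolding tri_def by blast
  note O = triangle_Ob[OF t]
  have K: "K \<in> Ob T" using assms(3) hom_zero_Ob by blast
  show ?thesis
  proof (rule hom_zeroI[OF K O(2)])
    fix u assume u: "u \<in> Hom T K D"
    have "g \<cdot> u = Zero T K Y" using hom_zeroD[OF assms(2) O(5)] zero_comp[OF u O(3)] by simp
    then obtain v where v: "v \<in> Hom T K X" "f \<cdot> v = u" using triangle_lift[OF t u] by blast
    then show "u = Zero T K D" using hom_zeroD[OF assms(3) v(1)] comp_zero[OF O(4) K] by simp
  qed
qed

section \<open>The co-t-structure in terms of orthogonals\<close>

lemma perp_le_mono: "m \<le> n \<Longrightarrow> perp_le T G n \<subseteq> perp_le T G m"
  unfolding right_perp_def by (blast dest: order_trans)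

lemma perp_le_iff: "Y \<in> perp_le T G m \<longleftrightarrow> Y \<in> Ob T \<and> (\<forall>i\<le>m. hom_zero T (shift T i G) Y)"
  by (auto simp: right_perp_def)

lemma perp_le_shift:
  assumes G: "G \<in> Ob T" and Y: "Y \<in> perp_le T G m" shows "shift T j Y \<in> perp_le T G (m + j)"
  unfolding perp_le_iff
proof (intro conjI allI impI)
  have YO: "Y \<in> Ob T" using Y by (simp add: perp_le_iff)
  then show "shift T j Y \<in> Ob T" by (rule shift_Ob)
  fix i assume "i \<le> m + j"
  then have "hom_zero T (shift T (i - j) G) Y" using Y by (simp add: perp_le_iff)
  then show "hom_zero T (shift T i G) (shift T j Y)"
    using hom_zero_shift[OF shift_Ob[OF G] YO, of j "i - j"] shift_shift[OF G, of j "i - j"] by simp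
qed

text \<open>The index 1 - n has two sources: \<open>co_t_ge0\<close> is orthogonal to the shift of
  \<open>co_t_le0\<close>, which contributes 1, and the shift by - n in \<open>co_t_ge\<close>
  contributes - n.\<close>

lemma co_t_ge_iff:
  assumes G: "G \<in> Ob T"
  shows "D \<in> co_t_ge T G n \<longleftrightarrow> D \<in> Ob T \<and> (\<forall>Y\<in>perp_le T G (1 - n). hom_zero T D Y)"
proof
  assume "D \<in> co_t_ge T G n"
  then obtain E where E: "D = shift T (- n) E" "E \<in> Ob T" "\<And>Y. Y \<in> perp_le T G 0 \<Longrightarrow> hom_zero T E (shift T 1 Y)"
    unfolding co_t_ge_def co_t_ge0_def co_t_le0_def left_perp_def by blast
  show "D \<in> Ob T \<and> (\<forall>Y\<in>perp_le T G (1 - n). hom_zero T D Y)"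
  proof (intro conjI ballI)
    show "D \<in> Ob T" using E shift_Ob by simp
    fix Y assume Y: "Y \<in> perp_le T G (1 - n)"
    then have YO: "Y \<in> Ob T" by (simp add: perp_le_iff)
    have "shift T (n - 1) Y \<in> perp_le T G 0" using perp_le_shift[OF G Y, of "n - 1"] by simp
    from E(3)[OF this] have "hom_zero T E (shift T n Y)" using shift_shift[OF YO] by simp
    then show "hom_zero T D Y" using E hom_zero_shift_left[OF E(2) YO, of "- n"] by simp
  qed
next
  assume A: "D \<in> Ob T \<and> (\<forall>Y\<in>perp_le T G (1 - n). hom_zero T D Y)"
  have "shift T n D \<in> co_t_ge0 T G"
    unfolding co_t_ge0_def co_t_le0_def left_perp_def
  proof (intro CollectI conjI ballI)
    show "shift T n D \<in> Ob T" using A shift_Ob by blast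
    fix X assume "X \<in> shift T 1 ` perp_le T G 0"
    then obtain Y where Y: "Y \<in> perp_le T G 0" "X = shift T 1 Y" by blast
    then have YO: "Y \<in> Ob T" by (simp add: perp_le_iff)
    have "hom_zero T D (shift T (1 - n) Y)" using A perp_le_shift[OF G Y(1), of "1 - n"] by simp
    then show "hom_zero T (shift T n D) X"
      using A YO Y(2) hom_zero_shift_left[of D X n] shift_shift[OF YO, of "- n" 1] shift_Ob by simp
  qed
  moreover have "D = shift T (- n) (shift T n D)" using A shift_shift[of D "- n" n] by simp
  ultimately show "D \<in> co_t_ge T G n" unfolding co_t_ge_def by blast
qed

lemma co_t_ge_antimono: "\<lbrakk>G \<in> Ob T; m \<le> n\<rbrakk> \<Longrightarrow> co_t_ge T G n \<subseteq> co_t_ge T G m"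
  using co_t_ge_iff perp_le_mono[of "1 - n" "1 - m" G] by (simp add: subset_iff)

lemma co_t_ge_shift:
  assumes G: "G \<in> Ob T" and D: "D \<in> co_t_ge T G n" shows "shift T j D \<in> co_t_ge T G (n - j)"
proof -
  have DO: "D \<in> Ob T" using D co_t_ge_iff[OF G] by blast
  have "hom_zero T (shift T j D) Y" if Y: "Y \<in> perp_le T G (1 - (n - j))" for Y
  proof -
    have "shift T (- j) Y \<in> perp_le T G (1 - n)" using perp_le_shift[OF G Y, of "- j"] by simp
    then show ?thesis using D co_t_ge_iff[OF G] hom_zero_shift_left[OF DO] Y perp_le_iff by blast
  qed
  then show ?thesis using co_t_ge_iff[OF G] shift_Ob[OF DO] by blast
qed

lemma co_t_ge_ext:
  assumes G: "G \<in> Ob T" and "tri T X Y Z" "X \<in> co_t_ge T G n" "Z \<in> co_t_ge T G n"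
  shows "Y \<in> co_t_ge T G n"
  using assms tri_hom_zero_left tri_Ob unfolding co_t_ge_iff[OF G] by blast

lemma zero_co_t_ge: "\<lbrakk>G \<in> Ob T; zero_object T Z\<rbrakk> \<Longrightarrow> Z \<in> co_t_ge T G n"
  using co_t_ge_iff zero_objectD perp_le_iff by simp

lemma semiorthogonal_decompositionI:
  assumes "triangulated_subcat T S" "triangulated_subcat T A" "A \<subseteq> S" "triangulated_subcat T B" "B \<subseteq> S"
    and "\<And>a b. \<lbrakk>a \<in> A; b \<in> B\<rbrakk> \<Longrightarrow> hom_zero T b a"
    and dec: "\<And>F. F \<in> S \<Longrightarrow> \<exists>b\<in>B. \<exists>a\<in>A. tri T b F a"
  shows "semiorthogonal_decomposition T S A B"
proof -
  have "F \<in> S'" if F: "F \<in> S" and S': "triangulated_subcat T S'" "A \<union> B \<subseteq> S'" for F S'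
    using dec[OF F] triangulated_subcat_ext[OF S'(1)] S'(2) by blast
  then have "triangulated_hull T (A \<union> B) = S"
    using triangulated_subcat_hull[OF assms(1), of "A \<union> B"] assms(3,5)
    unfolding triangulated_hull_def by blast
  then show ?thesis using assms unfolding semiorthogonal_decomposition_def by blast
qed

lemma semiorthogonal_decomposition_tri:
  assumes "semiorthogonal_decomposition T S A B" and F: "F \<in> S"
  obtains b a where "b \<in> B" "a \<in> A" "tri T b F a"
proof -
  have A: "triangulated_subcat T A" and B: "triangulated_subcat T B"
    and z: "\<And>a b. \<lbrakk>a \<in> A; b \<in> B\<rbrakk> \<Longrightarrow> hom_zero T b a" and h: "triangulated_hull T (A \<union> B) = S"
    using assms unfolding semiorthogonal_decomposition_def by blast+
  let ?D = "{Y. \<exists>b\<in>B. \<exists>a\<in>A. tri T b Y a}"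
  obtain N where N: "zero_object T N" using ex_zero_object by blast
  have "N \<in> A" "N \<in> B" using N triangulated_subcatD(2) A B by blast+
  then have "A \<union> B \<subseteq> ?D"
    using tri_ident_left[OF _ N] tri_ident_right[OF _ N] triangulated_subcatD(1)[OF A] triangulated_subcatD(1)[OF B]
    by blast
  then have "S \<subseteq> ?D" using triangulated_subcat_hull[OF decomposable_subcat[OF A B z]] h by blast
  then show thesis using F that by blast
qed

end

context compactly_generated
begin

lemma Coprod_triangulated:
  assumes S: "triangulated_subcat T S" shows "triangulated_subcat T (Coprod T U S)"
proof -
  note SO = triangulated_subcatD(1)[OF S]
  have sh: "shift T k X \<in> Coprod T U S" if "X \<in> Coprod T U S" for k X
    using Coprod_shift[OF SO that, of k] Coprod_mono_set[of "shift T k ` S" S] triangulated_subcat_shift[OF S] by blast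
  show ?thesis
    by (rule triangulated_subcatI) (use Coprod_Ob[OF SO] Coprod_zero Coprod_ext sh in auto)
qed

end

context compactly_generated_category
begin

section \<open>Localization at one compact object and uniform bounds\<close>

lemma G_Ob: "G \<in> Ob T"
  using compact_Ob[OF generator_compact] .

text \<open>An orbit is stable under all shifts, so the additional shifts in
  \<open>localization\<close> are absorbed.\<close>

lemma localization_orbit:
  assumes K: "K \<in> compact_objects T U" and D: "D \<in> Ob T"
  obtains X Y where "tri T X D Y" "X \<in> Coprod T U (orbit T K)" "Y \<in> right_perp T (orbit T K)"
proof -
  have KO: "K \<in> Ob T" using K compact_Ob by blast
  have s: "shift T j x \<in> orbit T K" if "x \<in> orbit T K" for j x
    using that shift_shift[OF KO] by auto
  have "orbit T K \<union> shift T 1 ` orbit T K \<union> shift T 2 ` orbit T K = orbit T K" using s by blast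
  then show thesis
    using localization[of "orbit T K" D] that is_small_image[OF is_small_int] compact_shift[OF K] s D
    by (metis (no_types, lifting) image_subset_iff)
qed

lemma perp_generator_Coprod:
  assumes "tri T X D Y" "X \<in> Coprod T U S" "\<And>i. hom_zero T (shift T i G) Y"
  shows "D \<in> Coprod T U S"
proof -
  have "zero_object T Y" using assms generator tri_Ob by blast
  then show ?thesis using Coprod_ext[OF assms(1,2)] Coprod_zero by blast
qed

lemma Ob_Coprod: assumes "X \<in> Ob T" shows "X \<in> Coprod T U (orbit T G)"
proof -
  obtain Z Y where t: "tri T Z X Y" "Z \<in> Coprod T U (orbit T G)" "Y \<in> right_perp T (orbit T G)"
    using localization_orbit[OF generator_compact assms] .
  show ?thesis by (rule perp_generator_Coprod[OF t(1,2)]) (use t(3) right_perpD in blast)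
qed

text \<open>By the finiteness hypothesis, the coproduct of the \<open>Y m\<close> is also their product: this holds when tested
  against shifts of \<open>G\<close>, and the test objects form a localising subcategory. A family of nonzero
  morphisms from \<open>K\<close> to infinitely many of the \<open>Y m\<close> would then give a morphism from \<open>K\<close> to the
  coproduct with infinite support.\<close>

lemma compact_finite_support:
  fixes Y :: "nat \<Rightarrow> 'o"
  assumes Y: "\<And>m. Y m \<in> Ob T" and fin: "\<And>i. finite {m. \<not> hom_zero T (shift T i G) (Y m)}"
    and K: "K \<in> compact_objects T U"
  shows "finite {m. \<not> hom_zero T K (Y m)}"
proof -
  obtain C \<iota> where C: "is_coproduct T UNIV Y C \<iota>" using small_coproduct[OF is_small_nat, of Y] Y by blast
  have D: "C \<in> Ob T" "\<And>n. \<iota> n \<in> Hom T (Y n) C" using is_coproductD[OF C] by auto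
  obtain p where p: "\<And>n. p n \<in> Hom T C (Y n)"
    "\<And>n m. p n \<cdot> \<iota> m = (if n = m then Ident T (Y n) else Zero T (Y m) (Y n))"
    using coproduct_proj[OF C] by (metis UNIV_I)
  \<comment> \<open>\<open>Inj\<close> and \<open>Sur\<close> say that Hom(X, C) maps injectively,
    respectively surjectively, to the product of the Hom(X, Y m).\<close>
  define Inj where "Inj X \<longleftrightarrow> (\<forall>u\<in>Hom T X C. (\<forall>m. p m \<cdot> u = Zero T X (Y m)) \<longrightarrow> u = Zero T X C)" for X
  define Sur where "Sur X \<longleftrightarrow> (\<forall>f. (\<forall>m. f m \<in> Hom T X (Y m)) \<longrightarrow> (\<exists>u\<in>Hom T X C. \<forall>m. p m \<cdot> u = f m))" for X
  \<comment> \<open>The two halves of the four lemma. Each refers to a neighbouring shift of an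
    outer term, so the induction over \<open>Coprod\<close> has to treat all shifts at once.\<close>
  have tri_Inj: "Inj Y'" if t: "tri T X Y' Z" and XZ: "Inj X" "Inj Z" "Sur (ShO T X)" for X Y' Z
    unfolding Inj_def
  proof (intro ballI impI)
    fix u assume u: "u \<in> Hom T Y' C" and pu: "\<forall>m. p m \<cdot> u = Zero T Y' (Y m)"
    obtain f g h where t: "triangle T X Y' Z f g h" using t unfolding tri_def by blast
    note O = triangle_Ob[OF t]
    have "p m \<cdot> (u \<cdot> f) = Zero T X (Y m)" for m
      using comp_assoc[OF O(4) u p(1)] pu zero_comp[OF O(4) Y] by simp
    then have "u \<cdot> f = Zero T X C" using XZ(1) comp_hom[OF O(4) u] unfolding Inj_def by blast
    then obtain v where v: "v \<in> Hom T Z C" "v \<cdot> g = u" using triangle_extend[OF t u] by blast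
    have "\<exists>w. w \<in> Hom T (ShO T X) (Y m) \<and> w \<cdot> h = p m \<cdot> v" for m
    proof -
      have "(p m \<cdot> v) \<cdot> g = Zero T Y' (Y m)" using comp_assoc[OF O(5) v(1) p(1)] v(2) pu by simp
      then show ?thesis using triangle_extend2[OF t comp_hom[OF v(1) p(1)]] by metis
    qed
    then obtain w where w: "\<And>m. w m \<in> Hom T (ShO T X) (Y m) \<and> w m \<cdot> h = p m \<cdot> v" by metis
    obtain k where k: "k \<in> Hom T (ShO T X) C" "\<And>m. p m \<cdot> k = w m" using XZ(3) w unfolding Sur_def by blast
    have kh: "k \<cdot> h \<in> Hom T Z C" using comp_hom[OF O(6) k(1)] .
    have "p m \<cdot> sub v (k \<cdot> h) = Zero T Z (Y m)" for m
    proof -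
      have "p m \<cdot> (k \<cdot> h) = p m \<cdot> v" using comp_assoc[OF O(6) k(1) p(1)[of m]] k(2) w by simp
      then show ?thesis using comp_sub[OF v(1) kh p(1)] sub_eq_zero_iff comp_hom[OF v(1) p(1)] by simp
    qed
    then have "sub v (k \<cdot> h) = Zero T Z C" using XZ(2) sub_hom[OF v(1) kh] unfolding Inj_def by blast
    then have "v = k \<cdot> h" using sub_eq_zero_iff[OF v(1) kh] by simp
    then show "u = Zero T Y' C"
      using v comp_assoc[OF O(5) O(6) k(1)] triangle_comp_zero2[OF t] comp_zero[OF k(1) O(2)] by simp
  qed
  have tri_Sur: "Sur Y'" if t: "tri T X Y' Z" and XZ: "Sur X" "Sur Z" "Inj (shift T (- 1) Z)" for X Y' Z
    unfolding Sur_def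
  proof (intro allI impI)
    fix F assume F: "\<forall>m. F m \<in> Hom T Y' (Y m)"
    then have F': "\<And>m. F m \<in> Hom T Y' (Y m)" by blast
    let ?Z = "shift T (- 1) Z"
    have ZO: "?Z \<in> Ob T" "ShO T ?Z = Z" using t tri_Ob shift_m1_Ob ShO_shift_m1 by auto
    have "tri T ?Z X Y'" using t ZO tri_rotate[of ?Z X Y'] by simp
    then obtain e f h where t': "triangle T ?Z X Y' e f h" unfolding tri_def by blast
    note O = triangle_Ob[OF t']
    obtain u where u: "u \<in> Hom T X C" "\<And>m. p m \<cdot> u = F m \<cdot> f"
    proof -
      show thesis
        using XZ(1)[unfolded Sur_def, rule_format, of "\<lambda>m. F m \<cdot> f"] comp_hom[OF O(5) F'] that by blast
    qed
    have "p m \<cdot> (u \<cdot> e) = Zero T ?Z (Y m)" for m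
      using comp_assoc[OF O(4) u(1) p(1)] u(2) comp_assoc[OF O(4) O(5) F'] triangle_comp_zero[OF t'] comp_zero[OF F' ZO(1)] by simp
    then have "u \<cdot> e = Zero T ?Z C" using XZ(3) comp_hom[OF O(4) u(1)] unfolding Inj_def by blast
    then obtain v where v: "v \<in> Hom T Y' C" "v \<cdot> f = u" using triangle_extend[OF t' u(1)] by blast
    have pv: "p m \<cdot> v \<in> Hom T Y' (Y m)" for m using comp_hom[OF v(1) p(1)] .
    have "\<exists>k. k \<in> Hom T Z (Y m) \<and> k \<cdot> h = sub (F m) (p m \<cdot> v)" for m
    proof -
      have "(p m \<cdot> v) \<cdot> f = F m \<cdot> f" using comp_assoc[OF O(5) v(1) p(1)] v(2) u(2) by simp
      then have "sub (F m) (p m \<cdot> v) \<cdot> f = Zero T X (Y m)"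
        using sub_comp[OF O(5) F' pv] sub_eq_zero_iff comp_hom[OF O(5) F'] by simp
      then show ?thesis using triangle_extend2[OF t' sub_hom[OF F' pv]] ZO(2) by metis
    qed
    then obtain k where k: "\<And>m. k m \<in> Hom T Z (Y m) \<and> k m \<cdot> h = sub (F m) (p m \<cdot> v)" by metis
    obtain l where l: "l \<in> Hom T Z C" "\<And>m. p m \<cdot> l = k m" using XZ(2) k unfolding Sur_def by blast
    have h: "h \<in> Hom T Y' Z" using O(6) ZO(2) by simp
    have lh: "l \<cdot> h \<in> Hom T Y' C" using comp_hom[OF h l(1)] .
    have "p m \<cdot> Add T (l \<cdot> h) v = F m" for m
      using comp_add[OF lh v(1) p(1)[of m]] comp_assoc[OF h l(1) p(1)[of m]] l(2) k sub_add[OF F' pv, of m] by simp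
    then show "\<exists>u\<in>Hom T Y' C. \<forall>m. p m \<cdot> u = F m" using add_hom[OF lh v(1)] by blast
  qed
  have coprod_IS: "Inj Z \<and> Sur Z" if c: "coprod T A X Z" and X: "\<And>a. a \<in> A \<Longrightarrow> Inj (X a) \<and> Sur (X a)"
    for A :: "'i set" and X Z
  proof -
    obtain \<kappa> where \<kappa>: "is_coproduct T A X Z \<kappa>" using c unfolding coprod_def by blast
    note E = is_coproductD[OF \<kappa>]
    have "Inj Z"
      unfolding Inj_def
    proof (intro ballI impI)
      fix u assume u: "u \<in> Hom T Z C" "\<forall>m. p m \<cdot> u = Zero T Z (Y m)"
      show "u = Zero T Z C"
      proof (rule coproduct_eqI[OF \<kappa> u(1) zero_hom[OF E(1) D(1)]])
        fix a assume a: "a \<in> A"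
        have "p m \<cdot> (u \<cdot> \<kappa> a) = Zero T (X a) (Y m)" for m
          using comp_assoc[OF E(3)[OF a] u(1) p(1)] u(2) zero_comp[OF E(3)[OF a] Y] by simp
        then have "u \<cdot> \<kappa> a = Zero T (X a) C" using X[OF a] comp_hom[OF E(3)[OF a] u(1)] unfolding Inj_def by blast
        then show "u \<cdot> \<kappa> a = Zero T Z C \<cdot> \<kappa> a" using zero_comp[OF E(3)[OF a] D(1)] by simp
      qed
    qed
    moreover have "Sur Z"
      unfolding Sur_def
    proof (intro allI impI)
      fix F assume "\<forall>m. F m \<in> Hom T Z (Y m)"
      then have F: "\<And>m. F m \<in> Hom T Z (Y m)" by blast
      have "\<exists>u. u \<in> Hom T (X a) C \<and> (\<forall>m. p m \<cdot> u = F m \<cdot> \<kappa> a)" if a: "a \<in> A" for a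
      proof -
        have "Sur (X a)" using X[OF a] by blast
        from this[unfolded Sur_def, rule_format, of "\<lambda>m. F m \<cdot> \<kappa> a"]
        show ?thesis using comp_hom[OF E(3)[OF a] F] by blast
      qed
      then obtain u where u: "\<And>a. a \<in> A \<Longrightarrow> u a \<in> Hom T (X a) C" "\<And>a m. a \<in> A \<Longrightarrow> p m \<cdot> u a = F m \<cdot> \<kappa> a"
        by metis
      obtain v where v: "v \<in> Hom T Z C" "\<And>a. a \<in> A \<Longrightarrow> v \<cdot> \<kappa> a = u a"
        by (rule coproduct_map[OF \<kappa>, of u C]) (use u(1) D in auto)
      have "p m \<cdot> v = F m" for m
      proof (rule coproduct_eqI[OF \<kappa> comp_hom[OF v(1) p(1)] F])
        fix a assume a: "a \<in> A"
        show "(p m \<cdot> v) \<cdot> \<kappa> a = F m \<cdot> \<kappa> a" using comp_assoc[OF E(3)[OF a] v(1) p(1)] v(2)[OF a] u(2)[OF a] by simp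
      qed
      then show "\<exists>u\<in>Hom T Z C. \<forall>m. p m \<cdot> u = F m" using v(1) by blast
    qed
    ultimately show ?thesis ..
  qed
  have compact_Inj: "Inj K'" if K': "K' \<in> compact_objects T U" for K'
    unfolding Inj_def using compact_proj_zero[OF K' is_small_nat C, of _ p] p by blast
  \<comment> \<open>If almost all targets receive only zero, a family of morphisms is realized by
    the finite sum of its remaining members through the insertions.\<close>
  have compact_Sur: "Sur K'" if K': "K' \<in> compact_objects T U" and f: "finite {m. \<not> hom_zero T K' (Y m)}" for K'
    unfolding Sur_def
  proof (intro allI impI)
    fix F assume "\<forall>m. F m \<in> Hom T K' (Y m)"
    then have F: "\<And>m. F m \<in> Hom T K' (Y m)" by blast
    note KO = compact_Ob[OF K']
    have "\<exists>u\<in>Hom T K' C. \<forall>m. p m \<cdot> u = (if m \<in> M then F m else Zero T K' (Y m))" if "finite M" for M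
      using that
    proof (induction M rule: finite_induct)
      case empty
      then show ?case using comp_zero[OF p(1) KO] zero_hom[OF KO D(1)] by (intro bexI[of _ "Zero T K' C"]) simp_all
    next
      case (insert n M)
      then obtain u where u: "u \<in> Hom T K' C" "\<And>m. p m \<cdot> u = (if m \<in> M then F m else Zero T K' (Y m))" by blast
      have iF: "\<iota> n \<cdot> F n \<in> Hom T K' C" using comp_hom[OF F D(2)] .
      have "p m \<cdot> Add T (\<iota> n \<cdot> F n) u = (if m \<in> insert n M then F m else Zero T K' (Y m))" for m
      proof -
        have "p m \<cdot> (\<iota> n \<cdot> F n) = (if m = n then F m else Zero T K' (Y m))"
          using comp_assoc[OF F D(2) p(1)[of m], of n] p(2)[of m n] ident_comp[OF F] zero_comp[OF F Y] by auto
        then show ?thesis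
          using comp_add[OF iF u(1) p(1)[of m]] u(2)[of m] insert(2)
            add_zero[OF F] add_zero_left[OF F] add_zero[OF zero_hom[OF KO Y]] by auto
      qed
      then show ?case using add_hom[OF iF u(1)] by blast
    qed
    from this[OF f] obtain u where u: "u \<in> Hom T K' C"
      "\<And>m. p m \<cdot> u = (if m \<in> {m. \<not> hom_zero T K' (Y m)} then F m else Zero T K' (Y m))" by blast
    have "p m \<cdot> u = F m" for m using u(2)[of m] hom_zeroD[OF _ F] by (auto split: if_splits)
    then show "\<exists>u\<in>Hom T K' C. \<forall>m. p m \<cdot> u = F m" using u(1) by blast
  qed
  have orbit: "\<forall>i. Inj (shift T i X) \<and> Sur (shift T i X)" if "X \<in> Coprod T U (orbit T G)" for X
    using that
  proof (induction rule: Coprod.induct)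
    case (base X)
    then obtain j where j: "X = shift T j G" by blast
    show ?case using compact_Inj compact_Sur fin compact_shift[OF generator_compact] shift_shift[OF G_Ob] j by simp
  next
    case (coproduct I X Z \<kappa>)
    show ?case
    proof
      fix i
      have "coprod T I (\<lambda>a. shift T i (X a)) (shift T i Z)"
        by (rule coprod_shift) (use coproduct.hyps(3) in \<open>auto simp: coprod_def\<close>)
      then show "Inj (shift T i Z) \<and> Sur (shift T i Z)" using coprod_IS coproduct.IH by blast
    qed
  next
    case (extension X Z Y' f g h)
    then have t: "tri T X Y' Z" unfolding tri_def by blast
    have O: "X \<in> Ob T" "Y' \<in> Ob T" "Z \<in> Ob T" using t tri_Ob by auto
    show ?case
    proof
      fix i
      have t': "tri T (shift T i X) (shift T i Y') (shift T i Z)" using t tri_shift[OF O] by blast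
      have s: "ShO T (shift T i X) = shift T (i + 1) X" "shift T (- 1) (shift T i Z) = shift T (i - 1) Z"
        using shift_Suc[OF O(1)] shift_pred[OF O(3)] by auto
      show "Inj (shift T i Y') \<and> Sur (shift T i Y')"
        using tri_Inj[OF t'] tri_Sur[OF t'] extension.IH unfolding s by blast
    qed
  qed
  have KO: "K \<in> Ob T" using compact_Ob[OF K] .
  have "Sur K" using orbit[OF Ob_Coprod[OF KO]] shift_0 by metis
  moreover have "\<exists>f. f \<in> Hom T K (Y m) \<and> (\<not> hom_zero T K (Y m) \<longrightarrow> f \<noteq> Zero T K (Y m))" for m
    using hom_zeroI[OF KO Y] zero_hom[OF KO Y] by metis
  then obtain F where F: "\<And>m. F m \<in> Hom T K (Y m)" "\<And>m. \<not> hom_zero T K (Y m) \<Longrightarrow> F m \<noteq> Zero T K (Y m)" by metis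
  ultimately obtain u where u: "u \<in> Hom T K C" "\<And>m. p m \<cdot> u = F m" unfolding Sur_def by blast
  have "finite {m \<in> UNIV. p m \<cdot> u \<noteq> Zero T K (Y m)}"
    using compact_proj_finite[OF K is_small_nat C u(1), of p] p by blast
  then show ?thesis by (rule finite_subset[rotated]) (use u(2) F(2) in auto)
qed

text \<open>If no bound worked, each m would have a counterexample \<open>Y m\<close> orthogonal to
  all \<open>shift T i G\<close> with i at most m. A fixed shift of \<open>G\<close> then sees only
  finitely many of them, but \<open>K\<close> sees all of them, against
  \<open>compact_finite_support\<close>.\<close>

lemma compact_perp_le:
  assumes K: "K \<in> compact_objects T U"
  obtains c where "\<And>Y j. Y \<in> perp_le T G (c + j) \<Longrightarrow> hom_zero T (shift T j K) Y"
proof -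
  note KO = compact_Ob[OF K]
  have "\<exists>c. \<forall>Y\<in>perp_le T G c. hom_zero T K Y"
  proof (rule ccontr)
    assume "\<not> ?thesis"
    then have "\<forall>m::nat. \<exists>Y. Y \<in> perp_le T G (int m) \<and> \<not> hom_zero T K Y" by blast
    then obtain Y where "\<forall>m::nat. Y m \<in> perp_le T G (int m) \<and> \<not> hom_zero T K (Y m)"
      by (rule choice[THEN exE])
    then have Y: "Y m \<in> perp_le T G (int m)" "\<not> hom_zero T K (Y m)" for m :: nat by blast+
    have "finite {m. \<not> hom_zero T K (Y m)}"
    proof (rule compact_finite_support[OF _ _ K])
      show "Y m \<in> Ob T" for m using Y(1) perp_le_iff by blast
      show "finite {m. \<not> hom_zero T (shift T i G) (Y m)}" for i
      proof (rule finite_subset)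
        show "{m. \<not> hom_zero T (shift T i G) (Y m)} \<subseteq> {..nat i}"
        proof
          fix m assume "m \<in> {m. \<not> hom_zero T (shift T i G) (Y m)}"
          then have "\<not> i \<le> int m" using Y(1)[of m] perp_le_iff by blast
          then show "m \<in> {..nat i}" by simp
        qed
      qed simp
    qed
    then show False using Y(2) by simp
  qed
  then obtain c where c: "\<And>Y. Y \<in> perp_le T G c \<Longrightarrow> hom_zero T K Y" by blast
  show thesis
  proof (rule that[of c])
    fix Y j assume Y: "Y \<in> perp_le T G (c + j)"
    then have "shift T (- j) Y \<in> perp_le T G c" using perp_le_shift[OF G_Ob Y, of "- j"] by simp
    then show "hom_zero T (shift T j K) Y" using c hom_zero_shift_left[OF KO] Y perp_le_iff by blast
  qed
qed

end

section \<open>Semiorthogonal decompositions\<close>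

context triangulated_category
begin

lemma bounded_triangulated:
  assumes K: "K \<in> Ob T"
  shows "triangulated_subcat T {F \<in> Ob T. \<exists>N. \<forall>i\<le>N. hom_zero T (shift T i K) F}" (is "triangulated_subcat T ?S")
proof (rule triangulated_subcatI)
  show "Z \<in> ?S" if "zero_object T Z" for Z
    using zero_objectD[OF that] shift_Ob[OF K] by blast
  fix X Y Z assume t: "tri T X Y Z" and X: "X \<in> ?S" and Z: "Z \<in> ?S"
  obtain N where N: "\<And>i. i \<le> N \<Longrightarrow> hom_zero T (shift T i K) X" using X by blast
  obtain M where M: "\<And>i. i \<le> M \<Longrightarrow> hom_zero T (shift T i K) Z" using Z by blast
  have "hom_zero T (shift T i K) Y" if "i \<le> min N M" for i
    using tri_hom_zero_right[OF t N M] that by simp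
  then show "Y \<in> ?S" using tri_Ob[OF t] by blast
next
  have "shift T j X \<in> ?S" if X: "X \<in> ?S" for X j
  proof -
    have XO: "X \<in> Ob T" using X by blast
    obtain N where N: "\<And>i. i \<le> N \<Longrightarrow> hom_zero T (shift T i K) X" using X by blast
    have "hom_zero T (shift T i K) (shift T j X)" if "i \<le> N + j" for i
      using N[of "i - j"] that hom_zero_shift[OF shift_Ob[OF K] XO, of j "i - j"] shift_shift[OF K, of j "i - j"] by simp
    then show ?thesis using shift_Ob[OF XO] by blast
  qed
  then show "X \<in> ?S \<Longrightarrow> shift T 1 X \<in> ?S" "X \<in> ?S \<Longrightarrow> shift T (- 1) X \<in> ?S" for X
    by blast+
qed blast

end

context compactly_generated_category
begin

section \<open>The subcategories \<open>T_plus_c\<close> and \<open>T_b_c\<close>\<close>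

lemma T_plus_c_iff:
  "F \<in> T_plus_c T U G \<longleftrightarrow>
    F \<in> Ob T \<and> (\<forall>n. \<exists>E \<in> compact_objects T U. \<exists>D \<in> co_t_ge T G n. tri T E F D)"
  unfolding T_plus_c_def tri_def by blast

text \<open>Localizing at the shifts of \<open>G\<close> up to 1 - n makes \<open>D\<close> a
  retract of an object built from shifts up to 3 - n, the 2 being the loss in
  \<open>localization\<close>. From \<open>shift T j G\<close> to these there are no morphisms once
  j exceeds the shift by at least \<open>N\<close>.\<close>

lemma shift_co_t_ge_hom_zero:
  assumes N: "\<And>i. N \<le> i \<Longrightarrow> hom_zero T (shift T i G) G"
    and D: "D \<in> co_t_ge T G n" and j: "N + 3 - n \<le> j"
  shows "hom_zero T (shift T j G) D"
proof -
  let ?S = "{shift T i G | i. i \<le> 1 - n}"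
  have DO: "D \<in> Ob T" and D': "\<And>Y. Y \<in> right_perp T ?S \<Longrightarrow> hom_zero T D Y"
    using D co_t_ge_iff[OF G_Ob] by auto
  have S: "is_small U ?S" "?S \<subseteq> compact_objects T U"
    using is_small_subset[OF is_small_image[OF is_small_int, of "\<lambda>i. shift T i G"], of ?S]
      compact_shift[OF generator_compact] by auto
  have "shift T (- 1) s \<in> ?S" if s: "s \<in> ?S" for s
  proof -
    obtain i where i: "s = shift T i G" "i \<le> 1 - n" using s by blast
    then have "shift T (- 1) s = shift T (i - 1) G" "i - 1 \<le> 1 - n" using shift_shift[OF G_Ob] by auto
    then show ?thesis by blast
  qed
  from localization[OF S this DO] obtain X Y where t: "tri T X D Y"
    and X: "X \<in> Coprod T U (?S \<union> shift T 1 ` ?S \<union> shift T 2 ` ?S)" and Y: "Y \<in> right_perp T ?S" by blast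
  have "hom_zero T (shift T j G) s" if s: "s \<in> ?S \<union> shift T 1 ` ?S \<union> shift T 2 ` ?S" for s
  proof -
    obtain i k where i: "s = shift T k (shift T i G)" "i \<le> 1 - n" "k \<le> 2"
    proof -
      consider "s \<in> ?S" | "s \<in> shift T 1 ` ?S" | "s \<in> shift T 2 ` ?S" using s by blast
      then show thesis
      proof cases
        case 1 then show thesis using that[of 0] by auto
      next
        case 2 then show thesis using that[of 1] by auto
      next
        case 3 then show thesis using that[of 2] by auto
      qed
    qed
    then have s: "s = shift T (k + i) G" using shift_shift[OF G_Ob] by simp
    have "hom_zero T (shift T (j - (k + i)) G) G" using N i j by simp
    then show ?thesis
      using hom_zero_shift[OF shift_Ob[OF G_Ob] G_Ob, of "k + i" "j - (k + i)"] shift_shift[OF G_Ob] s by simp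
  qed
  then have "hom_zero T (shift T j G) X"
    using Coprod_hom_zero_right[OF compact_shift[OF generator_compact] _ X] by blast
  then show ?thesis using tri_hom_zero_retract[OF t D'[OF Y]] by blast
qed

text \<open>The diagonal argument of \<open>compact_perp_le\<close> for the other class of the
  co-t-structure: for fixed i, the preceding lemma leaves only finitely many of the
  \<open>D m\<close> visible to \<open>shift T i G\<close>.\<close>

lemma compact_co_t_ge:
  assumes bounded: "\<exists>N. \<forall>i\<ge>N. hom_zero T (shift T i G) G" and K: "K \<in> compact_objects T U"
  obtains m where "\<And>D. D \<in> co_t_ge T G m \<Longrightarrow> hom_zero T K D"
proof -
  obtain N where N: "\<And>i. N \<le> i \<Longrightarrow> hom_zero T (shift T i G) G" using bounded by blast
  have "\<exists>m. \<forall>D\<in>co_t_ge T G m. hom_zero T K D"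
  proof (rule ccontr)
    assume "\<not> ?thesis"
    then have "\<forall>m::nat. \<exists>D. D \<in> co_t_ge T G (int m) \<and> \<not> hom_zero T K D" by blast
    then obtain D where "\<forall>m::nat. D m \<in> co_t_ge T G (int m) \<and> \<not> hom_zero T K (D m)"
      by (rule choice[THEN exE])
    then have D: "D m \<in> co_t_ge T G (int m)" "\<not> hom_zero T K (D m)" for m :: nat by blast+
    have "finite {m. \<not> hom_zero T K (D m)}"
    proof (rule compact_finite_support[OF _ _ K])
      show "D m \<in> Ob T" for m using D(1) co_t_ge_iff[OF G_Ob] by blast
      show "finite {m. \<not> hom_zero T (shift T i G) (D m)}" for i
      proof (rule finite_subset)
        show "{m. \<not> hom_zero T (shift T i G) (D m)} \<subseteq> {..nat (N + 3 - i)}"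
        proof
          fix m assume "m \<in> {m. \<not> hom_zero T (shift T i G) (D m)}"
          then have "\<not> N + 3 - int m \<le> i" using shift_co_t_ge_hom_zero[where N = N and j = i, OF N D(1)[of m]] by auto
          then show "m \<in> {..nat (N + 3 - i)}" by simp
        qed
      qed simp
    qed
    then show False using D(2) by simp
  qed
  then show thesis using that by blast
qed

text \<open>For extensions, \<open>Z\<close> is approximated first; its compact part E2 determines
  how deep the tail D1 for \<open>X\<close> must lie so that the map from E2 to the shift of D1
  vanishes and \<open>tri_merge\<close> applies.\<close>

lemma T_plus_c_triangulated:
  assumes bounded: "\<exists>N. \<forall>i\<ge>N. hom_zero T (shift T i G) G"
  shows "triangulated_subcat T (T_plus_c T U G)"
proof (rule triangulated_subcatI)
  show "T_plus_c T U G \<subseteq> Ob T" using T_plus_c_iff by blast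
  show "Z \<in> T_plus_c T U G" if "zero_object T Z" for Z
    using that zero_co_t_ge[OF G_Ob that] triangulated_subcatD(2)[OF compact_subcat] tri_ident_left
      zero_objectD(1) T_plus_c_iff by blast
  fix X Y Z assume t: "tri T X Y Z" and X: "X \<in> T_plus_c T U G" and Z: "Z \<in> T_plus_c T U G"
  show "Y \<in> T_plus_c T U G"
    unfolding T_plus_c_iff
  proof (intro conjI allI)
    show "Y \<in> Ob T" using t tri_Ob by blast
    fix n
    obtain E2 D2 where 2: "E2 \<in> compact_objects T U" "D2 \<in> co_t_ge T G n" "tri T E2 Z D2"
      using Z T_plus_c_iff by blast
    obtain m where m: "\<And>D. D \<in> co_t_ge T G m \<Longrightarrow> hom_zero T E2 D" using compact_co_t_ge[OF bounded 2(1)] by blast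
    \<comment> \<open>One more than m because suspending D1 lowers its level by one; at least n so
      that the merged tail lies at level n.\<close>
    let ?m = "max n (m + 1)"
    obtain E1 D1 where 1: "E1 \<in> compact_objects T U" "D1 \<in> co_t_ge T G ?m" "tri T E1 X D1"
      using X T_plus_c_iff by blast
    have "m \<le> ?m - 1" by simp
    then have "shift T 1 D1 \<in> co_t_ge T G m"
      using co_t_ge_shift[OF G_Ob 1(2), of 1] co_t_ge_antimono[OF G_Ob] by blast
    then have "hom_zero T E2 (ShO T D1)" using m by (simp add: shift_1)
    from tri_merge[OF t 1(3) 2(3) this]
    obtain E D where ED: "tri T E Y D" "tri T E1 E E2" "tri T D1 D D2" .
    have "D1 \<in> co_t_ge T G n" using 1(2) co_t_ge_antimono[OF G_Ob, of n ?m] by auto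
    then have "D \<in> co_t_ge T G n" using co_t_ge_ext[OF G_Ob ED(3)] 2(2) by blast
    moreover have "E \<in> compact_objects T U" using triangulated_subcat_ext[OF compact_subcat ED(2)] 1(1) 2(1) by blast
    ultimately show "\<exists>E\<in>compact_objects T U. \<exists>D\<in>co_t_ge T G n. tri T E Y D" using ED(1) by blast
  qed
next
  have "shift T j X \<in> T_plus_c T U G" if X: "X \<in> T_plus_c T U G" for X j
    unfolding T_plus_c_iff
  proof (intro conjI allI)
    have XO: "X \<in> Ob T" using X T_plus_c_iff by blast
    then show "shift T j X \<in> Ob T" by (rule shift_Ob)
    fix n
    obtain E D where 1: "E \<in> compact_objects T U" "D \<in> co_t_ge T G (n + j)" "tri T E X D"
      using X T_plus_c_iff by blast
    have "shift T j D \<in> co_t_ge T G n" using co_t_ge_shift[OF G_Ob 1(2), of j] by simp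
    moreover have "tri T (shift T j E) (shift T j X) (shift T j D)" using 1(3) tri_shift tri_Ob by blast
    ultimately show "\<exists>E\<in>compact_objects T U. \<exists>D\<in>co_t_ge T G n. tri T E (shift T j X) D"
      using compact_shift[OF 1(1)] by blast
  qed
  then show "X \<in> T_plus_c T U G \<Longrightarrow> shift T 1 X \<in> T_plus_c T U G"
    "X \<in> T_plus_c T U G \<Longrightarrow> shift T (- 1) X \<in> T_plus_c T U G" for X
    by blast+
qed

lemma T_b_c_eq:
  "T_b_c T U G = T_plus_c T U G \<inter> {F \<in> Ob T. \<exists>N. \<forall>i\<le>N. hom_zero T (shift T i G) F}"
  unfolding T_b_c_def T_plus_c_def by blast

lemma T_b_c_triangulated:
  assumes bounded: "\<exists>N. \<forall>i\<ge>N. hom_zero T (shift T i G) G"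
  shows "triangulated_subcat T (T_b_c T U G)"
  unfolding T_b_c_eq
  by (rule triangulated_subcat_Int[OF T_plus_c_triangulated[OF bounded] bounded_triangulated[OF G_Ob]])

end

locale compact_sod = compactly_generated_category T U G
  for T :: "('o, 'm, 'x) tricat_scheme" (structure) and U :: "'i set set" and G :: 'o +
  fixes A B :: "'o set"
  assumes sod: "semiorthogonal_decomposition T (compact_objects T U) A B"
begin

abbreviation "CA \<equiv> Coprod T U A"
abbreviation "CB \<equiv> Coprod T U B"

section \<open>The induced decomposition of the whole category\<close>

lemma A_triangulated: "triangulated_subcat T A" and A_compact: "A \<subseteq> compact_objects T U"
  and B_triangulated: "triangulated_subcat T B" and B_compact: "B \<subseteq> compact_objects T U"
  and B_A: "\<lbrakk>b \<in> B; a \<in> A\<rbrakk> \<Longrightarrow> hom_zero T b a"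
  using sod unfolding semiorthogonal_decomposition_def by blast+

lemma CA_triangulated: "triangulated_subcat T CA" and CB_triangulated: "triangulated_subcat T CB"
  using Coprod_triangulated A_triangulated B_triangulated by blast+

text \<open>Coproducts in the target are handled first, for a compact b in \<open>B\<close>; the
  passage from \<open>B\<close> to \<open>CB\<close> in the source then follows from the universal
  property.\<close>

lemma CB_CA: assumes Y: "Y \<in> CB" and X: "X \<in> CA" shows "hom_zero T Y X"
proof (rule Coprod_hom_zero_left[OF _ _ Y])
  show "X \<in> Ob T" using triangulated_subcatD(1)[OF CA_triangulated] X by blast
  fix b assume "b \<in> B"
  then show "hom_zero T b X" using Coprod_hom_zero_right[of b A X] B_A B_compact X by blast
qed

lemma CB_CA_shift: assumes Y: "Y \<in> CB" and X: "X \<in> CA" shows "hom_zero T (shift T i Y) X"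
  using CB_CA[OF triangulated_subcat_shift[OF CB_triangulated Y] X] .

text \<open>Both components are read off the same chosen pair, which guarantees that
  \<open>G_B\<close> and \<open>G_A\<close> occur in one triangle.\<close>

definition G_B where "G_B = fst (SOME p. fst p \<in> B \<and> snd p \<in> A \<and> tri T (fst p) G (snd p))"
definition G_A where "G_A = snd (SOME p. fst p \<in> B \<and> snd p \<in> A \<and> tri T (fst p) G (snd p))"

lemma G_B: "G_B \<in> B" and G_A: "G_A \<in> A" and G_tri: "tri T G_B G G_A"
proof -
  obtain b a where "b \<in> B" "a \<in> A" "tri T b G a"
    using semiorthogonal_decomposition_tri[OF sod generator_compact] .
  then have "\<exists>p. fst p \<in> B \<and> snd p \<in> A \<and> tri T (fst p) G (snd p)" by auto
  from someI_ex[OF this] show "G_B \<in> B" "G_A \<in> A" "tri T G_B G G_A" unfolding G_B_def G_A_def by auto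
qed

lemma G_A_compact: "G_A \<in> compact_objects T U" and G_B_compact: "G_B \<in> compact_objects T U"
  using G_A A_compact G_B B_compact by blast+

lemma hom_zero_shift_G:
  assumes "hom_zero T (shift T i G_B) Y" "hom_zero T (shift T i G_A) Y"
  shows "hom_zero T (shift T i G) Y"
proof -
  have "tri T (shift T i G_B) (shift T i G) (shift T i G_A)" using G_tri tri_shift tri_Ob by blast
  then show ?thesis using tri_hom_zero_left assms by blast
qed

lemma orbit_G_A: "Coprod T U (orbit T G_A) \<subseteq> CA" and orbit_G_B: "Coprod T U (orbit T G_B) \<subseteq> CB"
  using triangulated_subcat_shift[OF A_triangulated G_A] triangulated_subcat_shift[OF B_triangulated G_B]
  by (intro Coprod_mono_set image_subsetI; simp)+

text \<open>The cone of the localization at \<open>G_A\<close> is orthogonal to the shifts of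
  \<open>G_A\<close> by construction and remains orthogonal to those of \<open>G_B\<close>. Hence it
  is orthogonal to all shifts of \<open>G\<close> and vanishes.\<close>

lemma in_orbit_G_A:
  assumes Y: "Y \<in> Ob T" and z: "\<And>i. hom_zero T (shift T i G_B) Y"
  shows "Y \<in> Coprod T U (orbit T G_A)"
proof -
  obtain X C where t: "tri T X Y C" and X: "X \<in> Coprod T U (orbit T G_A)" and C: "C \<in> right_perp T (orbit T G_A)"
    using localization_orbit[OF G_A_compact Y] .
  have XO: "X \<in> Ob T" using t tri_Ob by blast
  have t': "tri T Y C (ShO T X)" using t tri_rotate[OF XO] by blast
  have XA: "ShO T X \<in> CA" using orbit_G_A X triangulated_subcatD(4)[OF CA_triangulated] by (auto simp: shift_1)
  have GB: "G_B \<in> CB" using G_B by (rule Coprod.base)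
  have "hom_zero T (shift T i G) C" for i
    using hom_zero_shift_G tri_hom_zero_right[OF t' z CB_CA_shift[OF GB XA]] right_perpD[OF C] by blast
  then show ?thesis using perp_generator_Coprod[OF t X] by blast
qed

text \<open>With a single generator of \<open>CA\<close>, orthogonality to \<open>CA\<close> can be
  tested on the small orbit of \<open>G_A\<close>, and localization at that orbit gives the
  coreflection into \<open>CA\<close>.\<close>

lemma CA_eq_orbit: "CA = Coprod T U (orbit T G_A)"
proof
  have "a \<in> Coprod T U (orbit T G_A)" if a: "a \<in> A" for a
  proof (rule in_orbit_G_A)
    show "a \<in> Ob T" using a A_compact compact_Ob by blast
    show "hom_zero T (shift T i G_B) a" for i
      using B_A[OF triangulated_subcat_shift[OF B_triangulated G_B] a] .
  qed
  then show "CA \<subseteq> Coprod T U (orbit T G_A)" using Coprod_mono by blast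
qed (fact orbit_G_A)

lemma CA_perp: assumes C: "C \<in> right_perp T (orbit T G_A)" and X: "X \<in> CA" shows "hom_zero T X C"
proof (rule Coprod_hom_zero_left)
  show "X \<in> Coprod T U (orbit T G_A)" using X CA_eq_orbit by simp
qed (use C in \<open>auto simp: right_perp_def\<close>)

text \<open>Localizing at \<open>G_B\<close> leaves a cone orthogonal to all shifts of
  \<open>G_B\<close>, which \<open>in_orbit_G_A\<close> places in \<open>CA\<close>.\<close>

lemma decomposition:
  assumes F: "F \<in> Ob T"
  obtains b a where "b \<in> CB" "a \<in> CA" "tri T b F a"
proof -
  obtain X Y where t: "tri T X F Y" and X: "X \<in> Coprod T U (orbit T G_B)" and Y: "Y \<in> right_perp T (orbit T G_B)"
    using localization_orbit[OF G_B_compact F] .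
  have "Y \<in> CA" using in_orbit_G_A[of Y] orbit_G_A Y right_perpD[OF Y] tri_Ob[OF t] by blast
  then show thesis using that X orbit_G_B t by blast
qed

text \<open>The third localising subcategory \<open>CA\<^sup>\<bottom>\<close> makes the functor \<open>D \<mapsto> a\<close> a left adjoint:
  \<open>Hom(a, Y) = Hom(a, X) = Hom(D, X)\<close>, where \<open>X\<close> is the coreflection of \<open>Y\<close> in \<open>CA\<close>. Boundedness
  of the compact object \<open>G_A\<close> bounds \<open>X\<close> in terms of \<open>Y\<close>.\<close>

lemma reflection_co_t_ge:
  obtains c where "\<And>m b D a. \<lbrakk>D \<in> co_t_ge T G m; b \<in> CB; a \<in> CA; tri T b D a\<rbrakk> \<Longrightarrow> a \<in> co_t_ge T G (m - c)"
proof -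
  obtain c where c: "\<And>Y j. Y \<in> perp_le T G (c + j) \<Longrightarrow> hom_zero T (shift T j G_A) Y"
    using compact_perp_le[OF G_A_compact] by blast
  show thesis
  proof (rule that[of c])
    fix m b D a assume D: "D \<in> co_t_ge T G m" and b: "b \<in> CB" and a: "a \<in> CA" and t: "tri T b D a"
    have O: "b \<in> Ob T" "D \<in> Ob T" "a \<in> Ob T" using t tri_Ob by auto
    have t': "tri T D a (ShO T b)" using t tri_rotate O by blast
    have "hom_zero T a Y" if Y: "Y \<in> perp_le T G (1 - (m - c))" for Y
    proof -
      have YO: "Y \<in> Ob T" using Y perp_le_iff by blast
      obtain X C where u: "tri T X Y C" and X: "X \<in> Coprod T U (orbit T G_A)" and C: "C \<in> right_perp T (orbit T G_A)"
        using localization_orbit[OF G_A_compact YO] .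
      have XA: "X \<in> CA" using X orbit_G_A by blast
      have XO: "X \<in> Ob T" "C \<in> Ob T" using u tri_Ob by auto
      let ?C = "shift T (- 1) C"
      have CO: "?C \<in> Ob T" "ShO T ?C = C" using XO shift_m1_Ob ShO_shift_m1 by auto
      have u': "tri T ?C X Y" using u tri_rotate[OF CO(1)] CO(2) by simp
      have GB: "G_B \<in> CB" using G_B by (rule Coprod.base)
      \<comment> \<open>The part \<open>G_B\<close> has no morphisms to \<open>X\<close>, which lies
        in \<open>CA\<close>. The part \<open>G_A\<close> sees \<open>X\<close> only through
        \<open>Y\<close>, since it is orthogonal to every shift of \<open>C\<close>.\<close>
      have "hom_zero T (shift T i G) X" if i: "i \<le> 1 - m" for i
      proof (rule hom_zero_shift_G)
        show "hom_zero T (shift T i G_B) X" by (rule CB_CA_shift[OF GB XA])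
        \<comment> \<open>The inequality c + i \<le> 1 - (m - c) is i \<le> 1 - m, exactly the range
          against which \<open>D\<close> is tested.\<close>
        have "Y \<in> perp_le T G (c + i)" using Y perp_le_mono[of "c + i" "1 - (m - c)" G] i by auto
        then have "hom_zero T (shift T i G_A) Y" by (rule c)
        moreover have GO: "G_A \<in> Ob T" using compact_Ob[OF G_A_compact] .
        have "hom_zero T (shift T (i + 1) G_A) C" using right_perpD[OF C] by blast
        then have "hom_zero T (shift T i G_A) ?C"
          using hom_zero_ShO[OF shift_Ob[OF GO] CO(1), of i] CO(2) shift_Suc[OF GO] by simp
        ultimately show "hom_zero T (shift T i G_A) X" using tri_hom_zero_right[OF u'] by blast
      qed
      then have "X \<in> perp_le T G (1 - m)" using XO perp_le_iff by blast
      then have "hom_zero T D X" using D co_t_ge_iff[OF G_Ob] by blast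
      moreover have "hom_zero T (ShO T b) X" using CB_CA_shift[OF b XA, of 1] by (simp add: shift_1)
      ultimately have "hom_zero T a X" using tri_hom_zero_left[OF t'] by blast
      then show ?thesis using tri_hom_zero_right[OF u] CA_perp[OF C a] by blast
    qed
    then show "a \<in> co_t_ge T G (m - c)" using co_t_ge_iff[OF G_Ob] O by blast
  qed
qed

text \<open>Decompositions of \<open>E\<close> and \<open>D\<close> merge into one of
  \<open>F\<close>, which uniqueness identifies with the given one. As \<open>E\<close> is
  decomposed among the compact objects, its component a1 lies in \<open>A\<close> itself.\<close>

lemma decomposition_reflection:
  assumes u: "tri T E F D" and E: "E \<in> compact_objects T U" and t: "tri T b F a" "b \<in> CB" "a \<in> CA"
  obtains a1 b2 a2 where "a1 \<in> A" "b2 \<in> CB" "a2 \<in> CA" "tri T b2 D a2" "tri T a1 a a2"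
proof -
  have sb: "ShO T x \<in> CB" if "x \<in> CB" for x
    using triangulated_subcatD(4)[OF CB_triangulated that] by (simp add: shift_1)
  obtain b1 a1 where 1: "b1 \<in> B" "a1 \<in> A" "tri T b1 E a1"
    using semiorthogonal_decomposition_tri[OF sod E] by blast
  have DO: "D \<in> Ob T" using u tri_Ob by blast
  obtain b2 a2 where 2: "b2 \<in> CB" "a2 \<in> CA" "tri T b2 D a2" using decomposition[OF DO] by blast
  have 3: "b1 \<in> CB" "a1 \<in> CA" using 1 by (auto intro: Coprod.base)
  have "ShO T a1 \<in> CA" using triangulated_subcatD(4)[OF CA_triangulated 3(2)] by (simp add: shift_1)
  then have "hom_zero T b2 (ShO T a1)" using CB_CA 2(1) by blast
  then obtain b' a' where 4: "tri T b' F a'" "tri T b1 b' b2" "tri T a1 a' a2"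
    using tri_merge[OF u 1(3) 2(3)] by blast
  have b': "b' \<in> CB" using triangulated_subcat_ext[OF CB_triangulated 4(2)] 3 2 by blast
  have a': "a' \<in> CA" using triangulated_subcat_ext[OF CA_triangulated 4(3)] 3 2 by blast
  have "isomorphic T a' a"
    by (rule decomposition_unique[OF 4(1) t(1)]) (use CB_CA sb t(2,3) a' b' in auto)
  then have "tri T a1 a a2" using tri_iso[OF 4(3) isomorphic_refl _ isomorphic_refl] tri_Ob[OF 4(3)] by blast
  then show thesis using that 1(2) 2 by blast
qed

lemma reflection_T_plus_c:
  assumes F: "F \<in> T_plus_c T U G" and ba: "b \<in> CB" "a \<in> CA" and t: "tri T b F a"
  shows "a \<in> T_plus_c T U G"
proof -
  obtain c where c: "\<And>m b D a. \<lbrakk>D \<in> co_t_ge T G m; b \<in> CB; a \<in> CA; tri T b D a\<rbrakk> \<Longrightarrow> a \<in> co_t_ge T G (m - c)"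
    using reflection_co_t_ge by blast
  have aO: "a \<in> Ob T" using t tri_Ob by blast
  show ?thesis
    unfolding T_plus_c_iff
  proof (intro conjI allI aO)
    fix n
    \<comment> \<open>Starting at level n + c compensates for the loss of c under
      reflection.\<close>
    obtain E D where E: "E \<in> compact_objects T U" and D: "D \<in> co_t_ge T G (n + c)" and u: "tri T E F D"
      using F T_plus_c_iff by blast
    obtain a1 b2 a2 where r: "a1 \<in> A" "b2 \<in> CB" "a2 \<in> CA" "tri T b2 D a2" "tri T a1 a a2"
      using decomposition_reflection[OF u E t ba] by blast
    have "a2 \<in> co_t_ge T G n" using c[OF D r(2-4)] by simp
    then show "\<exists>E \<in> compact_objects T U. \<exists>D \<in> co_t_ge T G n. tri T E a D" using r A_compact by blast
  qed
qed

text \<open>Only the component in \<open>CA\<close> has to be controlled: the other one is the fibre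
  of F -> a and stays in \<open>S\<close> with it.\<close>

lemma semiorthogonal_decomposition_restrict:
  assumes S: "triangulated_subcat T S"
    and refl: "\<And>F b a. \<lbrakk>F \<in> S; b \<in> CB; a \<in> CA; tri T b F a\<rbrakk> \<Longrightarrow> a \<in> S"
  shows "semiorthogonal_decomposition T S (CA \<inter> S) (CB \<inter> S)"
proof (rule semiorthogonal_decompositionI[OF S])
  show "triangulated_subcat T (CA \<inter> S)" "triangulated_subcat T (CB \<inter> S)"
    using triangulated_subcat_Int CA_triangulated CB_triangulated S by blast+
  fix F assume F: "F \<in> S"
  then have "F \<in> Ob T" using triangulated_subcatD(1)[OF S] by blast
  then obtain b a where ba: "b \<in> CB" "a \<in> CA" "tri T b F a" using decomposition by blast
  then have "a \<in> S" using refl[OF F] by blast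
  moreover have "b \<in> S" using triangulated_subcat_fibre[OF S ba(3) F \<open>a \<in> S\<close>] .
  ultimately show "\<exists>b\<in>CB \<inter> S. \<exists>a\<in>CA \<inter> S. tri T b F a" using ba by blast
qed (use CB_CA in auto)

text \<open>The fibre of the unit from \<open>G\<close> to its reflection in \<open>B\<close>. The
  universal property of the unit, at b and at its desuspension, is what makes this fibre left
  orthogonal to \<open>B\<close>.\<close>

lemma left_perp_decomposition:
  assumes adm: "admissible T (compact_objects T U) B"
  obtains c L where "L \<in> B" "c \<in> compact_objects T U" "tri T c G L" "\<And>b. b \<in> B \<Longrightarrow> hom_zero T c b"
proof -
  have CO: "compact_objects T U \<subseteq> Ob T" using compact_Ob by blast
  obtain L \<eta> where L: "L \<in> B" and \<eta>: "\<eta> \<in> Hom T G L"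
    and bij: "\<And>b. b \<in> B \<Longrightarrow> bij_betw (\<lambda>f. f \<cdot> \<eta>) (Hom T L b) (Hom T G b)"
    using left_adjoint_unit[of B "compact_objects T U" G] adm B_compact CO generator_compact
    unfolding admissible_def by metis
  obtain V k l where t: "triangle T G L V \<eta> k l" using TR1_cone[OF \<eta>] by blast
  note O = triangle_Ob[OF t]
  let ?c = "shift T (- 1) V"
  have c: "?c \<in> Ob T" "ShO T ?c = V" using O shift_m1_Ob ShO_shift_m1 by auto
  have "tri T G L V" using t unfolding tri_def by blast
  then have tc: "tri T ?c G L" using tri_rotate[OF c(1)] c(2) by simp
  have z: "hom_zero T V b" if b: "b \<in> B" for b
  proof -
    have bO: "b \<in> Ob T" using b B_compact CO by blast
    show ?thesis
    proof (rule hom_zeroI[OF O(3) bO])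
      fix u assume u: "u \<in> Hom T V b"
      have uk: "u \<cdot> k \<in> Hom T L b" using comp_hom[OF O(5) u] .
      \<comment> \<open>Injectivity of composition with the unit at b kills
        \<open>u \<cdot> k\<close>, so \<open>u\<close> factors through the boundary map
        \<open>l\<close>.\<close>
      have "(u \<cdot> k) \<cdot> \<eta> = Zero T L b \<cdot> \<eta>"
        using comp_assoc[OF O(4,5) u] triangle_comp_zero[OF t] comp_zero[OF u O(1)] zero_comp[OF O(4) bO] by simp
      then have "u \<cdot> k = Zero T L b"
        using bij_betw_imp_inj_on[OF bij[OF b]] uk zero_hom[OF O(2) bO] by (auto dest: inj_onD)
      then obtain v where v: "v \<in> Hom T (ShO T G) b" "v \<cdot> l = u" using triangle_extend2[OF t u] by blast
      \<comment> \<open>Surjectivity at the desuspension of b factors \<open>v\<close> through the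
        suspended unit, whose composite with \<open>l\<close> vanishes.\<close>
      let ?b = "shift T (- 1) b"
      have b': "?b \<in> B" "?b \<in> Ob T" "ShO T ?b = b"
        using triangulated_subcatD(5)[OF B_triangulated b] bO shift_m1_Ob ShO_shift_m1 by auto
      obtain v' where v': "v' \<in> Hom T G ?b" "v = ShA T v'" using ShA_surj[OF O(1) b'(2)] v(1) b'(3) by metis
      have "v' \<in> (\<lambda>f. f \<cdot> \<eta>) ` Hom T L ?b" using bij_betw_imp_surj_on[OF bij[OF b'(1)]] v'(1) by simp
      then obtain w where w: "w \<in> Hom T L ?b" "w \<cdot> \<eta> = v'" by auto
      have "v = ShA T w \<cdot> ShA T \<eta>" using ShA_comp[OF O(4) w(1)] w(2) v'(2) by simp
      then have "u = ShA T w \<cdot> (ShA T \<eta> \<cdot> l)"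
        using v(2) comp_assoc[OF O(6) ShA_hom[OF O(4)] ShA_hom[OF w(1)]] by simp
      then show "u = Zero T V b"
        using triangle_comp_zero3[OF t] comp_zero[OF ShA_hom[OF w(1)] O(3)] b'(3) by simp
    qed
  qed
  have "hom_zero T ?c b" if b: "b \<in> B" for b
    using z[of "ShO T b"] triangulated_subcatD(4)[OF B_triangulated b] hom_zero_ShO[OF c(1), of b] c(2)
      b B_compact CO by (auto simp: shift_1)
  moreover have "V \<in> compact_objects T U"
    using triangulated_subcatD(3)[OF compact_subcat, of G L V] t generator_compact L B_compact
    unfolding tri_def by blast
  ultimately show thesis using that[of L ?c] L tc compact_shift by blast
qed

text \<open>Boundedness is proved for b and then passes to a by the triangle. \<open>G\<close> is an
  extension of L by c: the part c sees no object of \<open>CB\<close>, being compact and orthogonal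
  to \<open>B\<close>, and the part L sees b only through \<open>F\<close>, being orthogonal to all
  shifts of a.\<close>

lemma reflection_T_b_c:
  assumes bounded: "\<exists>N. \<forall>i\<ge>N. hom_zero T (shift T i G) G"
    and adm: "admissible T (compact_objects T U) B"
    and F: "F \<in> T_b_c T U G" and b: "b \<in> CB" and a: "a \<in> CA" and t: "tri T b F a"
  shows "a \<in> T_b_c T U G"
proof -
  let ?S = "{F \<in> Ob T. \<exists>N. \<forall>i\<le>N. hom_zero T (shift T i G) F}"
  have O: "b \<in> Ob T" "F \<in> Ob T" "a \<in> Ob T" using t tri_Ob by auto
  have F': "F \<in> T_plus_c T U G" "F \<in> ?S" using F T_b_c_eq by auto
  obtain c L where L: "L \<in> B" and c: "c \<in> compact_objects T U" "tri T c G L" and z: "\<And>b. b \<in> B \<Longrightarrow> hom_zero T c b"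
    using left_perp_decomposition[OF adm] by blast
  have LO: "L \<in> Ob T" and cO: "c \<in> Ob T" using c tri_Ob by auto
  obtain m where m: "\<And>Y j. Y \<in> perp_le T G (m + j) \<Longrightarrow> hom_zero T (shift T j L) Y"
    using compact_perp_le[of L] L B_compact by blast
  obtain N where "\<And>i. i \<le> N \<Longrightarrow> hom_zero T (shift T i G) F" using F' by blast
  then have N: "F \<in> perp_le T G N" using perp_le_iff O by blast
  \<comment> \<open>The constant m bounds the compact object L, and i \<le> N - m puts
    \<open>F\<close> into \<open>perp_le T G (m + i)\<close>.\<close>
  have "hom_zero T (shift T i G) b" if i: "i \<le> N - m" for i
  proof -
    let ?a = "shift T (- 1) a"
    have a': "?a \<in> CA" using triangulated_subcatD(5)[OF CA_triangulated a] .
    have "tri T ?a b F" using t tri_rotate[of ?a b F] shift_m1_Ob ShO_shift_m1 O by simp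
    moreover have "hom_zero T (shift T i L) F"
      using m[of F i] N perp_le_mono[of "m + i" N G] i by auto
    moreover have "hom_zero T (shift T i L) ?a" using CB_CA_shift[OF Coprod.base[OF L] a'] .
    ultimately have "hom_zero T (shift T i L) b" using tri_hom_zero_right by blast
    moreover have "hom_zero T (shift T i c) b"
    proof -
      have "shift T (- i) b \<in> CB" using triangulated_subcat_shift[OF CB_triangulated b] .
      then have "hom_zero T c (shift T (- i) b)" using Coprod_hom_zero_right[OF c(1) z] by blast
      then show ?thesis using hom_zero_shift_left[OF cO O(1)] by simp
    qed
    moreover have "tri T (shift T i c) (shift T i G) (shift T i L)" using c(2) tri_shift cO G_Ob LO by blast
    ultimately show ?thesis using tri_hom_zero_left by blast
  qed
  then have "b \<in> ?S" using O by blast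
  then have "a \<in> ?S" using triangulated_subcatD(3)[OF bounded_triangulated[OF G_Ob] t] F' by blast
  then show ?thesis using reflection_T_plus_c[OF F'(1) b a t] T_b_c_eq by blast
qed

end

theorem theorem3:
  fixes T :: "('o, 'm) tricat" and U :: "'i set set" and G :: 'o and A B :: "'o set"
  assumes "compactly_generated T U G"
    and "\<exists>N. \<forall>i\<ge>N. hom_zero T (shift T i G) G"
    and "semiorthogonal_decomposition T (compact_objects T U) A B"
  shows "semiorthogonal_decomposition T (T_plus_c T U G)
           (Coprod T U A \<inter> T_plus_c T U G) (Coprod T U B \<inter> T_plus_c T U G) \<and>
         (admissible T (compact_objects T U) B \<longrightarrow>
           semiorthogonal_decomposition T (T_b_c T U G)
             (Coprod T U A \<inter> T_b_c T U G) (Coprod T U B \<inter> T_b_c T U G))"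
proof -
  interpret compactly_generated T U G by fact
  have "triangulated_subcat T (compact_objects T U)"
    using assms(3) unfolding semiorthogonal_decomposition_def by blast
  then interpret compact_sod T U G A B
    using assms(3) by unfold_locales
  show ?thesis
  proof (intro conjI impI)
    show "semiorthogonal_decomposition T (T_plus_c T U G) (CA \<inter> T_plus_c T U G) (CB \<inter> T_plus_c T U G)"
      by (rule semiorthogonal_decomposition_restrict[OF T_plus_c_triangulated[OF assms(2)] reflection_T_plus_c])
    assume adm: "admissible T (compact_objects T U) B"
    show "semiorthogonal_decomposition T (T_b_c T U G) (CA \<inter> T_b_c T U G) (CB \<inter> T_b_c T U G)"
      by (rule semiorthogonal_decomposition_restrict[OF T_b_c_triangulated[OF assms(2)] reflection_T_b_c[OF assms(2) adm]])
  qed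
qed

end
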